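(* Let $K$ be a finite extension of $\mathbb{Q}_p$, $p$ odd, and let $C/K:y^2=f(x)$ be a hyperelliptic curve with $f\in K[x]$ monic squarefree, having tame reduction, so that the inertia group $I$ of $K(\mathcal{R})/K$ is tame (hence cyclic). Let $\mathfrak{s}$ be a proper cluster and suppose $\gamma_{\mathfrak{s}}$ has order $t$. Then $$\operatorname{Ind}_{I_{\mathfrak{s}}}^I V_{\mathfrak{s}}=\left\lfloor\tfrac{|\mathfrak{s}^{odd}|}{n'_{\mathfrak{s}}}\right\rfloor\bigoplus_{d\mid n'_{\mathfrak{s}}}\bigoplus_{s\in S_{d,t}}\bigoplus_{n_1\mid \frac{n_{\mathfrak{s}}}{\gcd(n_{\mathfrak{s}},s^\infty)}}\alpha_{d,t,s}\beta(n_{\mathfrak{s}},s)\rho_{s\gcd(n_{\mathfrak{s}},s^\infty)n_1}\ \oplus\ \left(|\mathfrak{s}^{odd}|-n'_{\mathfrak{s}}\left\lfloor\tfrac{|\mathfrak{s}^{odd}|}{n'_{\mathfrak{s}}}\right\rfloor-1\right)\frac{\beta(n_{\mathfrak{s}},t)}{\varphi(t)}\bigoplus_{n_2\mid\frac{n_{\mathfrak{s}}}{\gcd(n_{\mathfrak{s}},t^\infty)}}\rho_{tn_2\gcd(n_{\mathfrak{s}},t^\infty)}\ \ominus\ \operatorname{Ind}_{I_{\mathfrak{s}}}^I\varepsilon_{\mathfrak{s}},$$ where $\operatorname{Ind}_{I_{\mathfrak{s}}}^I\varepsilon_{\mathfrak{s}}=0$ if $\varepsilon_{\mathfrak{s}}=0$;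 $=\bigoplus_{m\mid n_{\mathfrak{s}}}\rho_m$ if $\varepsilon_{\mathfrak{s}}$ is trivial; and $=\bigoplus_{m\mid 2n_{\mathfrak{s}},\ m\nmid n_{\mathfrak{s}}}\rho_m$ if $\varepsilon_{\mathfrak{s}}$ has order $2$.
   Context: $v$: valuation on $\overline K$ with $v(K^\times)=\mathbb{Z}$; $\mathcal{R}$: roots of $f$; clusters: nonempty $\mathcal{R}\cap\{x: v(x-z)\ge\delta\}$ ($z\in\overline K,\delta\in\mathbb{Q}$); proper if $|\mathfrak{s}|>1$, depth $d_{\mathfrak{s}}=\min_{r,r'\in\mathfrak{s}}v(r-r')$; children of $\mathfrak{s}$ are maximal clusters properly inside it; $I_{\mathfrak{s}}$ is the stabiliser of $\mathfrak{s}$ in $I$; a cluster is odd/even according to $|\mathfrak{s}|$. $\operatorname{denom}(a/b)=b$ ($\gcd(a,b)=1,b>0$). Invariants of a proper cluster $\mathfrak{s}$: $\mathfrak{s}^{odd}$ = set of odd children; $\mu_{\mathfrak{s}}=\sum_{r\in\mathcal{R}\setminus\mathfrak{s}}v(r-r_0)$ for any $r_0\in\mathfrak{s}$; $\lambda_{\mathfrak{s}}=\frac12[I:I_{\mathfrak{s}}](\mu_{\mathfrak{s}}+d_{\mathfrak{s}}|\mathfrak{s}^{odd}|)$; $\gamma_{\mathfrak{s}}$ is any character of $I_{\mathfrak{s}}$ of order equal to the prime-to-$p$ part of $\operatorname{denom}\lambda_{\mathfrak{s}}$ (trivial if $\lambda_{\mathfrak{s}}=0$); $\varepsilon_{\mathfrak{s}}$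 is the zero representation of $I_{\mathfrak{s}}$ if $|\mathfrak{s}|$ is odd, the trivial character if $|\mathfrak{s}|$ is even and $v_2([I:I_{\mathfrak{s}}]\mu_{\mathfrak{s}})\ge1$, and the order-two character of $I_{\mathfrak{s}}$ if $|\mathfrak{s}|$ is even and $v_2([I:I_{\mathfrak{s}}]\mu_{\mathfrak{s}})<1$; $V_{\mathfrak{s}}=\gamma_{\mathfrak{s}}\otimes(\mathbb{C}[\mathfrak{s}^{odd}]\ominus\mathbb{1})\ominus\varepsilon_{\mathfrak{s}}$ (virtual $I_{\mathfrak{s}}$-representation; $\mathbb{C}[\mathfrak{s}^{odd}]$ the permutation representation). $n_{\mathfrak{s}}=[I:I_{\mathfrak{s}}]$, $n'_{\mathfrak{s}}=\operatorname{denom}(d_{\mathfrak{s}}n_{\mathfrak{s}})$. $\varphi$ is Euler's function; $\rho_m$ is the direct sum of all characters of $I$ of order $m$; for $a\in\mathbb{Q}$, $a\rho_m$ means a sum of $a\varphi(m)$ distinct characters of order $m$, and the displayed identity asserts that for every $m$ the signed number of constituent characters of order $m$ of the left side equals $\varphi(m)$ times the total coefficient of $\rho_m$ on the right. $\gcd(n,d^\infty)=\lim_{k\to\infty}\gcd(n,d^k)$. $A_{d,t}=\{q\text{ prime}: v_q(d)=v_q(t)>0\}$; $S_{d,t}=\{\operatorname{lcm}(d,t)/\prod_{q_i\in A_{d,t}}q_i^{m_i}: 0\le m_i\le v_{q_i}(t)\}$; $Q_{q,k}(s)=\frac{q-2}{q-1}$ if $v_q(s)=k$ and $1$ otherwise;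 $\alpha_{d,t,s}=\frac{\varphi(d)}{\varphi(\operatorname{lcm}(d,t))}\prod_{q_i\in A_{d,t}}Q_{q_i,v_{q_i}(t)}(s)$; $\beta(n,s)=\frac{\gcd(n,s^\infty)\varphi(s)}{\varphi(s\gcd(n,s^\infty))}$. *)

theory Defs
  imports
    "HOL-Algebra.Algebraic_Closure_Type"
    "HOL-Algebra.Generated_Fields"
    "HOL-Algebra.Embedded_Algebras"
    "HOL-Algebra.Coset"
    "HOL-Algebra.Bij"
    "HOL-Number_Theory.Totient"
    "HOL-Library.Function_Algebras"
begin

section \<open>Valuations and finite extensions of the $p$-adic numbers\<close>

text \<open>
  A valuation is a function on the nonzero elements; the convention $v(0) = \infty$ is spelled out
  wherever an argument can vanish, and the value of the function at 0 is never used.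
\<close>

definition is_valuation :: "('a::field \<Rightarrow> rat) \<Rightarrow> bool" where
  "is_valuation v \<longleftrightarrow>
     (\<forall>x y. x \<noteq> 0 \<longrightarrow> y \<noteq> 0 \<longrightarrow> v (x * y) = v x + v y) \<and>
     (\<forall>x y. x \<noteq> 0 \<longrightarrow> y \<noteq> 0 \<longrightarrow> x + y \<noteq> 0 \<longrightarrow> v (x + y) \<ge> min (v x) (v y))"

definition close_to :: "('a::field \<Rightarrow> rat) \<Rightarrow> rat \<Rightarrow> 'a \<Rightarrow> 'a \<Rightarrow> bool" where
  "close_to v \<delta> x z \<longleftrightarrow> x = z \<or> v (x - z) \<ge> \<delta>"

definition denom :: "rat \<Rightarrow> nat" where
  "denom q = nat (snd (quotient_of q))"

definition rat_val :: "nat \<Rightarrow> rat \<Rightarrow> int" where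
  "rat_val p q = int (multiplicity (int p) (fst (quotient_of q)))
               - int (multiplicity (int p) (snd (quotient_of q)))"

definition val_complete :: "('a::field \<Rightarrow> rat) \<Rightarrow> 'a set \<Rightarrow> bool" where
  "val_complete v F \<longleftrightarrow>
     (\<forall>u :: nat \<Rightarrow> 'a. range u \<subseteq> F \<longrightarrow>
        (\<forall>\<delta>. \<exists>k. \<forall>m\<ge>k. \<forall>n\<ge>k. close_to v \<delta> (u m) (u n)) \<longrightarrow>
        (\<exists>l\<in>F. \<forall>\<delta>. \<exists>k. \<forall>n\<ge>k. close_to v \<delta> (u n) l))"

text \<open>
  The field $\mathbb{Q}_p$ is the completion of $\mathbb{Q}$ with respect to the $p$-adic
  valuation. The factor \<open>e\<close> allows for a different normalisation: if \<open>v\<close> is normalised on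
  an extension of $\mathbb{Q}_p$, then \<open>e\<close> is the ramification index.
\<close>

definition is_Qp :: "nat \<Rightarrow> ('a::field_char_0 \<Rightarrow> rat) \<Rightarrow> 'a set \<Rightarrow> bool" where
  "is_Qp p v F \<longleftrightarrow>
     subfield F ring_of_type_algebra \<and>
     (\<exists>e>0. \<forall>q. q \<noteq> 0 \<longrightarrow> v (of_rat q) = e * of_int (rat_val p q)) \<and>
     (\<forall>x\<in>F. \<forall>\<delta>. \<exists>q. close_to v \<delta> (of_rat q) x) \<and>
     val_complete v F"

definition finite_extension_of_Qp :: "nat \<Rightarrow> ('a::field_char_0 \<Rightarrow> rat) \<Rightarrow> bool" where
  "finite_extension_of_Qp p v \<longleftrightarrow>
     (\<exists>F. is_Qp p v F \<and> ring.finite_dimension (ring_of_type_algebra :: 'a ring) F UNIV)"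


section \<open>Galois and inertia groups\<close>

text \<open>
  The base field $K$ is the type \<open>'k\<close> and its algebraic closure is \<open>'k alg_closure\<close>;
  extensions of $K$ are subfields of the latter that contain \<open>range to_ac\<close>.
\<close>

definition gal :: "('k::field) alg_closure set \<Rightarrow> ('k alg_closure \<Rightarrow> 'k alg_closure) set" where
  "gal L = {\<sigma> \<in> Bij L. (\<forall>x\<in>L. \<forall>y\<in>L. \<sigma> (x + y) = \<sigma> x + \<sigma> y \<and> \<sigma> (x * y) = \<sigma> x * \<sigma> y) \<and>
                         (\<forall>c. \<sigma> (to_ac c) = to_ac c)}"

definition finite_galois :: "('k::field) alg_closure set \<Rightarrow> bool" where
  "finite_galois L \<longleftrightarrow>
     subfield L ring_of_type_algebra \<and> range to_ac \<subseteq> L \<and>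
     ring.finite_dimension (ring_of_type_algebra :: 'k alg_closure ring) (range to_ac) L \<and>
     (\<forall>x\<in>L. (\<forall>\<sigma>\<in>gal L. \<sigma> x = x) \<longrightarrow> x \<in> range to_ac)"

definition inertia :: "(('k::field) alg_closure \<Rightarrow> rat) \<Rightarrow> 'k alg_closure set
    \<Rightarrow> ('k alg_closure \<Rightarrow> 'k alg_closure) set" where
  "inertia v L = {\<sigma> \<in> gal L. \<forall>x\<in>L. x = 0 \<or> v x \<ge> 0 \<longrightarrow> \<sigma> x = x \<or> v (\<sigma> x - x) > 0}"

definition inertia_group :: "(('k::field) alg_closure \<Rightarrow> rat) \<Rightarrow> 'k alg_closure set
    \<Rightarrow> ('k alg_closure \<Rightarrow> 'k alg_closure) monoid" where
  "inertia_group v L = (BijGroup L)\<lparr>carrier := inertia v L\<rparr>"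

definition tame :: "nat \<Rightarrow> (('k::field) alg_closure \<Rightarrow> rat) \<Rightarrow> 'k alg_closure set \<Rightarrow> bool" where
  "tame p v L \<longleftrightarrow> \<not> p dvd card (inertia v L)"

definition roots :: "('k::field) poly \<Rightarrow> 'k alg_closure set" where
  "roots f = {x. poly (map_poly to_ac f) x = 0}"

definition split_field :: "('k::field) poly \<Rightarrow> 'k alg_closure set" where
  "split_field f = generate_field ring_of_type_algebra (range to_ac \<union> roots f)"

text \<open>
  For $p$ odd, $y^2 = f(x)$ acquires semistable reduction over a tame extension of $K$ if and only
  if $K(\mathcal{R})/K$ is tame; the latter is the form in which tameness enters here.
\<close>

definition tame_reduction :: "nat \<Rightarrow> (('k::field) alg_closure \<Rightarrow> rat) \<Rightarrow> 'k poly \<Rightarrow> bool" where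
  "tame_reduction p v f \<longleftrightarrow> tame p v (split_field f)"


section \<open>Clusters\<close>

definition is_cluster :: "('a::field \<Rightarrow> rat) \<Rightarrow> 'a set \<Rightarrow> 'a set \<Rightarrow> bool" where
  "is_cluster v R \<ss> \<longleftrightarrow> \<ss> \<noteq> {} \<and> (\<exists>z \<delta>. \<ss> = R \<inter> {x. close_to v \<delta> x z})"

definition proper_cluster :: "('a::field \<Rightarrow> rat) \<Rightarrow> 'a set \<Rightarrow> 'a set \<Rightarrow> bool" where
  "proper_cluster v R \<ss> \<longleftrightarrow> is_cluster v R \<ss> \<and> card \<ss> > 1"

definition depth :: "('a::field \<Rightarrow> rat) \<Rightarrow> 'a set \<Rightarrow> rat" where
  "depth v \<ss> = Min {v (r - r') | r r'. r \<in> \<ss> \<and> r' \<in> \<ss> \<and> r \<noteq> r'}"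

definition children :: "('a::field \<Rightarrow> rat) \<Rightarrow> 'a set \<Rightarrow> 'a set \<Rightarrow> 'a set set" where
  "children v R \<ss> = {c. is_cluster v R c \<and> c \<subset> \<ss> \<and> \<not> (\<exists>c'. is_cluster v R c' \<and> c \<subset> c' \<and> c' \<subset> \<ss>)}"

definition odd_children :: "('a::field \<Rightarrow> rat) \<Rightarrow> 'a set \<Rightarrow> 'a set \<Rightarrow> 'a set set" where
  "odd_children v R \<ss> = {c \<in> children v R \<ss>. odd (card c)}"

definition mu :: "('a::field \<Rightarrow> rat) \<Rightarrow> 'a set \<Rightarrow> 'a set \<Rightarrow> rat" where
  "mu v R \<ss> = (\<Sum>r\<in>R - \<ss>. v (r - (SOME r0. r0 \<in> \<ss>)))"

lemma is_valuation_one: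
  assumes "is_valuation v" shows "v 1 = 0"
proof -
  have "v (1 * 1) = v 1 + v 1"
    using assms unfolding is_valuation_def by (metis one_neq_zero)
  then show ?thesis by simp
qed

lemma is_valuation_minus:
  assumes v: "is_valuation v" and x: "x \<noteq> 0" shows "v (- x) = v x"
proof -
  have "v ((-1) * (-1)) = v (-1) + v (-1)"
    using v unfolding is_valuation_def by (metis neg_equal_0_iff_equal one_neq_zero)
  then have "v (-1) = 0" using is_valuation_one[OF v] by simp
  moreover have "v ((-1) * x) = v (-1) + v x"
    using v x unfolding is_valuation_def by (metis neg_equal_0_iff_equal one_neq_zero)
  ultimately show ?thesis by simp
qed

lemma close_to_sym: "is_valuation v \<Longrightarrow> close_to v \<delta> x y \<Longrightarrow> close_to v \<delta> y x"
  unfolding close_to_def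
  by (metis is_valuation_minus minus_diff_eq right_minus_eq)

lemma close_to_trans:
  assumes v: "is_valuation v" and xy: "close_to v \<delta> x y" and yz: "close_to v \<delta> y z"
  shows "close_to v \<delta> x z"
proof (cases "x = y \<or> y = z \<or> x = z")
  case True
  then show ?thesis using xy yz by (auto simp: close_to_def)
next
  case False
  then have "v ((x - y) + (y - z)) \<ge> min (v (x - y)) (v (y - z))"
    using v unfolding is_valuation_def by (metis diff_add_cancel eq_iff_diff_eq_0 add_diff_eq)
  then show ?thesis using False xy yz by (auto simp: close_to_def)
qed

lemma mu_eq:
  assumes v: "is_valuation v" and s: "is_cluster v R \<ss>" and r0: "r0 \<in> \<ss>"
  shows "mu v R \<ss> = (\<Sum>r\<in>R - \<ss>. v (r - r0))"
proof -
  obtain z \<delta> where \<ss>: "\<ss> = R \<inter> {x. close_to v \<delta> x z}"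
    using s by (auto simp: is_cluster_def)
  have le: "v (r - a) \<le> v (r - b)" if "a \<in> \<ss>" "b \<in> \<ss>" "r \<in> R - \<ss>" for a b r
  proof (rule ccontr)
    assume less: "\<not> v (r - a) \<le> v (r - b)"
    have ra: "\<not> close_to v \<delta> r a" and rb: "\<not> close_to v \<delta> r b"
      using that \<ss> close_to_trans[OF v] by blast+
    have ab: "close_to v \<delta> a b"
      using that \<ss> close_to_trans[OF v] close_to_sym[OF v] by blast
    have "close_to v (v (r - a)) r a" by (simp add: close_to_def)
    moreover have "close_to v (v (r - a)) a b"
      using ab ra by (auto simp: close_to_def)
    ultimately have "close_to v (v (r - a)) r b" by (rule close_to_trans[OF v])
    then show False using less rb by (auto simp: close_to_def)
  qed
  have "(SOME r0. r0 \<in> \<ss>) \<in> \<ss>" using r0 by (rule someI)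
  then show ?thesis
    unfolding mu_def using le r0 by (intro sum.cong refl antisym) auto
qed

text \<open>
  In the following definitions \<open>L\<close> is a finite Galois extension of $K$ containing the roots and
  $I$ is the inertia group of \<open>L\<close> over $K$. Clusters, stabiliser indices and orbits do not
  depend on \<open>L\<close>. One may take $L = K(\mathcal{R})$, but the stabiliser of a cluster in the inertia
  group of $K(\mathcal{R})/K$ can be too small to have characters of the orders prescribed for
  $\gamma$ and $\varepsilon$ (for instance if all roots lie in $K$), so larger tame \<open>L\<close> are needed.
\<close>

definition stab_group :: "(('k::field) alg_closure \<Rightarrow> rat) \<Rightarrow> 'k alg_closure set
    \<Rightarrow> 'k alg_closure set \<Rightarrow> ('k alg_closure \<Rightarrow> 'k alg_closure) monoid" where
  "stab_group v L \<ss> = (BijGroup L)\<lparr>carrier := {\<sigma> \<in> inertia v L. \<sigma> ` \<ss> = \<ss>}\<rparr>"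

definition cluster_index :: "(('k::field) alg_closure \<Rightarrow> rat) \<Rightarrow> 'k alg_closure set
    \<Rightarrow> 'k alg_closure set \<Rightarrow> nat" where
  "cluster_index v L \<ss> = card (rcosets\<^bsub>inertia_group v L\<^esub> (carrier (stab_group v L \<ss>)))"

definition lambda :: "(('k::field) alg_closure \<Rightarrow> rat) \<Rightarrow> 'k alg_closure set
    \<Rightarrow> 'k alg_closure set \<Rightarrow> 'k alg_closure set \<Rightarrow> rat" where
  "lambda v L R \<ss> = 1 / 2 * of_nat (cluster_index v L \<ss>)
      * (mu v R \<ss> + depth v \<ss> * of_nat (card (odd_children v R \<ss>)))"


section \<open>Complex representations of finite groups\<close>

text \<open>
  Every representation space is a space of functions \<open>'x \<Rightarrow> complex\<close> with pointwise operations.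
\<close>

definition cscale :: "complex \<Rightarrow> ('x \<Rightarrow> complex) \<Rightarrow> 'x \<Rightarrow> complex" where
  "cscale c F = (\<lambda>x. c * F x)"

lemma vector_space_cscale: "vector_space (cscale :: complex \<Rightarrow> ('x \<Rightarrow> complex) \<Rightarrow> _)"
  by unfold_locales (auto simp: cscale_def fun_eq_iff algebra_simps)

record ('g, 'x) repr =
  space :: "('x \<Rightarrow> complex) set"
  act :: "'g \<Rightarrow> ('x \<Rightarrow> complex) \<Rightarrow> ('x \<Rightarrow> complex)"

definition rep_iso :: "('g, 'b) monoid_scheme \<Rightarrow> ('g, 'x) repr \<Rightarrow> ('g, 'y) repr \<Rightarrow> bool" where
  "rep_iso G V W \<longleftrightarrow>
     (\<exists>T. bij_betw T (space V) (space W) \<and>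
          (\<forall>F\<in>space V. \<forall>F'\<in>space V. T (F + F') = T F + T F') \<and>
          (\<forall>c. \<forall>F\<in>space V. T (cscale c F) = cscale c (T F)) \<and>
          (\<forall>g\<in>carrier G. \<forall>F\<in>space V. T (act V g F) = act W g (T F)))"

text \<open>Characters are extended by 0 outside the group so that equal characters are equal functions.\<close>

definition characters :: "('g, 'b) monoid_scheme \<Rightarrow> ('g \<Rightarrow> complex) set" where
  "characters G = {\<chi>. (\<forall>g\<in>carrier G. \<chi> g \<noteq> 0) \<and>
      (\<forall>g\<in>carrier G. \<forall>h\<in>carrier G. \<chi> (g \<otimes>\<^bsub>G\<^esub> h) = \<chi> g * \<chi> h) \<and>
      (\<forall>g. g \<notin> carrier G \<longrightarrow> \<chi> g = 0)}"

definition char_order :: "('g, 'b) monoid_scheme \<Rightarrow> ('g \<Rightarrow> complex) \<Rightarrow> nat" where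
  "char_order G \<chi> = (LEAST k. k > 0 \<and> (\<forall>g\<in>carrier G. \<chi> g ^ k = 1))"

definition chars_of_order :: "('g, 'b) monoid_scheme \<Rightarrow> nat \<Rightarrow> ('g \<Rightarrow> complex) set" where
  "chars_of_order G m = {\<chi> \<in> characters G. char_order G \<chi> = m}"

definition triv_char :: "('g, 'b) monoid_scheme \<Rightarrow> 'g \<Rightarrow> complex" where
  "triv_char G = (\<lambda>g. if g \<in> carrier G then 1 else 0)"

definition zero_rep :: "('g, unit) repr" where
  "zero_rep = \<lparr>space = {0}, act = (\<lambda>g F. F)\<rparr>"

definition char_rep :: "('g \<Rightarrow> complex) \<Rightarrow> ('g, unit) repr" where
  "char_rep \<chi> = \<lparr>space = UNIV, act = (\<lambda>g. cscale (\<chi> g))\<rparr>"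

text \<open>
  The permutation representation on $\mathbb{C}[S]$: identifying $F$ with $\sum_{x \in S} F(x)\,[x]$,
  the element $g$ sends $[y]$ to $[g y]$.
\<close>

definition perm_rep :: "('g \<Rightarrow> 'x \<Rightarrow> 'x) \<Rightarrow> 'x set \<Rightarrow> ('g, 'x) repr" where
  "perm_rep a S = \<lparr>space = {F. \<forall>x. x \<notin> S \<longrightarrow> F x = 0},
                   act = (\<lambda>g F x. \<Sum>y | y \<in> S \<and> a g y = x. F y)\<rparr>"

definition twist :: "('g \<Rightarrow> complex) \<Rightarrow> ('g, 'x) repr \<Rightarrow> ('g, 'x) repr" where
  "twist \<chi> V = \<lparr>space = space V, act = (\<lambda>g F. cscale (\<chi> g) (act V g F))\<rparr>"

definition rep_plus :: "('g, 'x) repr \<Rightarrow> ('g, 'y) repr \<Rightarrow> ('g, 'x + 'y) repr" where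
  "rep_plus V W = \<lparr>space = {F. F \<circ> Inl \<in> space V \<and> F \<circ> Inr \<in> space W},
                   act = (\<lambda>g F. case_sum (act V g (F \<circ> Inl)) (act W g (F \<circ> Inr)))\<rparr>"

definition rep_Sum :: "'i set \<Rightarrow> ('i \<Rightarrow> ('g, 'x) repr) \<Rightarrow> ('g, 'i \<times> 'x) repr" where
  "rep_Sum M V =
     \<lparr>space = {F. \<forall>m. if m \<in> M then (\<lambda>x. F (m, x)) \<in> space (V m) else (\<forall>x. F (m, x) = 0)},
      act = (\<lambda>g F (m, x). if m \<in> M then act (V m) g (\<lambda>y. F (m, y)) x else 0)\<rparr>"

text \<open>
  The induced representation: functions $F \colon G \to V$ with $F(h g) = h F(g)$ for $h \in H$, on
  which $G$ acts by right translation.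
\<close>

definition ind :: "('g, 'b) monoid_scheme \<Rightarrow> ('g, 'b) monoid_scheme \<Rightarrow> ('g, 'x) repr
    \<Rightarrow> ('g, 'g \<times> 'x) repr" where
  "ind G H V =
     \<lparr>space = {F. (\<forall>g\<in>carrier G. (\<lambda>x. F (g, x)) \<in> space V) \<and>
                  (\<forall>g x. g \<notin> carrier G \<longrightarrow> F (g, x) = 0) \<and>
                  (\<forall>h\<in>carrier H. \<forall>g\<in>carrier G.
                     (\<lambda>x. F (h \<otimes>\<^bsub>G\<^esub> g, x)) = act V h (\<lambda>x. F (g, x)))},
      act = (\<lambda>k F (g, x). if g \<in> carrier G then F (g \<otimes>\<^bsub>G\<^esub> k, x) else 0)\<rparr>"

definition rho :: "('g, 'b) monoid_scheme \<Rightarrow> nat \<Rightarrow> ('g, 'g \<Rightarrow> complex) repr" where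
  "rho G m = \<lparr>space = {F. \<forall>\<chi>. \<chi> \<notin> chars_of_order G m \<longrightarrow> F \<chi> = 0},
              act = (\<lambda>g F \<chi>. \<chi> g * F \<chi>)\<rparr>"

definition char_mult :: "('g, 'b) monoid_scheme \<Rightarrow> ('g, 'x) repr \<Rightarrow> ('g \<Rightarrow> complex) \<Rightarrow> nat" where
  "char_mult G V \<chi> =
     vector_space.dim cscale {F \<in> space V. \<forall>g\<in>carrier G. act V g F = cscale (\<chi> g) F}"

definition num_constituents :: "('g, 'b) monoid_scheme \<Rightarrow> ('g, 'x) repr \<Rightarrow> nat \<Rightarrow> nat" where
  "num_constituents G V m = (\<Sum>\<chi>\<in>chars_of_order G m. char_mult G V \<chi>)"

text \<open>A virtual representation is a formal difference, given as a pair.\<close>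

type_synonym ('g, 'x, 'y) virt = "('g, 'x) repr \<times> ('g, 'y) repr"

definition virt_minus :: "('g, 'x, 'y) virt \<Rightarrow> ('g, 'z) repr \<Rightarrow> ('g, 'x, 'y + 'z) virt" where
  "virt_minus V W = (fst V, rep_plus (snd V) W)"

definition virt_twist :: "('g \<Rightarrow> complex) \<Rightarrow> ('g, 'x, 'y) virt \<Rightarrow> ('g, 'x, 'y) virt" where
  "virt_twist \<chi> V = (twist \<chi> (fst V), twist \<chi> (snd V))"

definition virt_ind :: "('g, 'b) monoid_scheme \<Rightarrow> ('g, 'b) monoid_scheme \<Rightarrow> ('g, 'x, 'y) virt
    \<Rightarrow> ('g, 'g \<times> 'x, 'g \<times> 'y) virt" where
  "virt_ind G H V = (ind G H (fst V), ind G H (snd V))"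

definition signed_constituents :: "('g, 'b) monoid_scheme \<Rightarrow> ('g, 'x, 'y) virt \<Rightarrow> nat \<Rightarrow> int" where
  "signed_constituents G V m = int (num_constituents G (fst V) m) - int (num_constituents G (snd V) m)"


section \<open>The representations attached to a cluster\<close>

definition prime_to_part :: "nat \<Rightarrow> nat \<Rightarrow> nat" where
  "prime_to_part p n = n div p ^ multiplicity p n"

definition is_gamma :: "nat \<Rightarrow> (('k::field) alg_closure \<Rightarrow> rat) \<Rightarrow> 'k alg_closure set
    \<Rightarrow> 'k alg_closure set \<Rightarrow> 'k alg_closure set
    \<Rightarrow> (('k alg_closure \<Rightarrow> 'k alg_closure) \<Rightarrow> complex) \<Rightarrow> bool" where
  "is_gamma p v L R \<ss> \<gamma> \<longleftrightarrow>
     \<gamma> \<in> chars_of_order (stab_group v L \<ss>) (prime_to_part p (denom (lambda v L R \<ss>)))"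

text \<open>The disjunct \<open>x = 0\<close> accounts for $v_2(0) = \infty$.\<close>

definition is_eps :: "(('k::field) alg_closure \<Rightarrow> rat) \<Rightarrow> 'k alg_closure set
    \<Rightarrow> 'k alg_closure set \<Rightarrow> 'k alg_closure set
    \<Rightarrow> ('k alg_closure \<Rightarrow> 'k alg_closure, unit) repr \<Rightarrow> bool" where
  "is_eps v L R \<ss> \<epsilon> \<longleftrightarrow>
     (let H = stab_group v L \<ss>; x = of_nat (cluster_index v L \<ss>) * mu v R \<ss> in
      if odd (card \<ss>) then \<epsilon> = zero_rep
      else if x = 0 \<or> rat_val 2 x \<ge> 1 then \<epsilon> = char_rep (triv_char H)
      else (\<exists>\<chi>\<in>chars_of_order H 2. \<epsilon> = char_rep \<chi>))"

definition cluster_rep :: "(('k::field) alg_closure \<Rightarrow> rat) \<Rightarrow> 'k alg_closure set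
    \<Rightarrow> 'k alg_closure set \<Rightarrow> 'k alg_closure set
    \<Rightarrow> (('k alg_closure \<Rightarrow> 'k alg_closure) \<Rightarrow> complex)
    \<Rightarrow> ('k alg_closure \<Rightarrow> 'k alg_closure, unit) repr
    \<Rightarrow> ('k alg_closure \<Rightarrow> 'k alg_closure, 'k alg_closure set, unit + unit) virt" where
  "cluster_rep v L R \<ss> \<gamma> \<epsilon> =
     virt_minus
       (virt_twist \<gamma>
         (perm_rep (\<lambda>\<sigma> c. \<sigma> ` c) (odd_children v R \<ss>), char_rep (triv_char (stab_group v L \<ss>))))
       \<epsilon>"


section \<open>Arithmetic functions\<close>

definition gcd_inf :: "nat \<Rightarrow> nat \<Rightarrow> nat" where
  "gcd_inf n d = lim (\<lambda>k. gcd n (d ^ k))"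

definition A_set :: "nat \<Rightarrow> nat \<Rightarrow> nat set" where
  "A_set d t = {q. prime q \<and> multiplicity q d = multiplicity q t \<and> multiplicity q t > 0}"

definition S_set :: "nat \<Rightarrow> nat \<Rightarrow> nat set" where
  "S_set d t = {lcm d t div (\<Prod>q\<in>A_set d t. q ^ m q) | m. \<forall>q\<in>A_set d t. m q \<le> multiplicity q t}"

definition Q_fun :: "nat \<Rightarrow> nat \<Rightarrow> nat \<Rightarrow> rat" where
  "Q_fun q k s = (if multiplicity q s = k then (of_nat q - 2) / (of_nat q - 1) else 1)"

definition alpha :: "nat \<Rightarrow> nat \<Rightarrow> nat \<Rightarrow> rat" where
  "alpha d t s = of_nat (totient d) / of_nat (totient (lcm d t))
                 * (\<Prod>q\<in>A_set d t. Q_fun q (multiplicity q t) s)"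

definition beta :: "nat \<Rightarrow> nat \<Rightarrow> rat" where
  "beta n s = of_nat (gcd_inf n s * totient s) / of_nat (totient (s * gcd_inf n s))"

text \<open>
  A formal rational combination of the $\rho_M$ is the function \<open>nat \<Rightarrow> rat\<close> of its
  coefficients; \<open>rho_coeff M\<close> stands for $\rho_M$ itself.
\<close>

definition rho_coeff :: "nat \<Rightarrow> nat \<Rightarrow> rat" where
  "rho_coeff M = (\<lambda>m. if m = M then 1 else 0)"

end

theory Submission
  imports Defs
begin

text \<open>
  Inertia \<open>I\<close> is tame, so \<open>\<sigma> \<mapsto> \<sigma> \<pi> / \<pi>\<close> (modulo the maximal ideal, \<open>\<pi>\<close> a uniformizer of \<open>L\<close>)
  embeds it into the roots of unity; hence \<open>I\<close> is cyclic, and its order is the ramification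
  index because the fixed field of \<open>I\<close> is unramified over \<open>K\<close>. Averaging over the stabiliser
  \<open>I\<^sub>s\<close> of the cluster gives a centre \<open>z\<close> fixed by \<open>I\<^sub>s\<close>. For a child at distance exactly the
  depth \<open>d\<close> from \<open>z\<close>, an element of \<open>I\<^sub>s\<close> fixes the child if and only if its tame
  character kills valuation \<open>d\<close>; so all orbits on the odd children have length \<open>n'\<close>, except for
  at most one fixed child. Therefore \<open>\<gamma> \<otimes> \<complex>[odd children]\<close> consists of \<open>\<lfloor>N / n'\<rfloor>\<close> copies of the sum of the
  \<open>\<gamma>\<psi>\<close> with \<open>\<psi> ^ n' = 1\<close>, plus at most one further copy of \<open>\<gamma>\<close>.

  By Frobenius reciprocity the count of constituents of order \<open>m\<close> becomes a count of complex
  roots of unity \<open>w\<close> of order \<open>m\<close> with prescribed \<open>w ^ n\<close>. The order of \<open>w ^ n\<close> is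
  \<open>m / gcd m n\<close>, and the fibres over elements of the same order have the same size because the
  power maps by units permute them; the orders of the products \<open>\<gamma>\<psi>\<close> are counted one prime at a
  time. It turns out that \<open>\<beta>\<close> is always 1.
\<close>

section \<open>Orders of roots of unity\<close>

text \<open>No representation is decomposed. The number of constituents is by definition a sum of
  dimensions of eigenspaces, so it suffices to know the multiplicity of each single character, and a
  character of a cyclic group is known by the root of unity that it takes at a fixed generator.

  Two obstacles shape the rest. The conjugates of \<open>v\<close> under \<open>gal L\<close> are
  not assumed to coincide with \<open>v\<close>, so a trace from \<open>L\<close> to the base field
  has terms that \<open>v\<close> does not control; weak approximation makes them small. The other
  obstacle is the odd child fixed by the stabiliser. For \<open>n' > 1\<close> it is the remainder
  of the number of odd children modulo \<open>n'\<close>, which is the coefficient in the second sum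
  (its \<open>- 1\<close> is the trivial summand removed from the permutation representation). For
  \<open>n' = 1\<close> it cannot be told from the other orbits and the floor counts it as well; but
  then the two sums count the same roots of unity, so the formula is unaffected.\<close>

definition has_order :: "'a::monoid_mult \<Rightarrow> nat \<Rightarrow> bool" where
  "has_order z d \<longleftrightarrow> d > 0 \<and> (\<forall>k. z ^ k = 1 \<longleftrightarrow> d dvd k)"

lemma has_orderD: "has_order z d \<Longrightarrow> z ^ k = 1 \<longleftrightarrow> d dvd k"
  by (simp add: has_order_def)

lemma has_order_pos: "has_order z d \<Longrightarrow> d > 0"
  by (simp add: has_order_def)

lemma has_order_self: "has_order z d \<Longrightarrow> z ^ d = 1"
  using has_orderD[of z d d] by simp

lemma has_order_unique: "has_order z d \<Longrightarrow> has_order z e \<Longrightarrow> d = e"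
  by (metis dvd_antisym dvd_refl has_orderD)

lemma has_order_exists:
  fixes z :: "'a::monoid_mult"
  assumes "z ^ N = 1" "N > 0"
  obtains d where "has_order z d" "d dvd N"
proof -
  define d where "d = (LEAST k. k > 0 \<and> z ^ k = 1)"
  have d: "d > 0 \<and> z ^ d = 1"
    unfolding d_def by (rule LeastI[of "\<lambda>k. k > 0 \<and> z ^ k = 1" N]) (use assms in simp)
  have "z ^ k = 1 \<longleftrightarrow> d dvd k" for k
  proof
    assume k: "z ^ k = 1"
    have "z ^ (d * (k div d) + k mod d) = 1" using k by simp
    then have "z ^ (k mod d) = 1" unfolding power_add power_mult using d by simp
    moreover have "k mod d < d" using d by simp
    ultimately have "\<not> k mod d > 0" using not_less_Least[of "k mod d" "\<lambda>k. k > 0 \<and> z ^ k = 1"]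
      by (auto simp: d_def)
    then show "d dvd k" by auto
  qed (use d in \<open>auto simp: power_mult elim!: dvdE\<close>)
  then have "has_order z d" using d by (simp add: has_order_def)
  moreover have "d dvd N" using calculation assms has_orderD by blast
  ultimately show ?thesis using that by blast
qed

lemma has_order_iff:
  fixes z :: "'a::monoid_mult"
  shows "has_order z d \<longleftrightarrow> d > 0 \<and> z ^ d = 1 \<and> (\<forall>k>0. z ^ k = 1 \<longrightarrow> d \<le> k)"
proof
  assume "has_order z d"
  then show "d > 0 \<and> z ^ d = 1 \<and> (\<forall>k>0. z ^ k = 1 \<longrightarrow> d \<le> k)"
    by (auto simp: has_order_def intro: dvd_imp_le)
next
  assume d: "d > 0 \<and> z ^ d = 1 \<and> (\<forall>k>0. z ^ k = 1 \<longrightarrow> d \<le> k)"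
  then obtain e where e: "has_order z e" "e dvd d" by (meson has_order_exists)
  then have "d \<le> e" using d by (metis dvd_refl has_order_def)
  then have "d = e" using e d by (simp add: dvd_imp_le le_antisym)
  then show "has_order z d" using e by simp
qed

text \<open>If \<open>z ^ k\<close> has the same order \<open>d\<close> as \<open>z\<close>, then
  \<open>has_order_power\<close> yields the second assumption; the conclusion makes \<open>k\<close>
  a unit modulo \<open>d\<close>.\<close>

lemma div_gcd_eq_self:
  fixes d k :: nat
  assumes "d > 0" "d div gcd d k = d" shows "gcd d k = 1"
proof -
  have "d div gcd d k * gcd d k = d" by simp
  then have "d * gcd d k = d * 1" using assms(2) by simp
  then show ?thesis using assms(1) by simp
qed

text \<open>After cancelling \<open>gcd d n\<close>, the cofactors of \<open>d\<close> and
  \<open>n\<close> are coprime, so \<open>d\<close> divides \<open>n * k\<close> exactly when the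
  cofactor of \<open>d\<close> divides \<open>k\<close>.\<close>

lemma has_order_power:
  fixes z :: "'a::monoid_mult"
  assumes "has_order z d"
  shows "has_order (z ^ n) (d div gcd d n)"
proof -
  have "d dvd n * k \<longleftrightarrow> d div gcd d n dvd k" for k
  proof -
    let ?g = "gcd d n"
    have g: "?g > 0" using assms by (simp add: has_order_def)
    obtain a b where ab: "d = a * ?g" "n = b * ?g" "coprime a b"
      using gcd_coprime_exists[of d n] g by auto
    have "d dvd n * k \<longleftrightarrow> a * ?g dvd (b * k) * ?g" using ab by (metis mult.assoc mult.commute)
    also have "\<dots> \<longleftrightarrow> a dvd b * k" using g by simp
    also have "\<dots> \<longleftrightarrow> a dvd k" using ab(3) by (simp add: coprime_dvd_mult_right_iff)
    also have "a = d div ?g" using ab(1) g by (metis nonzero_mult_div_cancel_right less_numeral_extra(3))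
    finally show ?thesis .
  qed
  moreover have "d div gcd d n > 0" using has_order_pos[OF assms] by (simp add: div_greater_zero_iff)
  ultimately show ?thesis using assms by (simp add: has_order_def flip: power_mult)
qed

lemma has_order_power_coprime:
  "has_order z d \<Longrightarrow> coprime d n \<Longrightarrow> has_order (z ^ n) d"
  using has_order_power[of z d n] by simp

lemma has_order_mult_coprime:
  fixes x y :: "'a::comm_monoid_mult"
  assumes "has_order x a" "has_order y b" "coprime a b"
  shows "has_order (x * y) (a * b)"
proof -
  have "(x * y) ^ k = 1 \<longleftrightarrow> a * b dvd k" for k
  proof
    assume k: "(x * y) ^ k = 1"
    then have "((x * y) ^ k) ^ b = 1" by simp
    then have "x ^ (k * b) * y ^ (k * b) = 1" by (simp add: power_mult_distrib flip: power_mult)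
    moreover have "y ^ (k * b) = 1" using assms(2) by (simp add: has_order_def)
    ultimately have "a dvd k" using assms by (auto simp: has_order_def coprime_dvd_mult_left_iff)
    from k have "((x * y) ^ k) ^ a = 1" by simp
    then have "x ^ (k * a) * y ^ (k * a) = 1" by (simp add: power_mult_distrib flip: power_mult)
    moreover have "x ^ (k * a) = 1" using assms(1) by (simp add: has_order_def)
    ultimately have "b dvd k" using assms
      by (auto simp: has_order_def coprime_commute coprime_dvd_mult_left_iff)
    with \<open>a dvd k\<close> assms(3) show "a * b dvd k" by (simp add: divides_mult)
  next
    assume k: "a * b dvd k"
    then have "x ^ k = 1" "y ^ k = 1" using assms(1,2) by (auto simp: has_order_def dest: dvd_mult_left dvd_mult_right)
    then show "(x * y) ^ k = 1" by (simp add: power_mult_distrib)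
  qed
  then show ?thesis using assms by (simp add: has_order_def)
qed

lemma has_order_one_iff [simp]: "has_order z (Suc 0) \<longleftrightarrow> z = 1"
  by (auto simp: has_order_def dest: spec[of _ 1])

lemma has_order_inverse:
  fixes z :: "'a::field"
  shows "has_order z d \<Longrightarrow> has_order (inverse z) d"
  by (auto simp: has_order_def power_inverse)

lemma has_order_nonzero: "has_order (z::'a::field) d \<Longrightarrow> z \<noteq> 0"
  by (metis dvd_refl has_order_def power_0_left zero_neq_one not_gr_zero)

section \<open>The complex roots of unity as a cyclic group\<close>

definition prim_root :: "nat \<Rightarrow> complex" where
  "prim_root d = cis (2 * pi / real d)"

lemma prim_root_power: "prim_root d ^ k = cis (2 * pi * real k / real d)"
  by (simp add: prim_root_def Complex.DeMoivre field_simps)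

lemma has_order_prim_root:
  assumes "d > 0" shows "has_order (prim_root d) d"
proof (subst has_order_iff, intro conjI allI impI)
  show "prim_root d ^ d = 1" using assms by (simp add: prim_root_power)
  fix k assume k: "k > 0" "prim_root d ^ k = 1"
  show "d \<le> k"
  proof (rule ccontr)
    assume "\<not> d \<le> k"
    moreover have "inj_on (\<lambda>k. cis (2 * pi * real k / real d)) {..<d}"
      using bij_betw_roots_unity[OF assms] by (simp add: bij_betw_def)
    moreover have "cis (2 * pi * real k / real d) = cis (2 * pi * real 0 / real d)"
      using k by (simp add: prim_root_power)
    ultimately show False using k assms by (auto dest!: inj_onD[where x = k and y = 0])
  qed
qed fact

lemma root_unity_power_prim_root:
  assumes "d > 0" "z ^ d = 1"
  obtains k where "k < d" "z = prim_root d ^ k"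
proof -
  have "z \<in> (\<lambda>k. cis (2 * pi * real k / real d)) ` {..<d}"
    using bij_betw_roots_unity[OF assms(1)] assms(2) by (auto simp: bij_betw_def)
  then show ?thesis using that by (auto simp: prim_root_power)
qed

text \<open>If \<open>z\<close> is the \<open>j\<close>-th power of \<open>prim_root d\<close> and
  has full order \<open>d\<close>, then \<open>j\<close> is prime to \<open>d\<close>, and an
  inverse of \<open>j\<close> modulo \<open>d\<close> recovers \<open>prim_root d\<close> as a power
  of \<open>z\<close>.\<close>

lemma has_order_generates:
  fixes z w :: complex
  assumes z: "has_order z d" and w: "w ^ d = 1"
  obtains k where "w = z ^ k"
proof -
  have d: "d > 0" using z by (simp add: has_order_def)
  have "z ^ d = 1" using z by (simp add: has_order_def)
  then obtain j where j: "z = prim_root d ^ j" by (meson d root_unity_power_prim_root)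
  have o: "d div gcd d j = d" 
    using has_order_power[OF has_order_prim_root[OF d], of j] z j has_order_unique by metis
  then have g: "gcd d j = 1" using d div_gcd_eq_self by simp
  obtain i where i: "w = prim_root d ^ i" by (rule root_unity_power_prim_root[OF d w])
  show ?thesis
  \<comment> \<open>\<open>bezout_nat\<close> excludes \<open>j = 0\<close>; in that case
    coprimality gives \<open>d = 1\<close> and hence \<open>w = 1\<close>.\<close>
  proof (cases "j = 0")
    case True
    then show ?thesis using g w by (intro that[of 0]) simp
  next
    case False
    then obtain a b where ab: "j * a = d * b + 1" using bezout_nat[of j d] g by (auto simp: gcd.commute)
    have "prim_root d ^ d = 1" using has_order_prim_root[OF d] by (simp add: has_order_def)
    then have "prim_root d ^ (d * b + 1) = prim_root d" by (simp add: power_add power_mult)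
    then have "prim_root d = z ^ a" unfolding j ab[symmetric] by (simp add: power_mult)
    then have "w = z ^ (a * i)" using i by (simp add: power_mult)
    then show ?thesis by (rule that)
  qed
qed

lemma finite_has_order [simp]: "finite {z::complex. has_order z d}"
proof (cases "d > 0")
  case True
  have "{z::complex. has_order z d} \<subseteq> {z. z ^ d = 1}" by (auto intro: has_order_self)
  moreover have "finite {z::complex. z ^ d = 1}" using finite_roots_unity[of d] True by simp
  ultimately show ?thesis by (rule finite_subset)
qed (simp add: has_order_def)

lemma card_has_order:
  assumes d: "d > 0"
  shows "card {z::complex. has_order z d} = totient d"
proof -
  let ?w = "prim_root d"
  note w = has_order_prim_root[OF d]
  have inj: "inj_on (\<lambda>k. ?w ^ k) {..<d}"
    using bij_betw_roots_unity[OF d] by (simp add: bij_betw_def prim_root_power)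
  have "{z. has_order z d} = (\<lambda>k. ?w ^ k) ` {k. k < d \<and> coprime d k}"
  proof (intro equalityI subsetI)
    fix z :: complex assume "z \<in> {z. has_order z d}"
    then have z: "has_order z d" by simp
    then obtain k where k: "k < d" "z = ?w ^ k"
      using root_unity_power_prim_root[OF d has_order_self] by blast
    have "d div gcd d k = d" using has_order_power[OF w, of k] z k(2) has_order_unique by metis
    then have "coprime d k" using div_gcd_eq_self[OF d] by (metis coprime_iff_gcd_eq_1)
    then show "z \<in> (\<lambda>k. ?w ^ k) ` {k. k < d \<and> coprime d k}" using k by auto
  qed (auto intro: has_order_power_coprime[OF w])
  then have "card {z::complex. has_order z d} = card {k. k < d \<and> coprime d k}"
    by (simp add: card_image inj_on_subset[OF inj] subset_iff)
  also have "\<dots> = totient d"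
  \<comment> \<open>\<open>totatives d\<close> lies in the range from 1 to \<open>d\<close>, the
    exponents here in the range from 0 to \<open>d - 1\<close>; the coprime numbers in both ranges
    agree unless \<open>d = 1\<close>.\<close>
  proof (cases "d = 1")
    case True
    then have "{k. k < d \<and> coprime d k} = {0}" by auto
    then show ?thesis using True by simp
  next
    case False
    then have "{k. k < d \<and> coprime d k} = totatives d"
      using d by (auto simp: totatives_def coprime_commute le_less intro!: Nat.gr0I)
    then show ?thesis by (simp add: totient_def)
  qed
  finally show ?thesis .
qed

section \<open>Counting products and powers of roots of unity\<close>

text \<open>Units lift along reduction: take \<open>u' = u + t * x\<close> with \<open>x\<close> the
  product of the primes of \<open>m\<close> that do not divide \<open>u\<close>. Each prime of
  \<open>m\<close> then divides exactly one of the two summands.\<close>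

lemma coprime_lift:
  fixes u t m :: nat
  assumes ut: "coprime u t" and m: "m > 0"
  obtains u' where "coprime m u'" "u' mod t = u mod t"
proof -
  define Qs where "Qs = {q. prime q \<and> q dvd m \<and> \<not> q dvd u}"
  have fin: "finite Qs" unfolding Qs_def by (rule finite_subset[of _ "{..m}"]) (use m in \<open>auto dest: dvd_imp_le\<close>)
  define x where "x = prod (\<lambda>q. q) Qs"
  have "coprime m (u + t * x)"
  proof (rule ccontr)
    assume "\<not> coprime m (u + t * x)"
    then have "gcd m (u + t * x) \<noteq> 1" by (metis coprime_iff_gcd_eq_1)
    then obtain q where q: "prime q" "q dvd m" "q dvd u + t * x"
      using prime_factor_nat by (metis gcd_nat.boundedE)
    show False
    proof (cases "q dvd u")
      case True
      then have "q dvd t * x" using q(3) by (simp add: dvd_add_right_iff)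
      moreover have "\<not> q dvd t" using True ut q(1) by (meson coprime_def not_prime_unit)
      ultimately have "q dvd x" using q(1) by (simp add: prime_dvd_mult_iff)
      then obtain r where "r \<in> Qs" "q dvd r"
        unfolding x_def using q(1) fin by (auto simp: prime_dvd_prod_iff)
      then have "q \<in> Qs" using q(1) primes_dvd_imp_eq by (auto simp: Qs_def)
      then show False using True by (simp add: Qs_def)
    next
      case False
      then have "q \<in> Qs" using q by (simp add: Qs_def)
      then have "q dvd x" unfolding x_def using fin dvd_prodI[of Qs q "\<lambda>q. q"] by simp
      then have "q dvd u" using q(3) by (simp add: dvd_add_left_iff)
      then show False using False by simp
    qed
  qed
  then show ?thesis by (rule that) simp
qed

text \<open>The primitive \<open>s\<close>-th roots \<open>x\<close> and \<open>y\<close> differ by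
  a power map whose exponent can be lifted to a unit \<open>u\<close> modulo \<open>m\<close>.
  Raising to the power \<open>u\<close> permutes the elements of order \<open>m\<close> and carries
  the fibre over \<open>x\<close> into the fibre over \<open>y\<close>; by symmetry the fibres have
  equal size.\<close>

lemma card_power_fibre_le:
  fixes x y :: complex
  assumes x: "has_order x s" and y: "has_order y s" and m: "m > 0"
  shows "card {w. has_order w m \<and> w ^ n = x} \<le> card {w. has_order w m \<and> w ^ n = y}"
proof -
  obtain k where k: "y = x ^ k" using has_order_generates[OF x has_order_self[OF y]] by blast
  have "s div gcd s k = s" using has_order_power[OF x, of k] y k has_order_unique by metis
  then have "gcd s k = 1" using div_gcd_eq_self has_order_pos[OF x] by blast
  then have "coprime k s" by (metis coprime_iff_gcd_eq_1 gcd.commute)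
  then obtain u where u: "coprime m u" "u mod s = k mod s" using coprime_lift m by blast
  have pm: "x ^ j = x ^ (j mod s)" for j
  proof -
    have "x ^ (s * (j div s) + j mod s) = x ^ (j mod s)"
      unfolding power_add power_mult by (simp add: has_order_self[OF x])
    then show ?thesis by simp
  qed
  have xu: "x ^ u = y" using pm[of u] pm[of k] u k by simp
  show ?thesis
  proof (rule card_inj_on_le)
    show "finite {w. has_order w m \<and> w ^ n = y}" by (rule finite_subset[OF _ finite_has_order[of m]]) auto
    show "(\<lambda>w. w ^ u) ` {w. has_order w m \<and> w ^ n = x} \<subseteq> {w. has_order w m \<and> w ^ n = y}"
    proof (clarsimp, intro conjI)
      fix w :: complex assume w: "has_order w m" "x = w ^ n"
      show "has_order (w ^ u) m" using w(1) u(1) by (rule has_order_power_coprime)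
      have "(w ^ u) ^ n = (w ^ n) ^ u" by (metis mult.commute power_mult)
      then show "(w ^ u) ^ n = y" using w xu by simp
    qed
    show "inj_on (\<lambda>w. w ^ u) {w. has_order w m \<and> w ^ n = x}"
    \<comment> \<open>\<open>bezout_nat\<close> needs \<open>u\<close> nonzero; \<open>u = 0\<close>
      is coprime to \<open>m\<close> only for \<open>m = 1\<close>.\<close>
    proof (cases "u = 0")
      case True
      then have "m = 1" using u(1) by simp
      then show ?thesis by (auto simp: inj_on_def)
    next
      case False
      then obtain a b where ab: "u * a = m * b + 1"
        using bezout_nat[of u m] u(1) by (auto simp: gcd.commute)
      have "w = (w ^ u) ^ a" if "has_order w m" for w :: complex
      proof -
        have "w ^ (m * b + 1) = w" using has_order_self[OF that] by (simp add: power_add power_mult)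
        then show ?thesis using ab by (metis power_mult)
      qed
      then show ?thesis by (auto simp: inj_on_def) metis
    qed
  qed
qed

text \<open>All \<open>totient m\<close> elements of order \<open>m\<close> have \<open>n\<close>-th
  powers of the same order, and they are spread evenly over the \<open>totient s\<close> elements of
  that order.\<close>

lemma card_power_fibre:
  fixes x :: complex
  assumes x: "has_order x s" and m: "m > 0"
  shows "(of_nat (card {w. has_order w m \<and> w ^ n = x}) :: rat) =
    (if m div gcd m n = s then of_nat (totient m) / of_nat (totient s) else 0)"
proof (cases "m div gcd m n = s")
  case False
  then have "{w. has_order w m \<and> w ^ n = x} = {}"
    using has_order_power[of _ m n] x has_order_unique by blast
  then show ?thesis using False by simp
next
  case True
  let ?F = "\<lambda>y. {w::complex. has_order w m \<and> w ^ n = y}"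
  have fin: "finite (?F y)" for y by (rule finite_subset[OF _ finite_has_order[of m]]) auto
  have s: "s > 0" using x by (rule has_order_pos)
  have "{w::complex. has_order w m} = (\<Union>y\<in>{y. has_order y s}. ?F y)"
    using has_order_power[of _ m n] True by auto
  then have "card {w::complex. has_order w m} = (\<Sum>y\<in>{y. has_order y s}. card (?F y))"
  proof (rule HOL.trans[OF arg_cong])
    show "card (\<Union>y\<in>{y. has_order y s}. ?F y) = (\<Sum>y\<in>{y. has_order y s}. card (?F y))"
      by (rule card_UN_disjoint) (use fin in \<open>simp_all, blast\<close>)
  qed
  also have "\<dots> = (\<Sum>y\<in>{y::complex. has_order y s}. card (?F x))"
    by (intro sum.cong refl antisym card_power_fibre_le[of _ s]) (use x m in auto)
  also have "\<dots> = totient s * card (?F x)" by (simp add: card_has_order[OF s])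
  finally have e: "totient m = totient s * card (?F x)" by (simp add: card_has_order[OF m])
  have "(of_nat (totient m) :: rat) = of_nat (totient s) * of_nat (card (?F x))"
    unfolding e by simp
  moreover have "(of_nat (totient s) :: rat) \<noteq> 0" using s by simp
  ultimately show ?thesis using True by (simp only: if_True) (simp add: field_simps)
qed

section \<open>Orders of products of roots of unity, one prime at a time\<close>

lemma has_order_mult_prime_power:
  fixes x y :: "'a::field"
  assumes q: "prime q" and x: "has_order x (q ^ a)" and y: "has_order y (q ^ b)" and ab: "a < b"
  shows "has_order (x * y) (q ^ b)"
proof -
  have xb: "x ^ (q ^ c) = 1" if "a \<le> c" for c
    using has_orderD[OF x, of "q ^ c"] that by (simp add: le_imp_power_dvd)
  have "(x * y) ^ (q ^ b) = 1"
    using xb[of b] has_order_self[OF y] ab by (simp add: power_mult_distrib)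
  then obtain d where d: "has_order (x * y) d" "d dvd q ^ b"
    using has_order_exists[of "x * y" "q ^ b"] q prime_gt_0_nat by auto
  then obtain c where c: "d = q ^ c" "c \<le> b" using q by (auto simp: divides_primepow_nat)
  \<comment> \<open>If the order of the product were smaller, its \<open>q ^ (b - 1)\<close>-th
    power would be trivial; that power already kills \<open>x\<close>, so it would kill
    \<open>y\<close> too.\<close>
  have "c = b"
  proof (rule ccontr)
    assume "c \<noteq> b"
    then have "c \<le> b - 1" using c by simp
    then have "(x * y) ^ (q ^ (b - 1)) = 1"
      using has_orderD[OF d(1), of "q ^ (b - 1)"] c by (simp add: le_imp_power_dvd)
    then have "y ^ (q ^ (b - 1)) = 1" using xb[of "b - 1"] ab by (simp add: power_mult_distrib)
    then have "q ^ b dvd q ^ (b - 1)" using has_orderD[OF y] by simp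
    then have "b \<le> b - 1" using q prime_gt_1_nat by (simp add: power_dvd_imp_le)
    then show False using ab by simp
  qed
  then show ?thesis using d c by simp
qed

lemma bij_betw_mult_left:
  fixes g :: "'a::field"
  assumes "g \<noteq> 0"
  shows "bij_betw (\<lambda>x. g * x) {x. P (g * x)} {y. P y}"
  by (rule bij_betwI[where g = "\<lambda>y. inverse g * y"]) (use assms in \<open>auto simp: mult.assoc[symmetric]\<close>)

text \<open>
  The \<open>q\<close>-part of the coefficient \<open>\<alpha>\<close>: \<open>a\<close>, \<open>b\<close>, \<open>c\<close> are the \<open>q\<close>-adic valuations of
  \<open>d\<close>, \<open>t\<close>, \<open>s\<close>.
\<close>

definition local_factor :: "nat \<Rightarrow> nat \<Rightarrow> nat \<Rightarrow> nat \<Rightarrow> rat" where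
  "local_factor q a b c =
     (if a = b \<and> b > 0 then (if c < b then 1 else if c = b then (of_nat q - 2) / (of_nat q - 1) else 0)
      else if c = max a b then of_nat (totient (q ^ a)) / of_nat (totient (q ^ max a b)) else 0)"

text \<open>If the orders of \<open>g\<close> and \<open>x\<close> differ, the larger one is the
  order of the product. Only a tie \<open>a = b > 0\<close> leaves room for cancellation, and this
  is where the primes of \<open>A_set\<close> come from.\<close>

lemma card_mult_order_prime_power:
  fixes g :: complex
  assumes q: "prime q" and g: "has_order g (q ^ b)"
  shows "(of_nat (card {x. has_order x (q ^ a) \<and> has_order (g * x) (q ^ c)}) :: rat) =
    of_nat (totient (q ^ c)) * local_factor q a b c"
proof -
  let ?S = "{x. has_order x (q ^ a) \<and> has_order (g * x) (q ^ c)}"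
  have q0: "q ^ k > 0" for k using q prime_gt_0_nat by simp
  have inj: "q ^ i = q ^ j \<longleftrightarrow> i = j" for i j using q prime_gt_1_nat by simp
  have g0: "g \<noteq> 0" using g by (rule has_order_nonzero)
  consider "a \<noteq> b \<or> b = 0" | "a = b" "b > 0" "c < b" | "a = b" "b > 0" "c = b" | "a = b" "b > 0" "c > b"
    by linarith
  then show ?thesis
  proof cases
    case 1
    have "has_order (g * x) (q ^ max a b)" if "has_order x (q ^ a)" for x
    proof -
      consider "a < b" | "b < a" | "a = 0" "b = 0" using 1 by linarith
      then show ?thesis
        using that g has_order_mult_prime_power[OF q that g] has_order_mult_prime_power[OF q g that]
        by cases (auto simp: mult.commute max_def)
    qed
    then have "?S = (if c = max a b then {x. has_order x (q ^ a)} else {})"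
      using has_order_unique inj by (auto, blast+)
    moreover have "(of_nat (totient (q ^ max a b)) :: rat) \<noteq> 0" using q0[of "max a b"] by simp
    ultimately show ?thesis using 1 card_has_order[OF q0[of a]]
      by (simp only: local_factor_def) (auto simp del: totient_0_iff)
  next
    \<comment> \<open>The order of \<open>x\<close> imposes nothing here: an \<open>x\<close> with
      \<open>g * x\<close> of smaller order is a product of \<open>inverse g\<close> with an element
      of smaller order, so it has order \<open>q ^ b\<close>.\<close>
    case 2
    have "?S = {x. has_order (g * x) (q ^ c)}"
    proof -
      have "has_order x (q ^ a)" if "has_order (g * x) (q ^ c)" for x
        using has_order_mult_prime_power[OF q that has_order_inverse[OF g]] 2 g0
        by (simp add: field_simps)
      then show ?thesis by blast
    qed
    also have "card \<dots> = card {y::complex. has_order y (q ^ c)}"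
      by (rule bij_betw_same_card[OF bij_betw_mult_left[OF g0]])
    finally show ?thesis using 2 by (simp add: local_factor_def card_has_order[OF q0])
  next
    \<comment> \<open>Origin of \<open>(q - 2) / (q - 1)\<close>: of the
      \<open>q ^ k * (q - 1)\<close> elements \<open>x\<close> of order \<open>q ^ b\<close>,
      exactly the \<open>q ^ k\<close> solutions of \<open>(g * x) ^ (q ^ k) = 1\<close> are
      lost.\<close>
    case 3
    define k where "k = b - 1"
    have k: "b = Suc k" using 3 by (simp add: k_def)
    let ?T = "{x. (g * x) ^ (q ^ k) = 1}"
    have T: "card ?T = q ^ k"
    proof -
      have "card ?T = card {y::complex. y ^ (q ^ k) = 1}"
        by (rule bij_betw_same_card[OF bij_betw_mult_left[OF g0]])
      then show ?thesis using card_roots_unity_eq[OF q0[of k]] by simp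
    qed
    have *: "x \<in> ?T" if x: "has_order x (q ^ b)" "\<not> has_order (g * x) (q ^ b)" for x
    proof -
      have "(g * x) ^ (q ^ b) = 1"
        using has_order_self[OF x(1)] has_order_self[OF g] by (simp add: power_mult_distrib)
      then obtain d where d: "has_order (g * x) d" "d dvd q ^ b"
        using has_order_exists[of "g * x" "q ^ b"] q0 by blast
      then obtain i where i: "d = q ^ i" "i \<le> b" using q by (auto simp: divides_primepow_nat)
      have "i \<noteq> b" using i d x by auto
      then have "i \<le> k" using i k by simp
      then show ?thesis using has_orderD[OF d(1), of "q ^ k"] i by (simp add: le_imp_power_dvd)
    qed
    have **: "has_order x (q ^ b) \<and> \<not> has_order (g * x) (q ^ b)" if "x \<in> ?T" for x
    proof -
      have "(g * x) ^ (q ^ k) = 1" using that by simp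
      then obtain d where d: "has_order (g * x) d" "d dvd q ^ k"
        using has_order_exists[of "g * x" "q ^ k"] q0 by blast
      then obtain i where i: "d = q ^ i" "i \<le> k" using q by (auto simp: divides_primepow_nat)
      then have "has_order x (q ^ b)"
        using has_order_mult_prime_power[OF q _ has_order_inverse[OF g], of "g * x" i] d g0 k
        by (simp add: field_simps)
      moreover have "q ^ i \<noteq> q ^ b" using inj[of i b] i k by simp
      ultimately show ?thesis using d i has_order_unique by metis
    qed
    have "{x::complex. has_order x (q ^ b)} = ?S \<union> ?T" using * ** 3 by auto
    moreover have "?S \<inter> ?T = {}" using ** 3 by auto
    moreover have "finite ?S" by (rule finite_subset[OF _ finite_has_order[of "q ^ a"]]) auto
    moreover have "finite ?T" using T q0[of k] by (metis card.infinite less_numeral_extra(3))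
    ultimately have "card {x::complex. has_order x (q ^ b)} = card ?S + card ?T"
      by (metis card_Un_disjoint)
    then have "totient (q ^ b) = card ?S + q ^ k" by (simp only: card_has_order[OF q0] T)
    then have "(of_nat (totient (q ^ b)) :: rat) = of_nat (card ?S) + of_nat (q ^ k)" by (metis of_nat_add)
    moreover have "(of_nat (totient (q ^ b)) :: rat) = of_nat (q ^ k) * (of_nat q - 1)"
      using totient_prime_power_Suc[OF q, of k] k q prime_gt_1_nat[of q] by (simp add: of_nat_diff)
    moreover have "(of_nat q - 1 :: rat) \<noteq> 0" using prime_gt_1_nat[OF q] by simp
    ultimately show ?thesis using 3 by (simp add: local_factor_def field_simps)
  next
    case 4
    have "x \<notin> ?S" for x
    proof
      assume "x \<in> ?S"
      then have x: "has_order x (q ^ a)" "has_order (g * x) (q ^ c)" by auto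
      have "(g * x) ^ (q ^ b) = 1"
        using has_order_self[OF x(1)] has_order_self[OF g] 4 by (simp add: power_mult_distrib)
      then have "q ^ c dvd q ^ b" using has_orderD[OF x(2)] by simp
      then show False using 4 q prime_gt_1_nat by (auto dest!: power_dvd_imp_le)
    qed
    then have "?S = {}" by blast
    then show ?thesis using 4 by (simp add: local_factor_def)
  qed
qed

text \<open>The coprime exponents \<open>D\<close> and \<open>E\<close> bound the true orders of
  \<open>x\<close> and \<open>y\<close> as well as \<open>a\<close> and \<open>b\<close>, so an
  equality of products \<open>a * b = a' * b'\<close> can be separated into its two factors.\<close>

lemma has_order_mult_coprime_iff:
  fixes x y :: "'a::field"
  assumes x: "x ^ D = 1" and y: "y ^ E = 1" and DE: "D > 0" "E > 0" "coprime D E"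
    and ab: "a dvd D" "b dvd E"
  shows "has_order (x * y) (a * b) \<longleftrightarrow> has_order x a \<and> has_order y b"
proof
  assume o: "has_order (x * y) (a * b)"
  obtain a' where a': "has_order x a'" "a' dvd D" using has_order_exists[OF x DE(1)] by blast
  obtain b' where b': "has_order y b'" "b' dvd E" using has_order_exists[OF y DE(2)] by blast
  have cop: "coprime u w" if "u dvd D" "w dvd E" for u w
    using DE(3) that by (meson coprime_divisors)
  have "has_order (x * y) (a' * b')"
    using has_order_mult_coprime[OF a'(1) b'(1) cop[OF a'(2) b'(2)]] .
  then have e: "a * b = a' * b'" using o has_order_unique by blast
  have "a dvd a' * b'" "a' dvd a * b" "b dvd b' * a'" "b' dvd b * a"
    using e by (metis dvd_triv_left mult.commute)+
  then have "a dvd a'" "a' dvd a" "b dvd b'" "b' dvd b"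
    using cop ab a' b' by (metis coprime_dvd_mult_left_iff coprime_commute)+
  then show "has_order x a \<and> has_order y b" using a' b' by (metis dvd_antisym)
next
  assume "has_order x a \<and> has_order y b"
  moreover have "coprime a b" using DE(3) ab by (meson coprime_divisors)
  ultimately show "has_order (x * y) (a * b)" using has_order_mult_coprime by blast
qed

text \<open>From a Bezout identity \<open>D * i = E * j + 1\<close>: the power
  \<open>w ^ (E * j)\<close> is killed by \<open>D\<close>, the power \<open>w ^ (D * i)\<close> by
  \<open>E\<close>, and their quotient is \<open>w\<close>.\<close>

lemma root_unity_split:
  fixes w :: "'a::field"
  assumes w: "w ^ (D * E) = 1" and DE: "D > 0" "E > 0" "coprime D E"
  obtains x y where "w = x * y" "x ^ D = 1" "y ^ E = 1"
proof -
  obtain i j where ij: "D * i = E * j + 1"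
    using bezout_nat[of D E] DE by (auto)
  have w0: "w \<noteq> 0" using w DE by (metis mult_pos_pos power_0_left less_numeral_extra(3) zero_neq_one)
  show ?thesis
  proof
    show "w = inverse (w ^ (E * j)) * w ^ (D * i)" using w0 ij by (simp add: field_simps)
    have "(w ^ (E * j)) ^ D = (w ^ (D * E)) ^ j" by (simp add: mult_ac flip: power_mult)
    then show "inverse (w ^ (E * j)) ^ D = 1" using w by (simp add: power_inverse)
    have "(w ^ (D * i)) ^ E = (w ^ (D * E)) ^ i" by (simp add: mult_ac flip: power_mult)
    then show "(w ^ (D * i)) ^ E = 1" using w by simp
  qed
qed

text \<open>Multiplication of pairs is a bijection between the product of the two sets on the right
  and the set on the left: this is the Chinese remainder theorem for roots of unity.\<close>

lemma card_mult_order_mult: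
  fixes g h :: complex
  assumes DE: "D > 0" "E > 0" "coprime D E"
    and D: "a\<^sub>1 dvd D" "c\<^sub>1 dvd D" "g ^ D = 1" and E: "a\<^sub>2 dvd E" "c\<^sub>2 dvd E" "h ^ E = 1"
  shows "card {x. has_order x (a\<^sub>1 * a\<^sub>2) \<and> has_order (g * h * x) (c\<^sub>1 * c\<^sub>2)} =
    card {x. has_order x a\<^sub>1 \<and> has_order (g * x) c\<^sub>1} * card {x. has_order x a\<^sub>2 \<and> has_order (h * x) c\<^sub>2}"
proof -
  let ?A = "{x. has_order x a\<^sub>1 \<and> has_order (g * x) c\<^sub>1}"
  let ?B = "{x. has_order x a\<^sub>2 \<and> has_order (h * x) c\<^sub>2}"
  let ?C = "{x. has_order x (a\<^sub>1 * a\<^sub>2) \<and> has_order (g * h * x) (c\<^sub>1 * c\<^sub>2)}"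
  have A: "x ^ D = 1" if "x \<in> ?A" for x using that D(1) has_orderD by blast
  have B: "y ^ E = 1" if "y \<in> ?B" for y using that E(1) has_orderD by blast
  have C: "x * y \<in> ?C \<longleftrightarrow> x \<in> ?A \<and> y \<in> ?B" if "x ^ D = 1" "y ^ E = 1" for x y
  proof -
    have "has_order (x * y) (a\<^sub>1 * a\<^sub>2) \<longleftrightarrow> has_order x a\<^sub>1 \<and> has_order y a\<^sub>2"
      by (rule has_order_mult_coprime_iff[OF that DE D(1) E(1)])
    moreover have "has_order ((g * x) * (h * y)) (c\<^sub>1 * c\<^sub>2) \<longleftrightarrow> has_order (g * x) c\<^sub>1 \<and> has_order (h * y) c\<^sub>2"
      by (rule has_order_mult_coprime_iff[OF _ _ DE D(2) E(2)]) (use that D(3) E(3) in \<open>simp_all add: power_mult_distrib\<close>)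
    moreover have "g * h * (x * y) = (g * x) * (h * y)" by (simp add: mult_ac)
    ultimately show ?thesis by (simp only: mem_Collect_eq) blast
  qed
  have "bij_betw (\<lambda>(x, y). x * y) (?A \<times> ?B) ?C"
    unfolding bij_betw_def
  proof
    show "inj_on (\<lambda>(x, y). x * y) (?A \<times> ?B)"
    proof (rule inj_onI)
      fix u u' assume u: "u \<in> ?A \<times> ?B" "u' \<in> ?A \<times> ?B" "(case u of (x, y) \<Rightarrow> x * y) = (case u' of (x, y) \<Rightarrow> x * y)"
      obtain x y x' y' where uu: "u = (x, y)" "u' = (x', y')" by fastforce
      have xy: "x \<in> ?A" "y \<in> ?B" "x' \<in> ?A" "y' \<in> ?B" "x * y = x' * y'"
        using u unfolding uu by (blast, blast, blast, blast, simp)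
      have nz: "x' \<noteq> 0" "y \<noteq> 0" using xy has_order_nonzero by blast+
      \<comment> \<open>Two factorisations of the same element differ by a number that is killed by
        both \<open>D\<close> and \<open>E\<close>, hence by 1.\<close>
      let ?z = "x / x'"
      have z: "?z = y' / y" using xy(5) nz by (simp add: field_simps)
      have "?z ^ D = 1" using A[OF xy(1)] A[OF xy(3)] by (simp add: power_divide)
      moreover have "?z ^ E = 1" unfolding z using B[OF xy(2)] B[OF xy(4)] by (simp add: power_divide)
      ultimately obtain d where "has_order ?z d" "d dvd D" "d dvd E"
        using has_order_exists[OF _ DE(1)] has_orderD by metis
      then have "?z = 1" using DE(3) by (metis coprime_common_divisor has_order_one_iff nat_dvd_1_iff_1 One_nat_def)
      then have "x = x'" "y' = y" using nz z by (simp_all add: divide_eq_1_iff)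
      then show "u = u'" using uu by simp
    qed
    show "(\<lambda>(x, y). x * y) ` (?A \<times> ?B) = ?C"
    proof (intro equalityI subsetI)
      fix w assume "w \<in> (\<lambda>(x, y). x * y) ` (?A \<times> ?B)"
      then obtain x y where "w = x * y" "x \<in> ?A" "y \<in> ?B" by auto
      then show "w \<in> ?C" using C[OF A B] by blast
    next
      fix w assume w: "w \<in> ?C"
      then have "has_order w (a\<^sub>1 * a\<^sub>2)" by simp
      then have "w ^ (D * E) = 1" using has_orderD mult_dvd_mono[OF D(1) E(1)] by blast
      then obtain x y where "w = x * y" "x ^ D = 1" "y ^ E = 1"
        using root_unity_split DE by metis
      then show "w \<in> (\<lambda>(x, y). x * y) ` (?A \<times> ?B)" using C[of x y] w by auto
    qed
  qed
  then have "card (?A \<times> ?B) = card ?C" by (rule bij_betw_same_card)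
  then show ?thesis by (simp add: card_cartesian_product)
qed

text \<open>Induction splitting off the \<open>q\<close>-part of all three numbers and of
  \<open>g\<close>. The set \<open>P\<close> may contain primes that divide none of them, which
  gives \<open>d\<close>, \<open>t\<close> and \<open>s\<close> a common index set; such primes
  contribute the factor 1.\<close>

lemma card_mult_order_prod:
  fixes g :: complex
  assumes "finite P" "\<And>q. q \<in> P \<Longrightarrow> prime q"
    and "d > 0" "s > 0" "prime_factors d \<subseteq> P" "prime_factors t \<subseteq> P" "prime_factors s \<subseteq> P"
    and "has_order g t"
  shows "(of_nat (card {x. has_order x d \<and> has_order (g * x) s}) :: rat) =
    of_nat (totient s) * (\<Prod>q\<in>P. local_factor q (multiplicity q d) (multiplicity q t) (multiplicity q s))"
  using assms
proof (induction P arbitrary: d t s g rule: finite_induct)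
  case empty
  have e: "u = 1" if "u > 0" "prime_factors u \<subseteq> {}" for u :: nat
  proof (rule ccontr)
    assume "u \<noteq> 1"
    then obtain r where "prime r" "r dvd u" using prime_factor_nat by blast
    then have "r \<in> prime_factors u" using that(1) by (simp only: in_prime_factors_iff) simp
    then show False using that(2) by blast
  qed
  have "d = 1" "s = 1" "t = 1" using e empty has_order_pos by blast+
  moreover have "{x. x = 1 \<and> g * x = 1} = {1}" using calculation(3) empty.prems by auto
  ultimately show ?case by simp
next
  case (insert q P)
  have q: "prime q" using insert by blast
  have nu: "\<not> is_unit q" using q not_prime_unit by blast
  have dec: "\<exists>u'. u = q ^ multiplicity q u * u' \<and> u' > 0 \<and> coprime q u' \<and> prime_factors u' \<subseteq> P \<and>
      (\<forall>r\<in>P. multiplicity r u = multiplicity r u')"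
    if u: "u > 0" "prime_factors u \<subseteq> insert q P" for u
  proof -
    obtain u' where u': "u = q ^ multiplicity q u * u'" "\<not> q dvd u'"
      using multiplicity_decompose'[of u q] u nu by auto
    have u0: "u' > 0" using u u' by (metis gr0I mult_0_right less_numeral_extra(3))
    have "u' dvd u" using u'(1) by (metis dvd_triv_right)
    then have "prime_factors u' \<subseteq> prime_factors u" using u(1) by (simp add: dvd_prime_factors)
    moreover have "q \<notin> prime_factors u'" using u' by auto
    ultimately have "prime_factors u' \<subseteq> P" using u(2) by blast
    moreover have "multiplicity r u = multiplicity r u'" if "r \<in> P" for r
    proof -
      have r: "prime r" "r \<noteq> q" using insert that by auto
      have "multiplicity r (q ^ multiplicity q u * u') = multiplicity r u'"
        using r q u0 by (subst prime_elem_multiplicity_mult_distrib) (auto simp: multiplicity_distinct_prime_power)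
      then show ?thesis using u'(1) by simp
    qed
    moreover have "coprime q u'" using u'(2) q by (simp add: prime_imp_coprime)
    ultimately show ?thesis using u' u0 by blast
  qed
  have t: "t > 0" using insert.prems has_order_pos by blast
  obtain d' where d': "d = q ^ multiplicity q d * d'" "d' > 0" "coprime q d'" "prime_factors d' \<subseteq> P"
    "\<forall>r\<in>P. multiplicity r d = multiplicity r d'" using dec[of d] insert.prems by blast
  obtain t' where t': "t = q ^ multiplicity q t * t'" "t' > 0" "coprime q t'" "prime_factors t' \<subseteq> P"
    "\<forall>r\<in>P. multiplicity r t = multiplicity r t'" using dec[of t] insert.prems t by blast
  obtain s' where s': "s = q ^ multiplicity q s * s'" "s' > 0" "coprime q s'" "prime_factors s' \<subseteq> P"
    "\<forall>r\<in>P. multiplicity r s = multiplicity r s'" using dec[of s] insert.prems by blast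
  let ?a = "multiplicity q d" and ?b = "multiplicity q t" and ?c = "multiplicity q s"
  \<comment> \<open>Any coprime common multiples of the \<open>q\<close>-parts and of the parts
    prime to \<open>q\<close> will do; adding exponents and multiplying cofactors gives crude
    ones.\<close>
  define D where "D = q ^ (?a + ?b + ?c)"
  define E where "E = d' * t' * s'"
  have DE: "D > 0" "E > 0" "coprime D E"
    using d' t' s' q prime_gt_0_nat by (auto simp: D_def E_def)
  have cop: "coprime (q ^ ?b) t'" using t' by simp
  have "g ^ (q ^ ?b * t') = 1" using has_order_self[OF insert.prems(7)] t'(1) by simp
  then obtain x y where xy: "g = x * y" "x ^ (q ^ ?b) = 1" "y ^ t' = 1"
    using root_unity_split[OF _ _ t'(2) cop] q prime_gt_0_nat by (metis zero_less_power)
  have "has_order x (q ^ ?b) \<and> has_order y t'"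
    using has_order_mult_coprime_iff[OF xy(2,3) _ t'(2) cop, of "q ^ ?b" t'] insert.prems(7) t'(1) xy(1) q prime_gt_0_nat
    by simp
  then have ox: "has_order x (q ^ ?b)" and oy: "has_order y t'" by auto
  have "card {x. has_order x d \<and> has_order (g * x) s} =
    card {z. has_order z (q ^ ?a * d') \<and> has_order (x * y * z) (q ^ ?c * s')}"
    using d'(1) s'(1) xy(1) by simp
  also have "\<dots> = card {z. has_order z (q ^ ?a) \<and> has_order (x * z) (q ^ ?c)} *
    card {z. has_order z d' \<and> has_order (y * z) s'}"
  proof (rule card_mult_order_mult[OF DE])
    show "q ^ ?a dvd D" "q ^ ?c dvd D" by (auto simp: D_def le_imp_power_dvd)
    have "q ^ ?b dvd D" by (auto simp: D_def le_imp_power_dvd)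
    then show "x ^ D = 1" using ox has_orderD by blast
    show "d' dvd E" "s' dvd E" by (auto simp: E_def)
    have "t' dvd E" by (auto simp: E_def)
    then show "y ^ E = 1" using oy has_orderD by blast
  qed
  finally have "(of_nat (card {x. has_order x d \<and> has_order (g * x) s}) :: rat) =
     of_nat (card {z. has_order z (q ^ ?a) \<and> has_order (x * z) (q ^ ?c)}) *
     of_nat (card {z. has_order z d' \<and> has_order (y * z) s'})" by simp
  also have "\<dots> = (of_nat (totient (q ^ ?c)) * local_factor q ?a ?b ?c) *
     (of_nat (totient s') * (\<Prod>q\<in>P. local_factor q (multiplicity q d') (multiplicity q t') (multiplicity q s')))"
    by (subst card_mult_order_prime_power[OF q ox], subst insert.IH[of d' s' t' y])
       (use d' t' s' oy insert.prems in auto)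
  also have "(\<Prod>q\<in>P. local_factor q (multiplicity q d') (multiplicity q t') (multiplicity q s')) =
     (\<Prod>q\<in>P. local_factor q (multiplicity q d) (multiplicity q t) (multiplicity q s))"
    using d'(5) t'(5) s'(5) by simp
  finally have "(of_nat (card {x. has_order x d \<and> has_order (g * x) s}) :: rat) =
    (of_nat (totient (q ^ ?c)) * local_factor q ?a ?b ?c) * (of_nat (totient s') *
     (\<Prod>q\<in>P. local_factor q (multiplicity q d) (multiplicity q t) (multiplicity q s)))" .
  moreover have "totient s = totient (q ^ ?c) * totient s'"
    using totient_mult_coprime[of "q ^ ?c" s'] s' by simp
  ultimately show ?case using insert.hyps by (simp add: mult_ac)
qed

section \<open>The set \<open>S_set\<close> and the coefficient \<open>alpha\<close>, prime by
  prime\<close>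

lemma nat_eq_multiplicityI:
  fixes x y :: nat
  assumes "x > 0" "y > 0" "\<And>q. prime q \<Longrightarrow> multiplicity q x = multiplicity q y"
  shows "x = y"
  using multiplicity_eq_imp_eq[of x y] assms by simp

lemma nat_multiplicity_mult:
  fixes x y :: nat
  assumes "prime q" "x > 0" "y > 0"
  shows "multiplicity q (x * y) = multiplicity q x + multiplicity q y"
  using assms by (simp add: prime_elem_multiplicity_mult_distrib)

lemma finite_A_set: "t > 0 \<Longrightarrow> finite (A_set d t)"
  by (rule finite_subset[OF _ finite_set_mset[of "prime_factorization t"]])
     (unfold prime_factors_multiplicity, auto simp: A_set_def)

text \<open>Dividing the \<open>lcm\<close> by the products in \<open>S_set\<close> lowers the
  valuation only at primes of \<open>A_set\<close>, where \<open>d\<close>, \<open>t\<close> and the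
  \<open>lcm\<close> all have the same valuation, and there by an arbitrary amount.\<close>

lemma S_set_iff:
  assumes d: "d > 0" and t: "t > 0" and s: "s > 0"
  shows "s \<in> S_set d t \<longleftrightarrow> (\<forall>q. prime q \<longrightarrow>
    (if q \<in> A_set d t then multiplicity q s \<le> multiplicity q t
     else multiplicity q s = max (multiplicity q d) (multiplicity q t)))"
proof -
  let ?A = "A_set d t" and ?l = "lcm d t"
  have l: "?l > 0" using d t by (simp add: lcm_pos_nat)
  have ml: "multiplicity q ?l = max (multiplicity q d) (multiplicity q t)" if "prime q" for q
    using that d t by (intro multiplicity_lcm) auto
  have fin: "finite ?A" using t by (rule finite_A_set)
  have mp: "multiplicity q (\<Prod>q\<in>?A. q ^ m q) = (if q \<in> ?A then m q else 0)" if "prime q" for q m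
    by (rule multiplicity_prod_prime_powers[OF fin _ that]) (simp add: A_set_def)
  have pos: "(\<Prod>q\<in>?A. q ^ m q) > 0" for m
    by (intro prod_pos) (auto simp: A_set_def intro: prime_gt_0_nat)
  have mA: "multiplicity q d = multiplicity q t" if "q \<in> ?A" for q using that by (simp add: A_set_def)
  show ?thesis
  proof
    assume "s \<in> S_set d t"
    then obtain m where sm: "s = ?l div (\<Prod>q\<in>?A. q ^ m q)" "\<forall>q\<in>?A. m q \<le> multiplicity q t"
      by (auto simp: S_set_def)
    have "(\<Prod>q\<in>?A. q ^ m q) dvd ?l"
    proof (rule multiplicity_le_imp_dvd)
      show "(\<Prod>q\<in>?A. q ^ m q) \<noteq> 0" using pos[of m] by simp
      fix q :: nat assume q: "prime q"
      show "multiplicity q (\<Prod>q\<in>?A. q ^ m q) \<le> multiplicity q ?l"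
        unfolding mp[OF q] ml[OF q] using sm(2) by auto
    qed
    then have "?l = s * (\<Prod>q\<in>?A. q ^ m q)" using sm(1) by simp
    then have "max (multiplicity q d) (multiplicity q t) = multiplicity q s + (if q \<in> ?A then m q else 0)"
      if "prime q" for q
      using nat_multiplicity_mult[OF that s pos[of m]] ml[OF that] mp[OF that] by simp
    then show "\<forall>q. prime q \<longrightarrow> (if q \<in> ?A then multiplicity q s \<le> multiplicity q t
     else multiplicity q s = max (multiplicity q d) (multiplicity q t))"
      using mA by (metis add.right_neutral le_add1 max.idem)
  next
    assume a: "\<forall>q. prime q \<longrightarrow> (if q \<in> ?A then multiplicity q s \<le> multiplicity q t
     else multiplicity q s = max (multiplicity q d) (multiplicity q t))"
    define m where "m = (\<lambda>q. multiplicity q t - multiplicity q s)"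
    have "?l = s * (\<Prod>q\<in>?A. q ^ m q)"
    proof (rule nat_eq_multiplicityI[OF l])
      show "s * (\<Prod>q\<in>?A. q ^ m q) > 0" using s pos[of m] by simp
      fix q :: nat assume q: "prime q"
      show "multiplicity q ?l = multiplicity q (s * (\<Prod>q\<in>?A. q ^ m q))"
        unfolding nat_multiplicity_mult[OF q s pos[of m]] mp[OF q] ml[OF q]
        using a q mA[of q] by (auto simp: m_def split: if_splits)
    qed
    then have "s = ?l div (\<Prod>q\<in>?A. q ^ m q)" using pos[of m] by (metis less_numeral_extra(3) nonzero_mult_div_cancel_right)
    moreover have "\<forall>q\<in>?A. m q \<le> multiplicity q t" by (simp add: m_def)
    ultimately show "s \<in> S_set d t" unfolding S_set_def by blast
  qed
qed

text \<open>The quotient in \<open>S_set\<close> is a division of naturals, so positivity rests on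
  the removed product being a divisor of the \<open>lcm\<close>.\<close>

lemma S_set_pos: "d > 0 \<Longrightarrow> t > 0 \<Longrightarrow> s \<in> S_set d t \<Longrightarrow> s > 0"
proof -
  assume dt: "d > 0" "t > 0" and "s \<in> S_set d t"
  then obtain m where sm: "s = lcm d t div (\<Prod>q\<in>A_set d t. q ^ m q)" "\<forall>q\<in>A_set d t. m q \<le> multiplicity q t"
    by (auto simp: S_set_def)
  let ?p = "\<Prod>q\<in>A_set d t. q ^ m q"
  have pos: "?p > 0" by (intro prod_pos) (auto simp: A_set_def intro: prime_gt_0_nat)
  have "?p dvd lcm d t"
  proof (rule multiplicity_le_imp_dvd)
    show "?p \<noteq> 0" using pos by simp
    fix q :: nat assume q: "prime q"
    have "multiplicity q ?p = (if q \<in> A_set d t then m q else 0)"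
      by (rule multiplicity_prod_prime_powers[OF finite_A_set[OF dt(2)] _ q]) (simp add: A_set_def)
    moreover have "multiplicity q (lcm d t) = max (multiplicity q d) (multiplicity q t)"
      using q dt by (intro multiplicity_lcm) auto
    ultimately show "multiplicity q ?p \<le> multiplicity q (lcm d t)" using sm(2) by auto
  qed
  then show "s > 0" unfolding sm(1) using dt by (metis dvd_div_eq_0_iff gr0I lcm_pos_nat less_numeral_extra(3))
qed

lemma finite_S_set:
  assumes "d > 0" "t > 0" shows "finite (S_set d t)"
  by (rule finite_subset[of _ "{..lcm d t}"]) (auto simp: S_set_def)

lemma totient_prod_multiplicity:
  assumes P: "finite P" "\<And>q. q \<in> P \<Longrightarrow> prime q" and d: "d > 0" "prime_factors d \<subseteq> P"
  shows "totient d = (\<Prod>q\<in>P. totient (q ^ multiplicity q d))"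
proof -
  have "d = (\<Prod>q\<in>P. q ^ multiplicity q d)"
  proof (rule nat_eq_multiplicityI[OF d(1)])
    show "(\<Prod>q\<in>P. q ^ multiplicity q d) > 0" using P by (intro prod_pos) (auto intro: prime_gt_0_nat)
    fix q :: nat assume q: "prime q"
    have "multiplicity q (\<Prod>q\<in>P. q ^ multiplicity q d) = (if q \<in> P then multiplicity q d else 0)"
      by (rule multiplicity_prod_prime_powers[OF P(1) _ q]) (use P in auto)
    moreover have "multiplicity q d = 0" if "q \<notin> P"
      using that d q by (metis in_prime_factors_iff not_dvd_imp_multiplicity_0 less_numeral_extra(3) subsetD)
    ultimately show "multiplicity q d = multiplicity q (\<Prod>q\<in>P. q ^ multiplicity q d)" by auto
  qed
  then have "totient d = totient (\<Prod>q\<in>P. q ^ multiplicity q d)" by simp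
  also have "\<dots> = (\<Prod>q\<in>P. totient (q ^ multiplicity q d))"
    using P
  proof (induction P rule: finite_induct)
    case (insert q P)
    have "coprime (q ^ multiplicity q d) (\<Prod>q\<in>P. q ^ multiplicity q d)"
    proof (intro prod_coprime_right)
      fix r assume "r \<in> P"
      then have "coprime q r" using insert by (intro primes_coprime) auto
      then show "coprime (q ^ multiplicity q d) (r ^ multiplicity r d)" by simp
    qed
    then show ?case using insert by (simp add: totient_mult_coprime)
  qed simp
  finally show ?thesis .
qed

text \<open>The Euler product of \<open>alpha\<close>. The quotient of totients factors over
  \<open>P\<close>, the factors \<open>Q_fun\<close> sit only at primes of \<open>A_set\<close>, and
  a number outside \<open>S_set\<close> fails its condition at some prime, whose local factor is
  0.\<close>

lemma prod_local_factor:
  assumes P: "finite P" "\<And>q. q \<in> P \<Longrightarrow> prime q"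
    and pos: "d > 0" "t > 0" "s > 0" and sub: "prime_factors d \<subseteq> P" "prime_factors t \<subseteq> P" "prime_factors s \<subseteq> P"
  shows "(\<Prod>q\<in>P. local_factor q (multiplicity q d) (multiplicity q t) (multiplicity q s)) =
    (if s \<in> S_set d t then alpha d t s else 0)"
proof (cases "s \<in> S_set d t")
  case True
  note S = True[unfolded S_set_iff[OF pos], rule_format]
  have l: "lcm d t > 0" using pos by (simp add: lcm_pos_nat)
  have subl: "prime_factors (lcm d t) \<subseteq> P"
  proof
    fix q assume "q \<in> prime_factors (lcm d t)"
    then have q: "prime q" "multiplicity q (lcm d t) > 0" by (auto simp: prime_factors_multiplicity)
    moreover have "multiplicity q (lcm d t) = max (multiplicity q d) (multiplicity q t)"
      using q pos by (intro multiplicity_lcm) auto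
    ultimately have "0 < multiplicity q d \<or> 0 < multiplicity q t" by (simp add: less_max_iff_disj)
    then show "q \<in> P" using sub q(1) by (auto simp: prime_factors_multiplicity)
  qed
  have AP: "A_set d t \<subseteq> P" using sub(2) by (auto simp: A_set_def prime_factors_multiplicity)
  have "alpha d t s = (\<Prod>q\<in>P. of_nat (totient (q ^ multiplicity q d)) / of_nat (totient (q ^ multiplicity q (lcm d t)))) *
     (\<Prod>q\<in>A_set d t. Q_fun q (multiplicity q t) s)"
  proof -
    have "(of_nat (totient d) :: rat) = (\<Prod>q\<in>P. of_nat (totient (q ^ multiplicity q d)))"
      by (subst totient_prod_multiplicity[OF P pos(1) sub(1)]) simp_all
    moreover have "(of_nat (totient (lcm d t)) :: rat) = (\<Prod>q\<in>P. of_nat (totient (q ^ multiplicity q (lcm d t))))"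
      by (subst totient_prod_multiplicity[OF P l subl]) simp_all
    ultimately show ?thesis by (simp only: alpha_def prod_dividef)
  qed
  also have "(\<Prod>q\<in>A_set d t. Q_fun q (multiplicity q t) s) = (\<Prod>q\<in>P. if q \<in> A_set d t then Q_fun q (multiplicity q t) s else 1)"
    using P(1) AP by (simp add: prod.If_cases Int_absorb1 Int_commute)
  also have "(\<Prod>q\<in>P. of_nat (totient (q ^ multiplicity q d)) / of_nat (totient (q ^ multiplicity q (lcm d t)))) * \<dots> =
    (\<Prod>q\<in>P. local_factor q (multiplicity q d) (multiplicity q t) (multiplicity q s))"
    unfolding prod.distrib[symmetric]
  proof (rule prod.cong[OF refl])
    fix q assume "q \<in> P"
    then have q: "prime q" using P by blast
    have l: "multiplicity q (lcm d t) = max (multiplicity q d) (multiplicity q t)"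
      using q pos by (intro multiplicity_lcm) auto
    have nz: "(of_nat (totient (q ^ k)) :: rat) \<noteq> 0" for k using q prime_gt_0_nat by simp
    show "of_nat (totient (q ^ multiplicity q d)) / of_nat (totient (q ^ multiplicity q (lcm d t))) *
         (if q \<in> A_set d t then Q_fun q (multiplicity q t) s else 1) =
         local_factor q (multiplicity q d) (multiplicity q t) (multiplicity q s)"
    proof (cases "q \<in> A_set d t")
      \<comment> \<open>Here \<open>d\<close> and the \<open>lcm\<close> have the same valuation at
        \<open>q\<close>, so the totients cancel and only \<open>Q_fun\<close> is left.\<close>
      case True
      then have "multiplicity q d = multiplicity q t" "multiplicity q t > 0" by (auto simp: A_set_def)
      then show ?thesis using S[OF q] True l nz by (simp only: local_factor_def Q_fun_def) auto
    next
      case False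
      then have "\<not> (multiplicity q d = multiplicity q t \<and> multiplicity q t > 0)" using q by (auto simp: A_set_def)
      then show ?thesis using S[OF q] False l by (simp only: local_factor_def) auto
    qed
  qed
  finally show ?thesis using True by simp
next
  case False
  then obtain q where q: "prime q" "\<not> (if q \<in> A_set d t then multiplicity q s \<le> multiplicity q t
     else multiplicity q s = max (multiplicity q d) (multiplicity q t))"
    unfolding S_set_iff[OF pos] by blast
  \<comment> \<open>At a prime outside \<open>P\<close> all three valuations vanish, and the
    condition for \<open>S_set\<close> holds there trivially.\<close>
  have "q \<in> P"
  proof (rule ccontr)
    assume "q \<notin> P"
    then have m: "multiplicity q d = 0" "multiplicity q t = 0" "multiplicity q s = 0"
      using sub q(1) by (auto simp: prime_factors_multiplicity)
    show False using q(2) unfolding m max.idem by (cases "q \<in> A_set d t") auto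
  qed
  moreover have "local_factor q (multiplicity q d) (multiplicity q t) (multiplicity q s) = 0"
    using q by (auto simp: local_factor_def A_set_def split: if_splits)
  ultimately have "(\<Prod>q\<in>P. local_factor q (multiplicity q d) (multiplicity q t) (multiplicity q s)) = 0"
    using P(1) by (simp add: prod_zero_iff) blast
  then show ?thesis using False by simp
qed

section \<open>The function \<open>gcd_inf\<close> and the indices of the constituents
  \<open>rho\<close>\<close>

lemma multiplicity_le_self:
  fixes n q :: nat
  assumes "n > 0" "prime q" shows "multiplicity q n \<le> n"
proof -
  have "q ^ multiplicity q n \<le> n" using assms by (simp add: dvd_imp_le multiplicity_dvd)
  moreover have "multiplicity q n < q ^ multiplicity q n"
    using prime_gt_1_nat[OF assms(2)] by (simp add: power_gt_expt)
  ultimately show ?thesis by simp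
qed

text \<open>The sequence is constant from index \<open>n\<close> on: a prime of \<open>s\<close>
  occurs in \<open>s ^ n\<close> at least \<open>n\<close> times, and in \<open>n\<close> at most
  \<open>n\<close> times.\<close>

lemma gcd_inf_eq_gcd:
  assumes n: "n > 0" and s: "s > 0"
  shows "gcd_inf n s = gcd n (s ^ n)"
proof -
  have "gcd n (s ^ k) = gcd n (s ^ n)" if k: "k \<ge> n" for k
  proof (rule nat_eq_multiplicityI)
    fix q :: nat assume q: "prime q"
    have m: "multiplicity q (gcd n (s ^ j)) = min (multiplicity q n) (j * multiplicity q s)" for j
      using q n s by (subst multiplicity_gcd) (auto simp: prime_elem_multiplicity_power_distrib)
    note mn = multiplicity_le_self[OF n q]
    have "min (multiplicity q n) (j * multiplicity q s) = (if multiplicity q s = 0 then 0 else multiplicity q n)"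
      if "j \<ge> n" for j
    proof (cases "multiplicity q s = 0")
      case False
      then have "j * 1 \<le> j * multiplicity q s" by (intro mult_left_mono) auto
      then have "multiplicity q n \<le> j * multiplicity q s" using that mn by linarith
      then show ?thesis using False by (simp add: min_absorb1)
    qed simp
    then show "multiplicity q (gcd n (s ^ k)) = multiplicity q (gcd n (s ^ n))"
      unfolding m using k by simp
  qed (use n in auto)
  then have "(\<lambda>k. gcd n (s ^ k)) \<longlonglongrightarrow> gcd n (s ^ n)"
    by (intro tendsto_eventually eventually_sequentiallyI[of n])
  then show ?thesis unfolding gcd_inf_def by (rule limI)
qed

lemma multiplicity_gcd_inf:
  assumes n: "n > 0" and s: "s > 0" and q: "prime q"
  shows "multiplicity q (gcd_inf n s) = (if multiplicity q s = 0 then 0 else multiplicity q n)"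
proof -
  have m: "multiplicity q (gcd_inf n s) = min (multiplicity q n) (n * multiplicity q s)"
    unfolding gcd_inf_eq_gcd[OF n s] using q n s
    by (subst multiplicity_gcd) (auto simp: prime_elem_multiplicity_power_distrib)
  note mn = multiplicity_le_self[OF n q]
  show ?thesis
  proof (cases "multiplicity q s = 0")
    case False
    then have "n * 1 \<le> n * multiplicity q s" by (intro mult_left_mono) auto
    then have "multiplicity q n \<le> n * multiplicity q s" using mn by linarith
    then show ?thesis using False m by (simp add: min_absorb1)
  qed (use m in simp)
qed

lemma gcd_inf_dvd: "n > 0 \<Longrightarrow> s > 0 \<Longrightarrow> gcd_inf n s dvd n"
  by (simp add: gcd_inf_eq_gcd)

lemma gcd_inf_pos: "n > 0 \<Longrightarrow> s > 0 \<Longrightarrow> gcd_inf n s > 0"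
  by (simp add: gcd_inf_eq_gcd)

text \<open>Every prime of \<open>gcd_inf n s\<close> already divides \<open>s\<close>, and at such
  a prime raising the exponent by one multiplies the totient by that prime.\<close>

lemma totient_mult_gcd_inf:
  assumes n: "n > 0" and s: "s > 0"
  shows "totient (s * gcd_inf n s) = gcd_inf n s * totient s"
proof -
  let ?g = "gcd_inf n s"
  have g: "?g > 0" using n s by (rule gcd_inf_pos)
  let ?P = "prime_factors s"
  have P: "finite ?P" "\<And>q. q \<in> ?P \<Longrightarrow> prime q" by auto
  have sub: "prime_factors (s * ?g) \<subseteq> ?P"
  proof
    fix q assume "q \<in> prime_factors (s * ?g)"
    then have q: "prime q" "multiplicity q (s * ?g) > 0" by (auto simp: prime_factors_multiplicity)
    then have "multiplicity q s > 0"
      using multiplicity_gcd_inf[OF n s q(1)] nat_multiplicity_mult[OF q(1) s g] by (auto split: if_splits)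
    then show "q \<in> ?P" using q by (simp add: prime_factors_multiplicity)
  qed
  have sub': "prime_factors ?g \<subseteq> ?P" using sub g s by (auto simp: prime_factors_product)
  have ge: "?g = (\<Prod>q\<in>?P. q ^ multiplicity q ?g)"
  proof (rule nat_eq_multiplicityI[OF g])
    show "(\<Prod>q\<in>?P. q ^ multiplicity q ?g) > 0" by (intro prod_pos) (auto intro: prime_gt_0_nat)
    fix q :: nat assume q: "prime q"
    have "multiplicity q (\<Prod>q\<in>?P. q ^ multiplicity q ?g) = (if q \<in> ?P then multiplicity q ?g else 0)"
      by (rule multiplicity_prod_prime_powers[OF P(1) _ q]) (use P in auto)
    moreover have "multiplicity q ?g = 0" if "q \<notin> ?P"
      using that sub' q g by (metis in_prime_factors_iff not_dvd_imp_multiplicity_0 less_numeral_extra(3) subsetD)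
    ultimately show "multiplicity q ?g = multiplicity q (\<Prod>q\<in>?P. q ^ multiplicity q ?g)" by auto
  qed
  have "totient (s * ?g) = (\<Prod>q\<in>?P. totient (q ^ multiplicity q (s * ?g)))"
    by (rule totient_prod_multiplicity[OF P _ sub]) (use g s in auto)
  also have "\<dots> = (\<Prod>q\<in>?P. q ^ multiplicity q ?g * totient (q ^ multiplicity q s))"
  proof (rule prod.cong[OF refl])
    fix q assume "q \<in> ?P"
    then have q: "prime q" "multiplicity q s > 0" by (auto simp: prime_factors_multiplicity)
    then obtain k where k: "multiplicity q s = Suc k" using gr0_implies_Suc by blast
    show "totient (q ^ multiplicity q (s * ?g)) = q ^ multiplicity q ?g * totient (q ^ multiplicity q s)"
      unfolding nat_multiplicity_mult[OF q(1) s g] k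
      using totient_prime_power_Suc[OF q(1), of "k + multiplicity q ?g"] totient_prime_power_Suc[OF q(1), of k]
      by (simp add: power_add mult_ac)
  qed
  also have "\<dots> = (\<Prod>q\<in>?P. q ^ multiplicity q ?g) * (\<Prod>q\<in>?P. totient (q ^ multiplicity q s))"
    by (rule prod.distrib)
  also have "\<dots> = ?g * totient s"
    using ge totient_prod_multiplicity[OF P s] by simp
  finally show ?thesis .
qed

lemma beta_eq_1:
  assumes "n > 0" "s > 0" shows "beta n s = 1"
  unfolding beta_def totient_mult_gcd_inf[OF assms] using gcd_inf_pos[OF assms] assms by simp

text \<open>Explains the indices in the formula. The left side says that at each prime
  \<open>m\<close> has the valuation of \<open>s\<close> plus the smaller of the valuations of
  \<open>m\<close> and \<open>n\<close>. At primes of \<open>s\<close> this forces the sum of the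
  valuations of \<open>s\<close> and \<open>n\<close>, collected in \<open>s * gcd_inf n s\<close>;
  at the other primes \<open>m\<close> may have any valuation up to that of \<open>n\<close>,
  collected in \<open>k\<close>.\<close>

lemma div_gcd_eq_iff_gcd_inf:
  assumes n: "n > 0" and s: "s > 0" and m: "m > 0"
  shows "m div gcd m n = s \<longleftrightarrow> (\<exists>k. k dvd n div gcd_inf n s \<and> m = s * gcd_inf n s * k)"
proof -
  let ?g = "gcd_inf n s"
  have g: "?g > 0" using n s by (rule gcd_inf_pos)
  obtain c where c: "n = ?g * c" using gcd_inf_dvd[OF n s] by (auto elim: dvdE)
  have c0: "c > 0" using c n by (metis gr0I mult_0_right less_numeral_extra(3))
  have ngc: "n div ?g = c" using g by (subst c) simp
  have mg: "multiplicity q ?g = (if multiplicity q s = 0 then 0 else multiplicity q n)"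
    and mc: "multiplicity q c = (if multiplicity q s = 0 then multiplicity q n else 0)"
    and mgcd: "multiplicity q (gcd m n) = min (multiplicity q m) (multiplicity q n)" if "prime q" for q
  proof -
    show 1: "multiplicity q ?g = (if multiplicity q s = 0 then 0 else multiplicity q n)"
      using multiplicity_gcd_inf[OF n s that] .
    have "multiplicity q n = multiplicity q ?g + multiplicity q c"
      using nat_multiplicity_mult[OF that g c0] c by simp
    then show "multiplicity q c = (if multiplicity q s = 0 then multiplicity q n else 0)" using 1 by auto
    show "multiplicity q (gcd m n) = min (multiplicity q m) (multiplicity q n)"
      using that m n by (intro multiplicity_gcd) auto
  qed
  have gcd0: "gcd m n > 0" using m by simp
  have "m div gcd m n = s \<longleftrightarrow> m = s * gcd m n"
    using gcd0 by (metis dvd_div_mult_self gcd_dvd1 less_numeral_extra(3) nonzero_mult_div_cancel_right)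
  also have "\<dots> \<longleftrightarrow> (\<forall>q. prime q \<longrightarrow> multiplicity q m = multiplicity q s + min (multiplicity q m) (multiplicity q n))"
  proof
    assume "m = s * gcd m n"
    then show "\<forall>q. prime q \<longrightarrow> multiplicity q m = multiplicity q s + min (multiplicity q m) (multiplicity q n)"
      using nat_multiplicity_mult[OF _ s gcd0] mgcd by metis
  next
    assume *: "\<forall>q. prime q \<longrightarrow> multiplicity q m = multiplicity q s + min (multiplicity q m) (multiplicity q n)"
    show "m = s * gcd m n"
      by (rule nat_eq_multiplicityI[OF m]) (use * s gcd0 mgcd nat_multiplicity_mult[OF _ s gcd0] in auto)
  qed
  also have "\<dots> \<longleftrightarrow> (\<exists>k. k dvd c \<and> m = s * ?g * k)"
  proof
    assume *: "\<forall>q. prime q \<longrightarrow> multiplicity q m = multiplicity q s + min (multiplicity q m) (multiplicity q n)"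
    have "s * ?g dvd m"
    proof (rule multiplicity_le_imp_dvd)
      show "s * ?g \<noteq> 0" using s g by simp
      fix q :: nat assume q: "prime q"
      show "multiplicity q (s * ?g) \<le> multiplicity q m"
        unfolding nat_multiplicity_mult[OF q s g] mg[OF q] using *[rule_format, OF q] by auto
    qed
    then obtain k where k: "m = s * ?g * k" by (auto elim: dvdE)
    then have k0: "k > 0" using m by (metis gr0I mult_0_right less_numeral_extra(3))
    have "k dvd c"
    proof (rule multiplicity_le_imp_dvd)
      show "k \<noteq> 0" using k0 by simp
      fix q :: nat assume q: "prime q"
      have "multiplicity q m = multiplicity q s + multiplicity q ?g + multiplicity q k"
        unfolding k using q s g k0 by (simp add: nat_multiplicity_mult)
      then show "multiplicity q k \<le> multiplicity q c"
        unfolding mg[OF q] mc[OF q] using *[rule_format, OF q] by (auto split: if_splits)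
    qed
    then show "\<exists>k. k dvd c \<and> m = s * ?g * k" using k by blast
  next
    assume "\<exists>k. k dvd c \<and> m = s * ?g * k"
    then obtain k where k: "k dvd c" "m = s * ?g * k" by blast
    then have k0: "k > 0" using m by (metis gr0I mult_0_right less_numeral_extra(3))
    show "\<forall>q. prime q \<longrightarrow> multiplicity q m = multiplicity q s + min (multiplicity q m) (multiplicity q n)"
    proof (intro allI impI)
      fix q :: nat assume q: "prime q"
      have "multiplicity q m = multiplicity q s + multiplicity q ?g + multiplicity q k"
        unfolding k(2) using q s g k0 by (simp add: nat_multiplicity_mult)
      moreover have "multiplicity q k \<le> multiplicity q c" using k(1) c0 by (simp add: dvd_imp_multiplicity_le)
      ultimately show "multiplicity q m = multiplicity q s + min (multiplicity q m) (multiplicity q n)"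
        unfolding mg[OF q] mc[OF q] by (auto split: if_splits)
    qed
  qed
  finally show ?thesis unfolding ngc .
qed

text \<open>Different \<open>k\<close> give different indices, so each \<open>m\<close> is met at
  most once.\<close>

lemma sum_rho_coeff:
  assumes n: "n > 0" and s: "s > 0" and m: "m > 0"
  shows "(\<Sum>k | k dvd n div gcd_inf n s. rho_coeff (s * gcd_inf n s * k) m) =
    (if m div gcd m n = s then 1 else 0)"
proof -
  let ?g = "gcd_inf n s" and ?K = "{k. k dvd n div gcd_inf n s}"
  have g: "?g > 0" using n s by (rule gcd_inf_pos)
  have "n div ?g > 0" using gcd_inf_dvd[OF n s] n g by (simp add: div_greater_zero_iff dvd_imp_le)
  then have fin: "finite ?K" by simp
  have inj: "s * ?g * k = s * ?g * k' \<longleftrightarrow> k = k'" for k k' using s g by simp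
  show ?thesis
  proof (cases "m div gcd m n = s")
    case True
    then obtain k where k: "k \<in> ?K" "m = s * ?g * k"
      using div_gcd_eq_iff_gcd_inf[OF n s m] by auto
    have "(\<Sum>j\<in>?K. rho_coeff (s * ?g * j) m) = (\<Sum>j\<in>?K. if j = k then 1 else 0)"
      by (intro sum.cong refl) (simp only: rho_coeff_def k(2) inj, auto)
    also have "\<dots> = 1" using k(1) fin by (subst sum.delta) auto
    finally show ?thesis using True by simp
  next
    case False
    then have "rho_coeff (s * ?g * j) m = 0" if "j \<in> ?K" for j
      using that div_gcd_eq_iff_gcd_inf[OF n s m] by (auto simp: rho_coeff_def)
    then show ?thesis using False by simp
  qed
qed

section \<open>The two root counts behind the two sums of the formula\<close>

lemma card_order_fibre:
  fixes c :: complex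
  assumes c: "has_order c t" and n: "n > 0" and m: "m > 0"
  shows "(of_nat (card {w. has_order w m \<and> w ^ n = c}) :: rat) =
    of_nat (totient m) * (beta n t / of_nat (totient t)) *
      (\<Sum>k | k dvd n div gcd_inf n t. rho_coeff (t * k * gcd_inf n t) m)"
proof -
  have t: "t > 0" using c by (rule has_order_pos)
  have "(\<Sum>k | k dvd n div gcd_inf n t. rho_coeff (t * k * gcd_inf n t) m) =
    (if m div gcd m n = t then 1 else 0)"
    using sum_rho_coeff[OF n t m] by (simp add: mult_ac)
  then show ?thesis unfolding card_power_fibre[OF c m] beta_eq_1[OF n t] by simp
qed

lemma card_mult_order:
  fixes c :: complex
  assumes c: "has_order c t" and d: "d > 0" and s: "s > 0"
  shows "(of_nat (card {x. has_order x d \<and> has_order (c * x) s}) :: rat) =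
    of_nat (totient s) * (if s \<in> S_set d t then alpha d t s else 0)"
proof -
  have t: "t > 0" using c by (rule has_order_pos)
  let ?P = "prime_factors d \<union> prime_factors t \<union> prime_factors s"
  have P: "finite ?P" "\<And>q. q \<in> ?P \<Longrightarrow> prime q" by auto
  have sub: "prime_factors d \<subseteq> ?P" "prime_factors t \<subseteq> ?P" "prime_factors s \<subseteq> ?P" by blast+
  show ?thesis
    by (subst card_mult_order_prod[OF P(1) _ d s sub c], use P(2) in blast,
        subst prod_local_factor[OF P(1) _ d t s sub], use P(2) in blast, rule refl)
qed

text \<open>The roots \<open>w\<close> are sorted by \<open>x = w ^ n / c\<close>: the order
  \<open>d\<close> of \<open>x\<close> runs through the divisors of \<open>n'\<close>, and the order
  of \<open>c * x = w ^ n\<close> is the index \<open>s\<close>. For fixed \<open>x\<close> the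
  fibre is counted by \<open>card_power_fibre\<close>, and the admissible \<open>x\<close> are
  counted by \<open>card_mult_order\<close>, where the totient of \<open>s\<close> cancels.\<close>

lemma card_order_fibre_twist:
  fixes c :: complex
  assumes c: "has_order c t" and n: "n > 0" and m: "m > 0" and n': "n' > 0"
  shows "(of_nat (card {w. has_order w m \<and> (w ^ n / c) ^ n' = 1}) :: rat) =
    of_nat (totient m) * (\<Sum>d | d dvd n'. \<Sum>s\<in>S_set d t. \<Sum>k | k dvd n div gcd_inf n s.
      alpha d t s * beta n s * rho_coeff (s * gcd_inf n s * k) m)"
proof -
  have t: "t > 0" using c by (rule has_order_pos)
  have c0: "c \<noteq> 0" using c by (rule has_order_nonzero)
  \<comment> \<open>The order of \<open>w ^ n\<close> for every \<open>w\<close> of order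
    \<open>m\<close>; so only one \<open>s\<close> can contribute to a given
    \<open>m\<close>.\<close>
  define s where "s = m div gcd m n"
  have s: "s > 0" using m by (simp add: s_def div_greater_zero_iff)
  let ?F = "\<lambda>y. {w::complex. has_order w m \<and> w ^ n = y}"
  let ?Y = "\<lambda>d. {x::complex. has_order x d}"
  have finF: "finite (?F y)" for y by (rule finite_subset[OF _ finite_has_order[of m]]) auto
  have ord: "\<exists>e. has_order (c * x) e" if "has_order x d" for x d
  proof -
    have "(c * x) ^ (t * d) = (c ^ t) ^ d * (x ^ d) ^ t" by (simp add: power_mult_distrib mult.commute flip: power_mult)
    also have "\<dots> = 1" using has_order_self[OF c] has_order_self[OF that] by simp
    finally show ?thesis using has_order_exists[of "c * x" "t * d"] t has_order_pos[OF that] by (metis mult_pos_pos)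
  qed
  have "{w. has_order w m \<and> (w ^ n / c) ^ n' = 1} = (\<Union>d\<in>{d. d dvd n'}. \<Union>x\<in>?Y d. ?F (c * x))"
  proof (intro equalityI subsetI)
    fix w assume "w \<in> {w. has_order w m \<and> (w ^ n / c) ^ n' = 1}"
    then have w: "has_order w m" "(w ^ n / c) ^ n' = 1" by auto
    obtain d where "has_order (w ^ n / c) d" "d dvd n'" using has_order_exists[OF w(2) n'] by blast
    moreover have "w ^ n = c * (w ^ n / c)" using c0 by simp
    ultimately show "w \<in> (\<Union>d\<in>{d. d dvd n'}. \<Union>x\<in>?Y d. ?F (c * x))" using w(1) by blast
  next
    fix w assume "w \<in> (\<Union>d\<in>{d. d dvd n'}. \<Union>x\<in>?Y d. ?F (c * x))"
    then obtain d x where w: "d dvd n'" "has_order x d" "has_order w m" "w ^ n = c * x" by auto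
    then have "x ^ n' = 1" using has_orderD by blast
    then show "w \<in> {w. has_order w m \<and> (w ^ n / c) ^ n' = 1}" using w c0 by simp
  qed
  also have "card \<dots> = (\<Sum>d\<in>{d. d dvd n'}. card (\<Union>x\<in>?Y d. ?F (c * x)))"
  proof (rule card_UN_disjoint)
    show "finite {d. d dvd n'}" using n' by simp
    show "\<forall>d\<in>{d. d dvd n'}. finite (\<Union>x\<in>?Y d. ?F (c * x))" using finF by auto
    show "\<forall>i\<in>{d. d dvd n'}. \<forall>j\<in>{d. d dvd n'}. i \<noteq> j \<longrightarrow> (\<Union>x\<in>?Y i. ?F (c * x)) \<inter> (\<Union>x\<in>?Y j. ?F (c * x)) = {}"
    proof (intro ballI impI equals0I)
      fix i j w assume ij: "i \<noteq> j" "w \<in> (\<Union>x\<in>?Y i. ?F (c * x)) \<inter> (\<Union>x\<in>?Y j. ?F (c * x))"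
      then obtain x y where "has_order x i" "w ^ n = c * x" "has_order y j" "w ^ n = c * y" by blast
      then have "has_order x i" "has_order x j" using c0 by auto
      then show False using ij(1) has_order_unique by blast
    qed
  qed
  also have "\<dots> = (\<Sum>d\<in>{d. d dvd n'}. \<Sum>x\<in>?Y d. card (?F (c * x)))"
    by (intro sum.cong refl card_UN_disjoint) (use finF c0 in auto)
  finally have "(of_nat (card {w. has_order w m \<and> (w ^ n / c) ^ n' = 1}) :: rat) =
    (\<Sum>d | d dvd n'. \<Sum>x\<in>?Y d. of_nat (card (?F (c * x))))" by simp
  also have "\<dots> = (\<Sum>d | d dvd n'. of_nat (totient m) * (\<Sum>s\<in>S_set d t. \<Sum>k | k dvd n div gcd_inf n s.
      alpha d t s * beta n s * rho_coeff (s * gcd_inf n s * k) m))"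
  proof (rule sum.cong[OF refl])
    fix d assume "d \<in> {d. d dvd n'}"
    then have d: "d > 0" using n' by (auto intro: Nat.gr0I)
    have "(\<Sum>x\<in>?Y d. (of_nat (card (?F (c * x))) :: rat)) =
      (\<Sum>x\<in>?Y d. if has_order (c * x) s then of_nat (totient m) / of_nat (totient s) else 0)"
    proof (rule sum.cong[OF refl])
      fix x assume "x \<in> ?Y d"
      then obtain e where e: "has_order (c * x) e" using ord by blast
      have "s = e \<longleftrightarrow> has_order (c * x) s" using e has_order_unique by blast
      then show "(of_nat (card (?F (c * x))) :: rat) =
        (if has_order (c * x) s then of_nat (totient m) / of_nat (totient s) else 0)"
        unfolding card_power_fibre[OF e m, of n] s_def[symmetric] by metis
    qed
    also have "\<dots> = of_nat (card {x. has_order x d \<and> has_order (c * x) s}) * (of_nat (totient m) / of_nat (totient s))"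
      by (subst sum.inter_filter[symmetric]) (simp_all add: Collect_conj_eq)
    also have "\<dots> = of_nat (totient m) * (if s \<in> S_set d t then alpha d t s else 0)"
      unfolding card_mult_order[OF c d s] using s by simp
    \<comment> \<open>The single term is spread out over all of \<open>S_set\<close> in order to
      match the double sum, in which \<open>sum_rho_coeff\<close> is the indicator of this
      \<open>s\<close>.\<close>
    also have "(if s \<in> S_set d t then alpha d t s else 0) = (\<Sum>r\<in>S_set d t. if s = r then alpha d t r else 0)"
      using finite_S_set[OF d t] by simp
    also have "\<dots> = (\<Sum>s\<in>S_set d t. \<Sum>k | k dvd n div gcd_inf n s.
      alpha d t s * beta n s * rho_coeff (s * gcd_inf n s * k) m)"
    proof (rule sum.cong[OF refl])
      fix r assume "r \<in> S_set d t"
      then have r: "r > 0" using S_set_pos[OF d t] by blast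
      show "(if s = r then alpha d t r else 0) = (\<Sum>k | k dvd n div gcd_inf n r.
        alpha d t r * beta n r * rho_coeff (r * gcd_inf n r * k) m)"
        unfolding sum_distrib_left[symmetric] sum_rho_coeff[OF n r m] beta_eq_1[OF n r] by (simp add: s_def)
    qed
    finally show "(\<Sum>x\<in>?Y d. (of_nat (card (?F (c * x))) :: rat)) = of_nat (totient m) *
      (\<Sum>s\<in>S_set d t. \<Sum>k | k dvd n div gcd_inf n s. alpha d t s * beta n s * rho_coeff (s * gcd_inf n s * k) m)" .
  qed
  also have "\<dots> = of_nat (totient m) * (\<Sum>d | d dvd n'. \<Sum>s\<in>S_set d t. \<Sum>k | k dvd n div gcd_inf n s.
      alpha d t s * beta n s * rho_coeff (s * gcd_inf n s * k) m)" by (rule sum_distrib_left[symmetric])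
  finally show ?thesis .
qed

section \<open>Eigenspaces of representations\<close>

interpretation cs: vector_space "cscale :: complex \<Rightarrow> ('x \<Rightarrow> complex) \<Rightarrow> 'x \<Rightarrow> complex"
  by (rule vector_space_cscale)

interpretation csp: vector_space_pair "cscale :: complex \<Rightarrow> ('x \<Rightarrow> complex) \<Rightarrow> 'x \<Rightarrow> complex"
  "cscale :: complex \<Rightarrow> ('y \<Rightarrow> complex) \<Rightarrow> 'y \<Rightarrow> complex"
  by unfold_locales

lemma sum_fun_apply: "(\<Sum>i\<in>A. f i) x = (\<Sum>i\<in>A. f i x)"
  by (induction A rule: infinite_finite_induct) (simp_all add: zero_fun_def)

lemma linear_cscaleI:
  assumes "\<And>F F'. T (F + F') = T F + T F'" "\<And>c F. T (cscale c F) = cscale c (T F)"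
  shows "Vector_Spaces.linear cscale cscale T"
  by unfold_locales (fact assms)+

text \<open>The eigenspaces are brought to this shape, or mapped isomorphically onto it, so that
  multiplicities become cardinalities of sets of free coordinates.\<close>

lemma dim_supported:
  assumes Z: "finite Z"
  shows "cs.dim {F. \<forall>x. x \<notin> Z \<longrightarrow> F x = 0} = card Z"
proof -
  define e :: "'a \<Rightarrow> 'a \<Rightarrow> complex" where "e = (\<lambda>x y. if y = x then 1 else 0)"
  have inj: "inj_on e Z" by (auto simp: inj_on_def e_def fun_eq_iff split: if_splits)
  have sume: "(\<Sum>x\<in>Z. cscale (u x) (e x)) y = (if y \<in> Z then u y else 0)" for u y
    using Z by (simp add: sum_fun_apply cscale_def e_def if_distrib[of "(*) _"] cong: if_cong)
  show ?thesis
  proof (rule cs.dim_unique[of "e ` Z"])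
    show "e ` Z \<subseteq> {F. \<forall>x. x \<notin> Z \<longrightarrow> F x = 0}" by (auto simp: e_def)
    show "{F. \<forall>x. x \<notin> Z \<longrightarrow> F x = 0} \<subseteq> cs.span (e ` Z)"
    proof
      fix F :: "'a \<Rightarrow> complex" assume "F \<in> {F. \<forall>x. x \<notin> Z \<longrightarrow> F x = 0}"
      then have "F = (\<Sum>x\<in>Z. cscale (F x) (e x))" by (auto simp: fun_eq_iff sume)
      also have "\<dots> \<in> cs.span (e ` Z)"
        by (intro cs.span_sum cs.span_scale cs.span_base) auto
      finally show "F \<in> cs.span (e ` Z)" .
    qed
    show "cs.independent (e ` Z)"
    proof
      assume "cs.dependent (e ` Z)"
      then obtain u v where u: "v \<in> e ` Z" "u v \<noteq> 0" "(\<Sum>v\<in>e ` Z. cscale (u v) v) = 0"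
        using cs.dependent_finite[of "e ` Z"] Z by auto
      then have "(\<Sum>x\<in>Z. cscale (u (e x)) (e x)) = 0" by (simp add: sum.reindex[OF inj])
      then have "u (e x) = 0" if "x \<in> Z" for x using sume[of "\<lambda>x. u (e x)" x] that by (simp add: zero_fun_def)
      then show False using u by auto
    qed
    show "card (e ` Z) = card Z" using inj by (rule card_image)
  qed
qed

text \<open>Injectivity is asked on \<open>A\<close> alone because the lemma is applied to
  restrictions to a set of coordinates, which have a kernel on the whole function space.\<close>

lemma dim_linear_image:
  fixes T :: "('x \<Rightarrow> complex) \<Rightarrow> ('y \<Rightarrow> complex)"
  assumes T: "Vector_Spaces.linear cscale cscale T" and A: "cs.subspace A" and inj: "inj_on T A"
  shows "cs.dim (T ` A) = cs.dim A"
proof -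
  obtain B where B: "B \<subseteq> A" "cs.independent B" "A \<subseteq> cs.span B" "card B = cs.dim A"
    using cs.basis_exists by blast
  have "cs.span B = A" using B A by (metis cs.span_minimal subset_antisym)
  then have inj': "inj_on T (cs.span B)" using inj by simp
  have "cs.independent (T ` B)" using csp.linear_independent_injective_image[OF T B(2) inj'] .
  moreover have "cs.span (T ` B) = T ` A" using csp.linear_span_image[OF T] \<open>cs.span B = A\<close> by metis
  ultimately have "cs.dim (T ` A) = card (T ` B)" by (metis cs.dim_span_eq_card_independent)
  also have "\<dots> = card B" using inj B(1) by (simp add: card_image inj_on_subset)
  finally show ?thesis using B by simp
qed

definition eigenspace :: "('g, 'b) monoid_scheme \<Rightarrow> ('g, 'x) repr \<Rightarrow> ('g \<Rightarrow> complex) \<Rightarrow> ('x \<Rightarrow> complex) set" where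
  "eigenspace H V \<chi> = {F \<in> space V. \<forall>g\<in>carrier H. act V g F = cscale (\<chi> g) F}"

lemma char_mult_eq_dim: "char_mult G V \<chi> = cs.dim (eigenspace G V \<chi>)"
  by (simp add: char_mult_def eigenspace_def)

text \<open>The record \<open>repr\<close> carries no axioms; these are the ones that make
  eigenspaces subspaces.\<close>

definition linear_rep :: "('g, 'b) monoid_scheme \<Rightarrow> ('g, 'x) repr \<Rightarrow> bool" where
  "linear_rep H V \<longleftrightarrow> cs.subspace (space V) \<and>
     (\<forall>h\<in>carrier H. \<forall>F\<in>space V. \<forall>F'\<in>space V. act V h (F + F') = act V h F + act V h F') \<and>
     (\<forall>h\<in>carrier H. \<forall>c. \<forall>F\<in>space V. act V h (cscale c F) = cscale c (act V h F))"

lemma subspace_eigenspace: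
  assumes V: "linear_rep H V"
  shows "cs.subspace (eigenspace H V \<chi>)"
proof (rule cs.subspaceI)
  have sub: "cs.subspace (space V)" using V by (simp add: linear_rep_def)
  have 0: "0 \<in> space V" using sub by (rule cs.subspace_0)
  have "act V h 0 = cscale 0 (act V h 0)" if "h \<in> carrier H" for h
    using V 0 that unfolding linear_rep_def by (metis cs.scale_zero_right)
  then show "0 \<in> eigenspace H V \<chi>" using 0 by (auto simp: eigenspace_def)
  show "x + y \<in> eigenspace H V \<chi>" if "x \<in> eigenspace H V \<chi>" "y \<in> eigenspace H V \<chi>" for x y
    using that V cs.subspace_add[OF sub] by (auto simp: eigenspace_def linear_rep_def cs.scale_right_distrib)
  show "cscale c x \<in> eigenspace H V \<chi>" if "x \<in> eigenspace H V \<chi>" for c x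
    using that V cs.subspace_scale[OF sub] by (auto simp: eigenspace_def linear_rep_def mult.commute)
qed

lemma character_one:
  assumes "group G" "\<eta> \<in> characters G" shows "\<eta> \<one>\<^bsub>G\<^esub> = 1"
proof -
  interpret group G by fact
  have "\<eta> (\<one>\<^bsub>G\<^esub> \<otimes>\<^bsub>G\<^esub> \<one>\<^bsub>G\<^esub>) = \<eta> \<one>\<^bsub>G\<^esub> * \<eta> \<one>\<^bsub>G\<^esub>" "\<eta> \<one>\<^bsub>G\<^esub> \<noteq> 0"
    using assms(2) unfolding characters_def by blast+
  then show ?thesis by simp
qed

text \<open>Frobenius reciprocity for a one-dimensional character. An eigenfunction for right
  translation is determined by its value \<open>F\<close> at the identity, as
  \<open>\<eta> g * F x\<close>, and it lies in the induced space exactly when \<open>F\<close> is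
  an eigenvector of the subgroup.\<close>

lemma char_mult_ind:
  fixes G H :: "('g, 'b) monoid_scheme" and V :: "('g, 'x) repr"
  assumes G: "group G" and H: "subgroup (carrier H) G" and \<eta>: "\<eta> \<in> characters G" and V: "linear_rep H V"
  shows "char_mult G (ind G H V) \<eta> = char_mult H V \<eta>"
proof -
  interpret group G by fact
  interpret H: subgroup "carrier H" G by fact
  define T :: "('x \<Rightarrow> complex) \<Rightarrow> 'g \<times> 'x \<Rightarrow> complex"
    where "T = (\<lambda>F (g, x). if g \<in> carrier G then \<eta> g * F x else 0)"
  have mult: "\<eta> (a \<otimes>\<^bsub>G\<^esub> b) = \<eta> a * \<eta> b" if "a \<in> carrier G" "b \<in> carrier G" for a b
    using \<eta> that by (auto simp: characters_def)
  have T: "Vector_Spaces.linear cscale cscale T"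
    by (rule linear_cscaleI) (auto simp: T_def cscale_def fun_eq_iff algebra_simps)
  have Tg: "(\<lambda>x. T F (g, x)) = cscale (\<eta> g) F" if "g \<in> carrier G" for F g
    using that by (simp add: T_def cscale_def)
  have img: "T ` eigenspace H V \<eta> = eigenspace G (ind G H V) \<eta>"
  proof (intro equalityI subsetI)
    fix F' assume "F' \<in> T ` eigenspace H V \<eta>"
    then obtain F where F: "F \<in> space V" "\<forall>h\<in>carrier H. act V h F = cscale (\<eta> h) F" "F' = T F"
      by (auto simp: eigenspace_def)
    have sub: "cs.subspace (space V)" using V by (simp add: linear_rep_def)
    have "F' \<in> space (ind G H V)"
      unfolding ind_def repr.select_convs mem_Collect_eq F(3)
    proof (intro conjI ballI allI impI)
      fix g assume g: "g \<in> carrier G"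
      show "(\<lambda>x. T F (g, x)) \<in> space V"
        unfolding Tg[OF g] using F(1) sub by (simp add: cs.subspace_scale)
      fix h assume h: "h \<in> carrier H"
      have "act V h (cscale (\<eta> g) F) = cscale (\<eta> g) (cscale (\<eta> h) F)"
        using V F h unfolding linear_rep_def by metis
      then show "(\<lambda>x. T F (h \<otimes>\<^bsub>G\<^esub> g, x)) = act V h (\<lambda>x. T F (g, x))"
        using Tg[of "h \<otimes>\<^bsub>G\<^esub> g" F] Tg[OF g] mult[of h g] h g by (simp add: mult.commute)
    qed (auto simp: T_def)
    moreover have "act (ind G H V) k F' = cscale (\<eta> k) F'" if "k \<in> carrier G" for k
      using that mult F(3) by (auto simp: ind_def T_def cscale_def fun_eq_iff)
    ultimately show "F' \<in> eigenspace G (ind G H V) \<eta>" by (simp add: eigenspace_def)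
  next
    fix F' assume "F' \<in> eigenspace G (ind G H V) \<eta>"
    then have F': "F' \<in> space (ind G H V)" "\<And>k. k \<in> carrier G \<Longrightarrow> act (ind G H V) k F' = cscale (\<eta> k) F'"
      by (auto simp: eigenspace_def)
    define F where "F = (\<lambda>x. F' (\<one>\<^bsub>G\<^esub>, x))"
    have val: "F' (k, x) = \<eta> k * F x" if "k \<in> carrier G" for k x
      using fun_cong[OF F'(2)[OF that], of "(\<one>\<^bsub>G\<^esub>, x)"] that by (simp add: ind_def cscale_def F_def)
    have zero: "F' (k, x) = 0" if "k \<notin> carrier G" for k x using F'(1) that by (simp add: ind_def)
    have "F' = T F" using val zero by (auto simp: T_def fun_eq_iff)
    moreover have "F \<in> eigenspace H V \<eta>"
    proof -
      have "F \<in> space V" using F'(1) by (simp add: ind_def F_def)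
      moreover have "act V h F = cscale (\<eta> h) F" if h: "h \<in> carrier H" for h
      proof -
        have "(\<lambda>x. F' (h \<otimes>\<^bsub>G\<^esub> \<one>\<^bsub>G\<^esub>, x)) = act V h (\<lambda>x. F' (\<one>\<^bsub>G\<^esub>, x))"
          using F'(1) h one_closed unfolding ind_def repr.select_convs mem_Collect_eq by blast
        then show ?thesis using h val character_one[OF G \<eta>] by (simp add: F_def[symmetric] cscale_def)
      qed
      ultimately show ?thesis by (simp add: eigenspace_def)
    qed
    ultimately show "F' \<in> T ` eigenspace H V \<eta>" by blast
  qed
  have inj: "inj_on T (eigenspace H V \<eta>)"
  proof (rule inj_onI)
    fix F F' assume "T F = T F'"
    then have "T F (\<one>\<^bsub>G\<^esub>, x) = T F' (\<one>\<^bsub>G\<^esub>, x)" for x by simp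
    then show "F = F'" by (simp add: T_def character_one[OF G \<eta>] fun_eq_iff)
  qed
  show ?thesis
    unfolding char_mult_eq_dim img[symmetric] by (rule dim_linear_image[OF T subspace_eigenspace[OF V] inj])
qed

text \<open>
  The eigenspaces of a permutation \<open>\<tau>\<close> all of whose cycles have length \<open>l\<close>, except for the
  fixed points in \<open>S\<^sub>0\<close>: evaluation at a transversal of the cycles is an isomorphism.
\<close>

lemma dim_permutation_eigenspace:
  assumes S: "finite S" and \<tau>_image: "\<tau> ` S \<subseteq> S" and S0: "S\<^sub>0 \<subseteq> S" "\<forall>y\<in>S\<^sub>0. \<tau> y = y"
    and S1: "\<forall>y\<in>S - S\<^sub>0. \<forall>j. (\<tau> ^^ j) y = y \<longleftrightarrow> l dvd j" and l: "l > 0"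
  shows "\<exists>a. card S = l * a + card S\<^sub>0 \<and>
    (\<forall>\<xi>. \<xi> \<noteq> 0 \<longrightarrow> cs.dim {F. (\<forall>x. x \<notin> S \<longrightarrow> F x = 0) \<and> (\<forall>y\<in>S. F (\<tau> y) = \<xi> * F y)} =
       (if \<xi> ^ l = 1 then a else 0) + (if \<xi> = 1 then card S\<^sub>0 else 0))"
proof -
  have \<tau>: "\<tau> y \<in> S" if "y \<in> S" for y using \<tau>_image that by blast
  note S1 = S1[rule_format] and S0 = S0(1) S0(2)[rule_format]
  define S' where "S' = S - S\<^sub>0"
  have fin: "finite S'" "finite S\<^sub>0" using S S0(1) by (auto simp: S'_def intro: finite_subset)
  have per: "(\<tau> ^^ (j + l * k)) y = (\<tau> ^^ j) y" if "y \<in> S'" for j k y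
    unfolding funpow_add using S1[of y "l * k"] that by (simp add: S'_def)
  have pmod: "(\<tau> ^^ j) y = (\<tau> ^^ (j mod l)) y" if "y \<in> S'" for j y
    using per[OF that, of "j mod l" "j div l"] by (simp add: add.commute)
  have \<tau>S: "(\<tau> ^^ j) y \<in> S" if "y \<in> S" for j y using that \<tau> by (induction j) auto
  have \<tau>S': "(\<tau> ^^ j) y \<in> S'" if y: "y \<in> S'" for j y
  proof -
    have "(\<tau> ^^ j) y \<notin> S\<^sub>0"
    proof
      assume a: "(\<tau> ^^ j) y \<in> S\<^sub>0"
      have fix0: "(\<tau> ^^ i) z = z" if "z \<in> S\<^sub>0" for i z using S0(2) that by (induction i) auto
      \<comment> \<open>If an iterate of \<open>y\<close> were one of the fixed points,
        \<open>y\<close> would be that point: \<open>l * j - j\<close> further steps lead back to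
        \<open>y\<close>. The subtraction does not truncate because \<open>l > 0\<close>.\<close>
      have "(\<tau> ^^ ((l * j - j) + j)) y = (\<tau> ^^ j) y" unfolding funpow_add using fix0[OF a] by simp
      moreover have "l * j - j + j = 0 + l * j" using l by simp
      ultimately have "y = (\<tau> ^^ j) y" using per[OF y, of 0 j] by simp
      then show False using a y by (simp add: S'_def)
    qed
    then show ?thesis using \<tau>S y by (simp add: S'_def)
  qed
  define orb where "orb = (\<lambda>y. (\<lambda>j. (\<tau> ^^ j) y) ` {..<l})"
  have orb_mem: "(\<tau> ^^ j) y \<in> orb y" if "y \<in> S'" for y j
    unfolding orb_def using pmod[OF that, of j] l by auto
  have orb_self: "y \<in> orb y" if "y \<in> S'" for y using orb_mem[OF that, of 0] by simp
  have inv: "\<exists>i. (\<tau> ^^ i) ((\<tau> ^^ j) y) = y" if y: "y \<in> S'" for y j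
  proof (rule exI[of _ "l * j - j"])
    have "l * j - j + j = 0 + l * j" using l by simp
    then show "(\<tau> ^^ (l * j - j)) ((\<tau> ^^ j) y) = y"
      using per[OF y, of 0 j] funpow_add[of "l * j - j" j \<tau>] by simp
  qed
  have orb_eq: "orb ((\<tau> ^^ j) y) = orb y" if y: "y \<in> S'" for y j
  proof (intro equalityI subsetI)
    fix z assume "z \<in> orb ((\<tau> ^^ j) y)"
    then obtain i where "z = (\<tau> ^^ i) ((\<tau> ^^ j) y)" by (auto simp: orb_def)
    then have "z = (\<tau> ^^ (i + j)) y" by (simp add: funpow_add)
    then show "z \<in> orb y" using orb_mem[OF y] by blast
  next
    fix z assume "z \<in> orb y"
    then obtain i where i: "z = (\<tau> ^^ i) y" by (auto simp: orb_def)
    obtain k where "(\<tau> ^^ k) ((\<tau> ^^ j) y) = y" using inv[OF y] by blast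
    then have "z = (\<tau> ^^ (i + k)) ((\<tau> ^^ j) y)" using i by (simp add: funpow_add)
    then show "z \<in> orb ((\<tau> ^^ j) y)" using orb_mem[OF \<tau>S'[OF y]] by blast
  qed
  have orb_card: "card (orb y) = l" if y: "y \<in> S'" for y
  proof -
    have "inj_on (\<lambda>j. (\<tau> ^^ j) y) {..<l}"
    proof (rule linorder_inj_onI)
      fix i j assume ij: "i < j" "i \<in> {..<l}" "j \<in> {..<l}"
      show "(\<tau> ^^ i) y \<noteq> (\<tau> ^^ j) y"
      proof
        assume e: "(\<tau> ^^ i) y = (\<tau> ^^ j) y"
        have "(\<tau> ^^ (j - i)) ((\<tau> ^^ i) y) = (\<tau> ^^ i) y"
          using e ij funpow_add[of "j - i" i \<tau>] by simp
        then have "l dvd j - i" using S1[of "(\<tau> ^^ i) y" "j - i"] \<tau>S'[OF y, of i] by (simp add: S'_def)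
        then show False using ij by (auto dest: dvd_imp_le)
      qed
    qed auto
    then show ?thesis by (simp add: orb_def card_image)
  qed
  \<comment> \<open>The choice depends on the set \<open>orb y\<close> only, so all points of a
    cycle get the same representative.\<close>
  define rep where "rep = (\<lambda>y. SOME z. z \<in> orb y)"
  have rep_orb: "rep y \<in> orb y" if "y \<in> S'" for y
    unfolding rep_def using orb_self[OF that] by (rule someI)
  have rep_ex: "\<exists>j. rep y = (\<tau> ^^ j) y" if "y \<in> S'" for y using rep_orb[OF that] by (auto simp: orb_def)
  have rep_S': "rep y \<in> S'" if "y \<in> S'" for y using rep_ex[OF that] \<tau>S'[OF that] by auto
  have orb_rep: "orb (rep y) = orb y" if "y \<in> S'" for y using rep_ex[OF that] orb_eq[OF that] by auto
  have rep_rep: "rep (rep y) = rep y" if "y \<in> S'" for y using orb_rep[OF that] by (simp add: rep_def)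
  have rep_\<tau>: "rep (\<tau> y) = rep y" if "y \<in> S'" for y using orb_eq[OF that, of 1] by (simp add: rep_def)
  define T where "T = rep ` S'"
  have TS: "T \<subseteq> S'" using rep_S' by (auto simp: T_def)
  have cardS': "card S' = l * card T"
  proof -
    have "card (orb ` T) = card T"
    proof (rule card_image, rule inj_onI)
      fix x y assume "x \<in> T" "y \<in> T" "orb x = orb y"
      then have "rep x = rep y" by (simp add: rep_def)
      moreover have "rep x = x" "rep y = y" using \<open>x \<in> T\<close> \<open>y \<in> T\<close> rep_rep by (auto simp: T_def)
      ultimately show "x = y" by simp
    qed
    moreover have "l * card (orb ` T) = card (\<Union>(orb ` T))"
    proof (rule card_partition)
      show "finite (orb ` T)" using fin TS by (meson finite_imageI finite_subset)
      have "\<Union>(orb ` T) \<subseteq> S'" using TS \<tau>S' by (auto simp: orb_def)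
      then show "finite (\<Union>(orb ` T))" using fin finite_subset by blast
      show "\<And>c. c \<in> orb ` T \<Longrightarrow> card c = l" using orb_card TS by blast
      fix c c' assume c: "c \<in> orb ` T" "c' \<in> orb ` T" "c \<noteq> c'"
      show "c \<inter> c' = {}"
      proof (rule equals0I)
        fix z assume z: "z \<in> c \<inter> c'"
        obtain y y' where y: "y \<in> S'" "c = orb y" "y' \<in> S'" "c' = orb y'" using c TS by blast
        obtain j where "z = (\<tau> ^^ j) y" using z y by (auto simp: orb_def)
        moreover obtain j' where "z = (\<tau> ^^ j') y'" using z y by (auto simp: orb_def)
        ultimately have "orb z = c" "orb z = c'" using orb_eq[OF y(1)] orb_eq[OF y(3)] y(2,4) by metis+
        then show False using c by simp
      qed
    qed
    moreover have "\<Union>(orb ` T) = S'"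
    proof (intro equalityI subsetI)
      fix z assume z: "z \<in> S'"
      then have "z \<in> orb (rep z)" using orb_rep orb_self by blast
      then show "z \<in> \<Union>(orb ` T)" using z by (auto simp: T_def)
    qed (use TS \<tau>S' in \<open>auto simp: orb_def\<close>)
    ultimately show ?thesis by simp
  qed
  define jj where "jj = (\<lambda>y. SOME j. (\<tau> ^^ j) (rep y) = y)"
  have jj: "(\<tau> ^^ jj y) (rep y) = y" if "y \<in> S'" for y
    unfolding jj_def using rep_ex[OF that] inv[OF that] by (metis (mono_tags, lifting) someI_ex)
  have dim: "cs.dim {F. (\<forall>x. x \<notin> S \<longrightarrow> F x = 0) \<and> (\<forall>y\<in>S. F (\<tau> y) = \<xi> * F y)} =
       (if \<xi> ^ l = 1 then card T else 0) + (if \<xi> = 1 then card S\<^sub>0 else 0)" if \<xi>: "\<xi> \<noteq> 0" for \<xi> :: complex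
  proof -
    let ?E = "{F. (\<forall>x. x \<notin> S \<longrightarrow> F x = 0) \<and> (\<forall>y\<in>S. F (\<tau> y) = \<xi> * F y)}"
    \<comment> \<open>The free coordinates of an eigenfunction. Going once round a cycle multiplies
      by \<open>\<xi> ^ l\<close>, so the value at its representative is free if this is 1 and is
      forced to be 0 otherwise; a fixed point has the same alternative with
      \<open>\<xi>\<close>.\<close>
    define Z where "Z = (if \<xi> ^ l = 1 then T else {}) \<union> (if \<xi> = 1 then S\<^sub>0 else {})"
    have Zfin: "finite Z" using fin TS by (auto simp: Z_def intro: finite_subset)
    have ZS: "Z \<subseteq> S" using TS S0 by (auto simp: Z_def S'_def)
    have "T \<inter> S\<^sub>0 = {}" using TS by (auto simp: S'_def)
    then have cardZ: "card Z = (if \<xi> ^ l = 1 then card T else 0) + (if \<xi> = 1 then card S\<^sub>0 else 0)"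
      using fin TS by (auto simp: Z_def card_Un_disjoint finite_subset)
    define U :: "('a \<Rightarrow> complex) \<Rightarrow> ('a \<Rightarrow> complex)" where "U = (\<lambda>F x. if x \<in> Z then F x else 0)"
    have U: "Vector_Spaces.linear cscale cscale U"
      by (rule linear_cscaleI) (auto simp: U_def cscale_def fun_eq_iff)
    have sub: "cs.subspace ?E"
      by (rule cs.subspaceI) (auto simp: cscale_def algebra_simps zero_fun_def)
    have pow: "F ((\<tau> ^^ j) y) = \<xi> ^ j * F y" if "F \<in> ?E" "y \<in> S" for F y j
      using that \<tau>S[OF that(2)] by (induction j) auto
    have inj: "inj_on U ?E"
    proof (rule inj_onI, rule ext)
      fix F F' x assume F: "F \<in> ?E" "F' \<in> ?E" and "U F = U F'"
      then have UZ: "F z = F' z" if "z \<in> Z" for z using that by (auto simp: U_def fun_eq_iff split: if_splits)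
      consider "x \<notin> S" | "x \<in> S\<^sub>0" | "x \<in> S'" by (auto simp: S'_def)
      then show "F x = F' x"
      proof cases
        case 2
        show ?thesis
        proof (cases "\<xi> = 1")
          case True
          then show ?thesis using UZ 2 by (simp add: Z_def)
        next
          case False
          have "G x = 0" if "G \<in> ?E" for G
            using pow[OF that, of x 1] S0 2 False by auto
          from this[OF F(1)] this[OF F(2)] show ?thesis by simp
        qed
      next
        case 3
        have r: "rep x \<in> T" "rep x \<in> S" using 3 TS by (auto simp: T_def S'_def)
        have "F (rep x) = F' (rep x)"
        proof (cases "\<xi> ^ l = 1")
          case True
          then show ?thesis using UZ r by (simp add: Z_def)
        next
          case False
          have "G (rep x) = 0" if "G \<in> ?E" for G
          proof -
            have "(\<tau> ^^ l) (rep x) = rep x" using S1[of "rep x" l] rep_S'[OF 3] by (simp add: S'_def)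
            then show ?thesis using pow[OF that r(2), of l] False by auto
          qed
          from this[OF F(1)] this[OF F(2)] show ?thesis by simp
        qed
        then show ?thesis using pow[OF F(1) r(2), of "jj x"] pow[OF F(2) r(2), of "jj x"] jj[OF 3] by simp
      qed (use F in auto)
    qed
    have img: "U ` ?E = {F. \<forall>x. x \<notin> Z \<longrightarrow> F x = 0}"
    proof (intro equalityI subsetI)
      fix G :: "'a \<Rightarrow> complex" assume "G \<in> {F. \<forall>x. x \<notin> Z \<longrightarrow> F x = 0}"
      then have G: "G x = 0" if "x \<notin> Z" for x using that by simp
      define F where "F = (\<lambda>x. if x \<in> S' then \<xi> ^ jj x * G (rep x) else if x \<in> S\<^sub>0 then G x else 0)"
      \<comment> \<open>The exponent \<open>jj\<close> is an arbitrary choice; two exponents leading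
        to the same point differ by a multiple of \<open>l\<close>, so the extension of
        \<open>G\<close> along the cycle is well defined.\<close>
      have pw: "\<xi> ^ i * G (rep y) = \<xi> ^ j * G (rep y)" if y: "y \<in> S'" "(\<tau> ^^ i) (rep y) = (\<tau> ^^ j) (rep y)" for i j y
      proof (cases "\<xi> ^ l = 1")
        case True
        have main: "\<xi> ^ i = \<xi> ^ j" if "i \<le> j" "(\<tau> ^^ i) (rep y) = (\<tau> ^^ j) (rep y)" for i j
        proof -
          have "(\<tau> ^^ (j - i)) ((\<tau> ^^ i) (rep y)) = (\<tau> ^^ i) (rep y)"
            using that funpow_add[of "j - i" i \<tau>] by simp
          then have "l dvd j - i"
            using S1[of "(\<tau> ^^ i) (rep y)" "j - i"] \<tau>S'[OF rep_S'[OF y(1)], of i] by (simp add: S'_def)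
          then have "\<xi> ^ (j - i) = 1" using True by (auto simp: power_mult elim!: dvdE)
          then show ?thesis using that by (metis le_add_diff_inverse mult.right_neutral power_add)
        qed
        show ?thesis using main[of i j] main[of j i] y by (metis nle_le)
      next
        case False
        then have "rep y \<notin> Z" using rep_S'[OF y(1)] by (auto simp: Z_def S'_def)
        then show ?thesis using G by simp
      qed
      have FE: "F \<in> ?E"
      proof (simp, intro conjI allI impI ballI)
        show "F x = 0" if "x \<notin> S" for x using that S0 by (auto simp: F_def S'_def)
        fix y assume "y \<in> S"
        then consider "y \<in> S\<^sub>0" | "y \<in> S'" by (auto simp: S'_def)
        then show "F (\<tau> y) = \<xi> * F y"
        proof cases
          case 1
          have "y \<notin> S'" using 1 by (simp add: S'_def)
          moreover have "G y = \<xi> * G y"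
          proof (cases "\<xi> = 1")
            case False
            then have "y \<notin> Z" using 1 TS by (auto simp: Z_def S'_def)
            then show ?thesis using G by simp
          qed simp
          ultimately show ?thesis using 1 S0(2) by (simp add: F_def)
        next
          case 2
          have t: "\<tau> y \<in> S'" using \<tau>S'[OF 2, of 1] by simp
          have "(\<tau> ^^ jj (\<tau> y)) (rep y) = (\<tau> ^^ Suc (jj y)) (rep y)"
            using jj[OF t] jj[OF 2] rep_\<tau>[OF 2] by simp
          then have "\<xi> ^ jj (\<tau> y) * G (rep y) = \<xi> ^ Suc (jj y) * G (rep y)" by (rule pw[OF 2])
          then show ?thesis using 2 t by (simp add: F_def rep_\<tau>)
        qed
      qed
      have "F x = G x" if "x \<in> Z" for x
      proof (cases "x \<in> S'")
        case True
        then have "x \<in> T" using that by (auto simp: Z_def S'_def split: if_splits)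
        then have r: "rep x = x" using rep_rep by (auto simp: T_def)
        then have "\<xi> ^ jj x * G (rep x) = \<xi> ^ 0 * G (rep x)" by (intro pw[OF True]) (use jj[OF True] in simp)
        then show ?thesis using True r by (simp add: F_def)
      next
        case False
        then show ?thesis using that ZS by (auto simp: F_def S'_def)
      qed
      then have "U F = G" using G by (auto simp: U_def fun_eq_iff)
      then show "G \<in> U ` ?E" using FE by blast
    qed (auto simp: U_def)
    have "cs.dim ?E = cs.dim (U ` ?E)" using dim_linear_image[OF U sub inj] by simp
    also have "\<dots> = card Z" unfolding img by (rule dim_supported[OF Zfin])
    finally show ?thesis using cardZ by simp
  qed
  have "card S = l * card T + card S\<^sub>0"
    using cardS' card_Diff_subset[OF fin(2) S0(1)] card_mono[OF S S0(1)] by (simp add: S'_def)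
  then show ?thesis using dim by (intro exI[of _ "card T"]) simp
qed

section \<open>Representations of finite cyclic groups\<close>

text \<open>The generator is a parameter because characters are compared through their values at it,
  and the generator \<open>g [^] n\<close> of a subgroup of index \<open>n\<close> has to be
  compatible with \<open>g\<close>.\<close>

locale finite_cyclic = group G for G (structure) +
  fixes g and M :: nat
  assumes gen_closed [simp]: "g \<in> carrier G" and carrier_range: "carrier G = range (\<lambda>k::nat. g [^] k)"
    and gen_pow_eq_one: "\<And>k::nat. g [^] k = \<one> \<longleftrightarrow> M dvd k" and M_pos: "M > 0"
begin

lemma gen_pow_eq_iff: "g [^] (i::nat) = g [^] (j::nat) \<longleftrightarrow> i mod M = j mod M"
proof -
  have *: "g [^] i = g [^] j \<longleftrightarrow> M dvd j - i" if "i \<le> j" for i j :: nat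
  proof -
    have "g [^] j = g [^] i \<otimes> g [^] (j - i)" using that by (simp add: nat_pow_mult)
    then have "g [^] i = g [^] j \<longleftrightarrow> g [^] (j - i) = \<one>" by (simp add: l_cancel_one' eq_commute)
    then show ?thesis by (simp add: gen_pow_eq_one)
  qed
  show ?thesis
  proof (cases "i \<le> j")
    case True
    then show ?thesis using *[OF True] mod_eq_dvd_iff_nat[OF True, of M] by auto
  next
    case False
    then have "j \<le> i" by simp
    then show ?thesis using *[of j i] mod_eq_dvd_iff_nat[of j i M] by auto
  qed
qed

lemma inj_on_gen_pow: "inj_on (\<lambda>k::nat. g [^] k) {..<M}"
  by (auto simp: inj_on_def gen_pow_eq_iff)

lemma carrier_image: "carrier G = (\<lambda>k::nat. g [^] k) ` {..<M}"
proof -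
  have "g [^] k \<in> (\<lambda>k::nat. g [^] k) ` {..<M}" for k :: nat
    using M_pos by (intro image_eqI[of _ _ "k mod M"]) (simp_all add: gen_pow_eq_iff)
  then show ?thesis unfolding carrier_range by auto
qed

lemma finite_carrier: "finite (carrier G)" unfolding carrier_image by simp

lemma card_carrier: "card (carrier G) = M"
  unfolding carrier_image by (simp add: card_image[OF inj_on_gen_pow])

lemma sum_carrier: "(\<Sum>x\<in>carrier G. f x) = (\<Sum>k<M. f (g [^] k))"
  unfolding carrier_image by (simp add: sum.reindex[OF inj_on_gen_pow])

lemma character_pow: "\<eta> \<in> characters G \<Longrightarrow> \<eta> (g [^] (k::nat)) = \<eta> g ^ k"
proof (induction k)
  case 0
  then show ?case using character_one[of G \<eta>] is_group by simp
next
  case (Suc k)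
  then have "\<eta> (g [^] k \<otimes> g) = \<eta> (g [^] k) * \<eta> g" unfolding characters_def by simp
  then show ?case using Suc by (simp add: mult.commute)
qed

lemma character_root: "\<eta> \<in> characters G \<Longrightarrow> \<eta> g ^ M = 1"
  using character_pow[of \<eta> M] character_one[of G \<eta>] is_group gen_pow_eq_one[of M] by simp

lemma character_eqI:
  assumes "\<eta> \<in> characters G" "\<eta>' \<in> characters G" "\<eta> g = \<eta>' g" shows "\<eta> = \<eta>'"
proof
  fix x show "\<eta> x = \<eta>' x"
  proof (cases "x \<in> carrier G")
    case True
    then obtain k :: nat where "x = g [^] k" unfolding carrier_range by blast
    then show ?thesis using character_pow assms by metis
  next
    case False
    then show ?thesis using assms by (simp add: characters_def)
  qed
qed

lemma character_exists:
  assumes w: "w ^ M = 1"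
  obtains \<eta> where "\<eta> \<in> characters G" "\<eta> g = w"
proof -
  \<comment> \<open>The chosen exponent is determined only modulo \<open>M\<close>, which suffices
    since \<open>w ^ M = 1\<close>.\<close>
  define \<eta> where "\<eta> = (\<lambda>x. if x \<in> carrier G then w ^ (SOME k. x = g [^] (k::nat)) else 0)"
  have w0: "w \<noteq> 0" using w M_pos by (metis power_0_left zero_neq_one less_numeral_extra(3))
  have wm: "w ^ k = w ^ (k mod M)" for k
  proof -
    have "w ^ (M * (k div M) + k mod M) = w ^ (k mod M)" unfolding power_add power_mult w by simp
    then show ?thesis by simp
  qed
  have val: "\<eta> (g [^] k) = w ^ k" for k :: nat
  proof -
    have "g [^] k = g [^] (SOME j. g [^] k = g [^] (j::nat))" by (rule someI[of _ k]) simp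
    then have "k mod M = (SOME j. g [^] k = g [^] (j::nat)) mod M" by (simp only: gen_pow_eq_iff)
    then show ?thesis using wm by (simp add: \<eta>_def) metis
  qed
  have "\<eta> \<in> characters G"
    unfolding characters_def mem_Collect_eq
  proof (intro conjI ballI allI impI)
    fix x assume "x \<in> carrier G"
    then obtain i :: nat where x: "x = g [^] i" unfolding carrier_range by blast
    show "\<eta> x \<noteq> 0" using val w0 x by simp
    fix y assume "y \<in> carrier G"
    then obtain j :: nat where y: "y = g [^] j" unfolding carrier_range by blast
    show "\<eta> (x \<otimes> y) = \<eta> x * \<eta> y" unfolding x y by (simp add: nat_pow_mult val power_add)
  qed (simp add: \<eta>_def)
  moreover have "\<eta> g = w" using val[of 1] by simp
  ultimately show ?thesis by (rule that)
qed

text \<open>Every element is a power of \<open>g\<close>, so a power of the character is trivial as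
  soon as it is trivial at \<open>g\<close>.\<close>

lemma char_order_eq_iff:
  assumes \<eta>: "\<eta> \<in> characters G"
  shows "char_order G \<eta> = d \<longleftrightarrow> has_order (\<eta> g) d"
proof -
  have "(\<forall>x\<in>carrier G. \<eta> x ^ k = 1) \<longleftrightarrow> \<eta> g ^ k = 1" for k
  proof
    assume "\<eta> g ^ k = 1"
    then have "(\<eta> g ^ j) ^ k = 1" for j by (metis mult.commute power_mult power_one)
    then show "\<forall>x\<in>carrier G. \<eta> x ^ k = 1" unfolding carrier_range using character_pow[OF \<eta>] by auto
  qed simp
  then have eq: "char_order G \<eta> = (LEAST k. k > 0 \<and> \<eta> g ^ k = 1)" by (simp add: char_order_def)
  obtain e where e: "has_order (\<eta> g) e" using has_order_exists[OF character_root[OF \<eta>] M_pos] by blast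
  then have "(LEAST k. k > 0 \<and> \<eta> g ^ k = 1) = e"
    unfolding has_order_iff by (intro Least_equality) auto
  then show ?thesis using eq e has_order_unique by metis
qed

lemma bij_betw_characters: "bij_betw (\<lambda>\<eta>. \<eta> g) (characters G) {w. w ^ M = 1}"
proof (rule bij_betw_imageI)
  show "inj_on (\<lambda>\<eta>. \<eta> g) (characters G)" using character_eqI by (auto intro: inj_onI)
  show "(\<lambda>\<eta>. \<eta> g) ` characters G = {w. w ^ M = 1}"
    using character_root by (auto elim: character_exists)
qed

lemma finite_characters: "finite (characters G)"
  using bij_betw_finite[OF bij_betw_characters] finite_roots_unity[of M, where ?'a = complex] M_pos by simp

lemma bij_betw_chars_of_order:
  "bij_betw (\<lambda>\<eta>. \<eta> g) (chars_of_order G m) {w. w ^ M = 1 \<and> has_order w m}"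
proof (rule bij_betw_imageI)
  show "inj_on (\<lambda>\<eta>. \<eta> g) (chars_of_order G m)" using character_eqI by (auto intro!: inj_onI simp: chars_of_order_def)
  show "(\<lambda>\<eta>. \<eta> g) ` chars_of_order G m = {w. w ^ M = 1 \<and> has_order w m}"
  proof (intro equalityI subsetI)
    fix w :: complex assume "w \<in> {w. w ^ M = 1 \<and> has_order w m}"
    then have w: "w ^ M = 1" "has_order w m" by auto
    obtain \<eta> where \<eta>: "\<eta> \<in> characters G" "\<eta> g = w" using character_exists[OF w(1)] .
    then have "\<eta> \<in> chars_of_order G m" using w char_order_eq_iff[OF \<eta>(1)] by (simp add: chars_of_order_def)
    then show "w \<in> (\<lambda>\<eta>. \<eta> g) ` chars_of_order G m" using \<eta>(2) by blast
  qed (use character_root char_order_eq_iff in \<open>auto simp: chars_of_order_def\<close>)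
qed

lemma num_constituents_eq:
  assumes "\<And>\<eta>. \<eta> \<in> characters G \<Longrightarrow> char_mult G V \<eta> = f (\<eta> g)"
  shows "num_constituents G V m = (\<Sum>w | w ^ M = 1 \<and> has_order w m. f w)"
proof -
  have "num_constituents G V m = (\<Sum>\<eta>\<in>chars_of_order G m. f (\<eta> g))"
    unfolding num_constituents_def by (intro sum.cong refl assms) (simp add: chars_of_order_def)
  also have "\<dots> = (\<Sum>w | w ^ M = 1 \<and> has_order w m. f w)"
    by (rule sum.reindex_bij_betw[OF bij_betw_chars_of_order])
  finally show ?thesis .
qed

text \<open>If \<open>g [^] k\<close> lies in \<open>K\<close>, then its power with exponent
  \<open>card K\<close> is the identity, so \<open>M = n * card K\<close> divides
  \<open>k * card K\<close> and \<open>n\<close> divides \<open>k\<close>. Thus \<open>K\<close> is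
  contained in the set of the \<open>M div n\<close> powers of \<open>g [^] n\<close>, and counting
  gives equality.\<close>

lemma subgroup_of_index:
  assumes K: "subgroup K G" and n: "card (rcosets K) = n"
  shows "n dvd M" "n > 0" "\<And>k::nat. g [^] k \<in> K \<longleftrightarrow> n dvd k"
    "finite_cyclic (G\<lparr>carrier := K\<rparr>) (g [^] n) (M div n)"
proof -
  have lag: "n * card K = M"
    using lagrange[OF K] n card_carrier by (simp add: Coset.order_def)
  have K0: "card K > 0" using lag M_pos by (intro Nat.gr0I) auto
  show nM: "n dvd M" using lag by (metis dvd_triv_left)
  show n0: "n > 0" using lag M_pos by (intro Nat.gr0I) auto
  have cK: "card K = M div n" using lag n0 by auto
  interpret K: group "G\<lparr>carrier := K\<rparr>" using K by (rule subgroup_imp_group)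
  have sub: "K \<subseteq> carrier G" using K by (rule subgroup.subset)
  have finK: "finite K" using sub finite_carrier finite_subset by blast
  have pow: "x [^]\<^bsub>G\<lparr>carrier := K\<rparr>\<^esub> (k::nat) = x [^] k" for x k
    by (rule nat_pow_consistent[symmetric])
  have KA: "K \<subseteq> (\<lambda>j::nat. g [^] (n * j)) ` {..<M div n}"
  proof
    fix x assume x: "x \<in> K"
    then obtain k :: nat where k: "x = g [^] k" "k < M" using sub unfolding carrier_image by auto
    have "x [^] card K = \<one>" using K.pow_order_eq_1[of x] x pow by (simp add: Coset.order_def)
    then have "M dvd k * card K" using k by (simp add: nat_pow_pow gen_pow_eq_one)
    then have "n dvd k" using lag K0 by (metis dvd_times_right_cancel_iff less_numeral_extra(3))
    then obtain j where j: "k = n * j" by (auto elim: dvdE)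
    then have "n * j < n * card K" using k lag by simp
    then have "j < M div n" using n0 cK by simp
    then show "x \<in> (\<lambda>j::nat. g [^] (n * j)) ` {..<M div n}" using k j by auto
  qed
  moreover have "card ((\<lambda>j::nat. g [^] (n * j)) ` {..<M div n}) \<le> card K"
    using card_image_le[of "{..<M div n}" "\<lambda>j::nat. g [^] (n * j)"] cK by simp
  ultimately have KE: "K = (\<lambda>j::nat. g [^] (n * j)) ` {..<M div n}"
    by (intro card_subset_eq) (auto intro: card_mono le_antisym)
  have n_mem: "g [^] (n * j) \<in> K" for j :: nat
  proof -
    have "j mod (M div n) < M div n" using K0 cK by simp
    moreover have "g [^] (n * j) = g [^] (n * (j mod (M div n)))"
      unfolding gen_pow_eq_iff using nM by (metis dvd_mult_div_cancel mod_mult_mult1 mod_mod_trivial)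
    ultimately show ?thesis unfolding KE by blast
  qed
  show mem: "g [^] k \<in> K \<longleftrightarrow> n dvd k" for k :: nat
  proof
    assume "g [^] k \<in> K"
    then obtain j where "g [^] k = g [^] (n * j)" unfolding KE by auto
    then have "k mod M = n * j mod M" by (simp only: gen_pow_eq_iff)
    then have "n dvd k mod M" using nM by (metis dvd_mod_iff dvd_triv_left)
    then show "n dvd k" using nM by (metis dvd_mod_iff)
  qed (use n_mem in \<open>auto elim!: dvdE\<close>)
  show "finite_cyclic (G\<lparr>carrier := K\<rparr>) (g [^] n) (M div n)"
  proof
    show "g [^] n \<in> carrier (G\<lparr>carrier := K\<rparr>)" using n_mem[of 1] by simp
    show "carrier (G\<lparr>carrier := K\<rparr>) = range (\<lambda>k::nat. (g [^] n) [^]\<^bsub>G\<lparr>carrier := K\<rparr>\<^esub> k)"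
      unfolding pow using n_mem KE by (auto simp: nat_pow_pow)
    show "((g [^] n) [^]\<^bsub>G\<lparr>carrier := K\<rparr>\<^esub> k = \<one>\<^bsub>G\<lparr>carrier := K\<rparr>\<^esub>) = (M div n dvd k)" for k :: nat
      unfolding pow using nM n0 by (simp add: nat_pow_pow gen_pow_eq_one) (metis dvd_mult_cancel_left dvd_mult_div_cancel nat_mult_dvd_cancel_disj less_numeral_extra(3))
    show "M div n > 0" using cK K0 by simp
  qed
qed

lemma sum_character_ratio:
  assumes "\<eta> \<in> characters G" "\<eta>' \<in> characters G"
  shows "(\<Sum>x\<in>carrier G. \<eta> x * inverse (\<eta>' x)) = (if \<eta> = \<eta>' then of_nat M else 0)"
proof -
  let ?z = "\<eta> g * inverse (\<eta>' g)"
  have nz: "\<eta>' g \<noteq> 0" using assms(2) by (simp add: characters_def)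
  have "(\<Sum>x\<in>carrier G. \<eta> x * inverse (\<eta>' x)) = (\<Sum>k<M. ?z ^ k)"
    unfolding sum_carrier using assms by (simp add: character_pow power_mult_distrib power_inverse)
  also have "\<dots> = (if \<eta> = \<eta>' then of_nat M else 0)"
  proof (cases "\<eta> = \<eta>'")
    case False
    then have z1: "?z \<noteq> 1" using character_eqI[OF assms] nz by (auto simp: field_simps)
    moreover have "?z ^ M = 1" using character_root assms by (simp add: power_mult_distrib power_inverse)
    ultimately show ?thesis using False by (simp add: geometric_sum)
  qed (use nz in simp)
  finally show ?thesis .
qed

text \<open>The second orthogonality relation. The values of the characters at \<open>g\<close> are
  the powers of \<open>prim_root M\<close>, so this is again a geometric sum.\<close>

lemma sum_characters_dual:
  assumes x: "x \<in> carrier G" and y: "y \<in> carrier G"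
  shows "(\<Sum>\<eta>\<in>characters G. \<eta> x * inverse (\<eta> y)) = (if x = y then of_nat M else 0)"
proof -
  obtain i j :: nat where ij: "x = g [^] i" "i < M" "y = g [^] j" "j < M"
    using x y unfolding carrier_image by auto
  have "(\<Sum>\<eta>\<in>characters G. \<eta> x * inverse (\<eta> y)) = (\<Sum>\<eta>\<in>characters G. \<eta> g ^ i * inverse (\<eta> g ^ j))"
    unfolding ij by (intro sum.cong refl) (simp add: character_pow)
  also have "\<dots> = (\<Sum>w\<in>{w. w ^ M = 1}. w ^ i * inverse (w ^ j))"
    by (rule sum.reindex_bij_betw[OF bij_betw_characters])
  also have "\<dots> = (\<Sum>k<M. (prim_root M ^ k) ^ i * inverse ((prim_root M ^ k) ^ j))"
    using sum.reindex_bij_betw[OF bij_betw_roots_unity[OF M_pos], of "\<lambda>w. w ^ i * inverse (w ^ j)"]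
    by (simp add: prim_root_power)
  also have "\<dots> = (\<Sum>k<M. (prim_root M ^ i * inverse (prim_root M ^ j)) ^ k)"
    by (intro sum.cong refl) (simp add: power_mult_distrib power_inverse mult.commute flip: power_mult)
  also have "\<dots> = (if x = y then of_nat M else 0)"
  proof -
    let ?w = "prim_root M" and ?z = "prim_root M ^ i * inverse (prim_root M ^ j)"
    have ow: "has_order ?w M" using has_order_prim_root[OF M_pos] .
    have w0: "?w \<noteq> 0" using ow by (rule has_order_nonzero)
    have injw: "inj_on (\<lambda>k. ?w ^ k) {..<M}"
      using bij_betw_roots_unity[OF M_pos] by (simp add: bij_betw_def prim_root_power)
    show ?thesis
    proof (cases "x = y")
      case True
      then have "i = j" using ij inj_onD[OF inj_on_gen_pow, of i j] by auto
      then show ?thesis using True w0 by simp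
    next
      case False
      then have "?w ^ i \<noteq> ?w ^ j" using ij inj_onD[OF injw, of i j] by auto
      then have "?z \<noteq> 1" using w0 by (simp add: field_simps)
      moreover have "?z ^ M = 1"
        using has_order_self[OF ow] by (simp add: power_mult_distrib power_inverse) (metis mult.commute power_mult power_one inverse_1 mult_1)
      ultimately show ?thesis using False by (simp add: geometric_sum)
    qed
  qed
  finally show ?thesis .
qed

end

context finite_cyclic
begin

text \<open>Fourier transform on a finite cyclic group: \<open>T\<close> takes Fourier coefficients
  and \<open>U\<close> is the inverse transform. The induced space consists of the functions that
  transform by \<open>\<chi>\<close> under \<open>H\<close>; these involve exactly the characters
  that restrict to \<open>\<chi>\<close>, and by assumption \<open>D\<close> recognises them by
  their orders.\<close>

lemma rep_iso_ind_char:
  assumes H: "subgroup (carrier H) G"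
    and M': "\<And>\<eta>. \<eta> \<in> characters G \<Longrightarrow> char_order G \<eta> \<in> D \<longleftrightarrow> (\<forall>h\<in>carrier H. \<eta> h = \<chi> h)"
  shows "rep_iso G (ind G H (char_rep \<chi>)) (rep_Sum D (rho G))"
proof -
  interpret H: subgroup "carrier H" G by fact
  have mult: "\<eta> (a \<otimes> b) = \<eta> a * \<eta> b" if "\<eta> \<in> characters G" "a \<in> carrier G" "b \<in> carrier G" for \<eta> a b
    using that by (auto simp: characters_def)
  have nz: "\<eta> a \<noteq> 0" if "\<eta> \<in> characters G" "a \<in> carrier G" for \<eta> a
    using that by (auto simp: characters_def)
  have cancel: "u = 0" if "u = c * u" "c \<noteq> 1" for u c :: complex using that by (simp add: mult_cancel_right1)
  have M0: "(of_nat M :: complex) \<noteq> 0" using M_pos by simp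
  define co :: "('a \<times> unit \<Rightarrow> complex) \<Rightarrow> ('a \<Rightarrow> complex) \<Rightarrow> complex"
    where "co = (\<lambda>F \<eta>. (\<Sum>x\<in>carrier G. F (x, ()) * inverse (\<eta> x)) / of_nat M)"
  define T where "T = (\<lambda>F (m, \<eta>). if m \<in> D \<and> \<eta> \<in> chars_of_order G m then co F \<eta> else 0)"
  define U where "U = (\<lambda>c (x, y::unit). if x \<in> carrier G then \<Sum>\<eta>\<in>characters G. c (char_order G \<eta>, \<eta>) * \<eta> x else 0)"
  let ?V = "ind G H (char_rep \<chi>)" and ?W = "rep_Sum D (rho G)"
  have V: "F \<in> space ?V \<longleftrightarrow> (\<forall>x. x \<notin> carrier G \<longrightarrow> F (x, ()) = 0) \<and>
      (\<forall>h\<in>carrier H. \<forall>x\<in>carrier G. F (h \<otimes> x, ()) = \<chi> h * F (x, ()))" for F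
    by (auto simp: ind_def char_rep_def cscale_def fun_eq_iff)
  have W: "c \<in> space ?W \<longleftrightarrow> (\<forall>m \<eta>. \<not> (m \<in> D \<and> \<eta> \<in> chars_of_order G m) \<longrightarrow> c (m, \<eta>) = 0)" for c
    by (auto simp: rep_Sum_def rho_def)
  have TW: "T F \<in> space ?W" for F by (auto simp: W T_def)
  have UV: "U c \<in> space ?V" if c: "c \<in> space ?W" for c
    unfolding V
  proof (intro conjI allI impI ballI)
    fix h x assume h: "h \<in> carrier H" and x: "x \<in> carrier G"
    have "(\<Sum>\<eta>\<in>characters G. c (char_order G \<eta>, \<eta>) * \<eta> (h \<otimes> x)) =
      (\<Sum>\<eta>\<in>characters G. \<chi> h * (c (char_order G \<eta>, \<eta>) * \<eta> x))"
    proof (rule sum.cong[OF refl])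
      fix \<eta> assume \<eta>: "\<eta> \<in> characters G"
      show "c (char_order G \<eta>, \<eta>) * \<eta> (h \<otimes> x) = \<chi> h * (c (char_order G \<eta>, \<eta>) * \<eta> x)"
      proof (cases "char_order G \<eta> \<in> D")
        case True
        then have "\<eta> h = \<chi> h" using M'[OF \<eta>] h by blast
        then show ?thesis using mult[OF \<eta>, of h x] h x by (simp add: mult_ac)
      next
        case False
        then have "c (char_order G \<eta>, \<eta>) = 0" using c unfolding W by blast
        then show ?thesis by simp
      qed
    qed
    then show "U c (h \<otimes> x, ()) = \<chi> h * U c (x, ())" using h x by (simp add: U_def sum_distrib_left)
  qed (simp add: U_def)
  have TU: "T (U c) = c" if c: "c \<in> space ?W" for c
  proof (rule ext, clarify)
    fix m \<eta>
    show "T (U c) (m, \<eta>) = c (m, \<eta>)"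
    proof (cases "m \<in> D \<and> \<eta> \<in> chars_of_order G m")
      case True
      then have \<eta>: "\<eta> \<in> characters G" "char_order G \<eta> = m" by (auto simp: chars_of_order_def)
      have "(\<Sum>x\<in>carrier G. U c (x, ()) * inverse (\<eta> x)) =
        (\<Sum>x\<in>carrier G. \<Sum>\<eta>'\<in>characters G. c (char_order G \<eta>', \<eta>') * (\<eta>' x * inverse (\<eta> x)))"
        by (intro sum.cong refl) (simp add: U_def sum_distrib_right mult.assoc)
      also have "\<dots> = (\<Sum>\<eta>'\<in>characters G. c (char_order G \<eta>', \<eta>') * (\<Sum>x\<in>carrier G. \<eta>' x * inverse (\<eta> x)))"
        by (subst sum.swap) (simp add: sum_distrib_left)
      also have "\<dots> = (\<Sum>\<eta>'\<in>characters G. if \<eta>' = \<eta> then c (char_order G \<eta>', \<eta>') * of_nat M else 0)"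
        by (intro sum.cong refl) (simp add: sum_character_ratio \<eta>(1))
      also have "\<dots> = c (m, \<eta>) * of_nat M" using finite_characters \<eta> by simp
      finally have "co (U c) \<eta> = c (m, \<eta>)" using M0 by (simp add: co_def)
      then show ?thesis using True by (simp add: T_def)
    next
      case False
      then show ?thesis using c unfolding W by (auto simp: T_def)
    qed
  qed
  have UT: "U (T F) = F" if F: "F \<in> space ?V" for F
  proof (rule ext, clarify)
    fix x :: 'a and y :: unit
    show "U (T F) (x, ()) = F (x, ())"
    proof (cases "x \<in> carrier G")
      case True
      \<comment> \<open>Translating the variable by \<open>h\<close> multiplies the coefficient by
        \<open>\<chi> h / \<eta> h\<close>, which differs from 1 for a suitable \<open>h\<close> in
        \<open>H\<close>.\<close>
      have co0: "co F \<eta> = 0" if \<eta>: "\<eta> \<in> characters G" "char_order G \<eta> \<notin> D" for \<eta>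
      proof -
        obtain h where h: "h \<in> carrier H" "\<eta> h \<noteq> \<chi> h" using M'[OF \<eta>(1)] \<eta>(2) by blast
        have hG: "h \<in> carrier G" using h by simp
        have bij: "bij_betw (\<lambda>x. h \<otimes> x) (carrier G) (carrier G)"
          by (rule bij_betwI[where g = "\<lambda>x. inv h \<otimes> x"]) (use hG in \<open>auto simp: m_assoc[symmetric]\<close>)
        have "(\<Sum>x\<in>carrier G. F (x, ()) * inverse (\<eta> x)) = (\<Sum>x\<in>carrier G. F (h \<otimes> x, ()) * inverse (\<eta> (h \<otimes> x)))"
          by (rule sum.reindex_bij_betw[OF bij, symmetric])
        also have "\<dots> = (\<Sum>x\<in>carrier G. \<chi> h * inverse (\<eta> h) * (F (x, ()) * inverse (\<eta> x)))"
          by (intro sum.cong refl) (use F h hG in \<open>simp add: V mult[OF \<eta>(1)] mult_ac\<close>)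
        also have "\<dots> = \<chi> h * inverse (\<eta> h) * (\<Sum>x\<in>carrier G. F (x, ()) * inverse (\<eta> x))"
          by (rule sum_distrib_left[symmetric])
        finally have "(\<Sum>x\<in>carrier G. F (x, ()) * inverse (\<eta> x)) =
          \<chi> h * inverse (\<eta> h) * (\<Sum>x\<in>carrier G. F (x, ()) * inverse (\<eta> x))" .
        moreover have "\<chi> h * inverse (\<eta> h) \<noteq> 1" using h(2) nz[OF \<eta>(1) hG] by (auto simp: field_simps)
        ultimately have "(\<Sum>x\<in>carrier G. F (x, ()) * inverse (\<eta> x)) = 0" by (rule cancel)
        then show ?thesis by (simp add: co_def)
      qed
      have "U (T F) (x, ()) = (\<Sum>\<eta>\<in>characters G. T F (char_order G \<eta>, \<eta>) * \<eta> x)" using True by (simp add: U_def)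
      also have "\<dots> = (\<Sum>\<eta>\<in>characters G. co F \<eta> * \<eta> x)"
        by (intro sum.cong refl) (auto simp: T_def chars_of_order_def co0)
      also have "\<dots> = (\<Sum>\<eta>\<in>characters G. \<Sum>z\<in>carrier G. F (z, ()) / of_nat M * (\<eta> x * inverse (\<eta> z)))"
        by (intro sum.cong refl) (simp add: co_def sum_distrib_right sum_divide_distrib, simp add: mult_ac)
      also have "\<dots> = (\<Sum>z\<in>carrier G. F (z, ()) / of_nat M * (\<Sum>\<eta>\<in>characters G. \<eta> x * inverse (\<eta> z)))"
        by (subst sum.swap) (simp add: sum_distrib_left)
      also have "\<dots> = (\<Sum>z\<in>carrier G. if x = z then F (z, ()) else 0)"
        by (intro sum.cong refl) (use M0 in \<open>simp add: sum_characters_dual[OF True]\<close>)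
      also have "\<dots> = F (x, ())" using finite_carrier True by simp
      finally show ?thesis .
    next
      case False
      then show ?thesis using F by (simp add: U_def V)
    qed
  qed
  have bij: "bij_betw T (space ?V) (space ?W)"
    by (rule bij_betwI[where g = U]) (use TW UV TU UT in auto)
  have add: "T (F + F') = T F + T F'" for F F'
    by (auto simp: T_def co_def fun_eq_iff sum.distrib algebra_simps add_divide_distrib)
  have scale: "T (cscale c F) = cscale c (T F)" for c F
    by (auto simp: T_def co_def fun_eq_iff cscale_def sum_distrib_left mult_ac)
  have equi: "T (act ?V k F) = act ?W k (T F)" if k: "k \<in> carrier G" for k F
  proof (rule ext, clarify)
    fix m \<eta>
    show "T (act ?V k F) (m, \<eta>) = act ?W k (T F) (m, \<eta>)"
    proof (cases "m \<in> D \<and> \<eta> \<in> chars_of_order G m")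
      case True
      then have \<eta>: "\<eta> \<in> characters G" by (auto simp: chars_of_order_def)
      have bij: "bij_betw (\<lambda>x. x \<otimes> k) (carrier G) (carrier G)"
        by (rule bij_betwI[where g = "\<lambda>x. x \<otimes> inv k"]) (use k in \<open>auto simp: m_assoc\<close>)
      have "(\<Sum>x\<in>carrier G. act ?V k F (x, ()) * inverse (\<eta> x)) =
        (\<Sum>x\<in>carrier G. \<eta> k * (F (x \<otimes> k, ()) * inverse (\<eta> (x \<otimes> k))))"
        by (intro sum.cong refl) (use k \<eta> nz[OF \<eta> k] in \<open>simp add: ind_def mult[OF \<eta>]\<close>)
      also have "\<dots> = (\<Sum>x\<in>carrier G. \<eta> k * (F (x, ()) * inverse (\<eta> x)))"
        by (rule sum.reindex_bij_betw[OF bij])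
      finally have "co (act ?V k F) \<eta> = \<eta> k * co F \<eta>" by (simp add: co_def sum_distrib_left)
      then show ?thesis using True by (simp add: T_def rep_Sum_def rho_def)
    next
      case False
      then show ?thesis by (auto simp: T_def rep_Sum_def rho_def)
    qed
  qed
  show ?thesis unfolding rep_iso_def using bij add scale equi by blast
qed

end

lemma linear_rep_char_rep: "linear_rep H (char_rep \<chi>)"
  by (auto simp: linear_rep_def char_rep_def cscale_def fun_eq_iff algebra_simps cs.subspace_UNIV)

lemma linear_rep_zero_rep: "linear_rep H zero_rep"
  by (auto simp: linear_rep_def zero_rep_def)

lemma linear_rep_twist:
  assumes "linear_rep H V" shows "linear_rep H (twist \<chi> V)"
  using assms by (auto simp: linear_rep_def twist_def cs.scale_right_distrib mult.commute)

lemma linear_rep_perm_rep: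
  assumes "finite S" shows "linear_rep H (perm_rep a S)"
  unfolding linear_rep_def perm_rep_def repr.select_convs
proof (intro conjI)
  show "cs.subspace {F. \<forall>x. x \<notin> S \<longrightarrow> F x = 0}"
    by (rule cs.subspaceI) (auto simp: cscale_def zero_fun_def)
qed (auto simp: fun_eq_iff cscale_def sum.distrib sum_distrib_left)

lemma linear_rep_rep_plus:
  assumes V: "linear_rep H V" and W: "linear_rep H W"
  shows "linear_rep H (rep_plus V W)"
proof -
  have add: "(F + F') \<circ> i = (F \<circ> i) + (F' \<circ> i)" and scale: "cscale c F \<circ> i = cscale c (F \<circ> i)"
    and zero: "(0 :: 'z \<Rightarrow> complex) \<circ> i = 0" for F F' :: "'z \<Rightarrow> complex" and i :: "'w \<Rightarrow> 'z" and c
    by (auto simp: fun_eq_iff cscale_def)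
  have cadd: "case_sum (f + f') (h + h') = case_sum f h + case_sum f' h'"
    for f f' :: "'c \<Rightarrow> complex" and h h' :: "'d \<Rightarrow> complex"
    by (auto simp: fun_eq_iff split: sum.split)
  have cscale: "case_sum (cscale c f) (cscale c h) = cscale c (case_sum f h)"
    for f :: "'c \<Rightarrow> complex" and h :: "'d \<Rightarrow> complex" and c
    by (auto simp: fun_eq_iff cscale_def split: sum.split)
  have sub: "cs.subspace (space V)" "cs.subspace (space W)" using V W by (auto simp: linear_rep_def)
  have "cs.subspace {F. F \<circ> Inl \<in> space V \<and> F \<circ> Inr \<in> space W}"
    by (rule cs.subspaceI) (use sub in \<open>auto simp: add scale zero cs.subspace_add cs.subspace_scale cs.subspace_0\<close>)
  then show ?thesis
    using V W unfolding linear_rep_def rep_plus_def repr.select_convs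
    by (simp add: add scale cadd cscale)
qed

text \<open>The generator acts by pushing functions forward along \<open>\<tau>\<close>, so being an
  eigenvector means \<open>\<gamma> h * F y = e * F (\<tau> y)\<close> with \<open>e\<close> the
  value of \<open>\<eta>\<close> at \<open>h\<close>. The condition at the generator implies the
  condition at all its powers.\<close>

lemma eigenspace_twist_perm_rep:
  assumes H: "finite_cyclic H h L" and S: "finite S" and \<gamma>: "\<gamma> \<in> characters H"
    and \<eta>: "\<And>k::nat. \<eta> (h [^]\<^bsub>H\<^esub> k) = e ^ k" and e: "e \<noteq> 0"
    and \<tau>: "bij_betw \<tau> S S" and a: "\<And>k y. y \<in> S \<Longrightarrow> a (h [^]\<^bsub>H\<^esub> (k::nat)) y = (\<tau> ^^ k) y"
  shows "eigenspace H (twist \<gamma> (perm_rep a S)) \<eta> =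
    {F. (\<forall>x. x \<notin> S \<longrightarrow> F x = 0) \<and> (\<forall>y\<in>S. F (\<tau> y) = (\<gamma> h / e) * F y)}"
proof -
  interpret H: finite_cyclic H h L by fact
  have bijk: "bij_betw (\<tau> ^^ k) S S" for k
  proof (induction k)
    case (Suc k)
    then have "bij_betw (\<tau> \<circ> (\<tau> ^^ k)) S S" using \<tau> by (rule bij_betw_trans)
    then show ?case by (simp only: funpow.simps)
  qed (simp add: bij_betw_def)
  have act: "act (twist \<gamma> (perm_rep a S)) (h [^]\<^bsub>H\<^esub> k) F x = (if x \<in> S then \<gamma> h ^ k * F (inv_into S (\<tau> ^^ k) x) else 0)" for k :: nat and F x
  proof -
    have set: "{y. y \<in> S \<and> a (h [^]\<^bsub>H\<^esub> k) y = x} = {y \<in> S. (\<tau> ^^ k) y = x}" using a by auto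
    have "{y \<in> S. (\<tau> ^^ k) y = x} = (if x \<in> S then {inv_into S (\<tau> ^^ k) x} else {})"
      using bijk[of k] by (auto simp: bij_betw_def inv_into_f_f f_inv_into_f intro: inv_into_into)
    then show ?thesis
      by (simp add: twist_def perm_rep_def cscale_def H.character_pow[OF \<gamma>] set)
  qed
  show ?thesis
  proof (intro equalityI subsetI)
    fix F assume "F \<in> eigenspace H (twist \<gamma> (perm_rep a S)) \<eta>"
    then have F: "\<And>x. x \<notin> S \<Longrightarrow> F x = 0" "\<And>g. g \<in> carrier H \<Longrightarrow> act (twist \<gamma> (perm_rep a S)) g F = cscale (\<eta> g) F"
      by (auto simp: eigenspace_def twist_def perm_rep_def)
    have "F (\<tau> y) = (\<gamma> h / e) * F y" if y: "y \<in> S" for y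
    proof -
      have "act (twist \<gamma> (perm_rep a S)) (h [^]\<^bsub>H\<^esub> (1::nat)) F (\<tau> y) = cscale (\<eta> (h [^]\<^bsub>H\<^esub> (1::nat))) F (\<tau> y)"
        by (subst F(2)) simp_all
      moreover have "\<tau> y \<in> S" "inv_into S \<tau> (\<tau> y) = y" using \<tau> y by (auto simp: bij_betw_def inv_into_f_f)
      ultimately have "\<gamma> h * F y = e * F (\<tau> y)" unfolding act \<eta> by (simp add: cscale_def)
      then show ?thesis using e by (simp add: field_simps)
    qed
    then show "F \<in> {F. (\<forall>x. x \<notin> S \<longrightarrow> F x = 0) \<and> (\<forall>y\<in>S. F (\<tau> y) = (\<gamma> h / e) * F y)}" using F(1) by blast
  next
    fix F assume "F \<in> {F. (\<forall>x. x \<notin> S \<longrightarrow> F x = 0) \<and> (\<forall>y\<in>S. F (\<tau> y) = (\<gamma> h / e) * F y)}"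
    then have F: "\<And>x. x \<notin> S \<Longrightarrow> F x = 0" "\<And>y. y \<in> S \<Longrightarrow> F (\<tau> y) = (\<gamma> h / e) * F y" by auto
    have Fk: "F ((\<tau> ^^ k) y) = (\<gamma> h / e) ^ k * F y" if "y \<in> S" for k y
    proof (induction k)
      case (Suc k)
      have "(\<tau> ^^ k) y \<in> S" using bijk[of k] that by (auto simp: bij_betw_def)
      then show ?case using Suc F(2) by simp
    qed simp
    have "act (twist \<gamma> (perm_rep a S)) (h [^]\<^bsub>H\<^esub> k) F x = cscale (\<eta> (h [^]\<^bsub>H\<^esub> k)) F x" for k :: nat and x
    proof (cases "x \<in> S")
      case True
      let ?y = "inv_into S (\<tau> ^^ k) x"
      have y: "?y \<in> S" "(\<tau> ^^ k) ?y = x"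
        using True bijk[of k] by (auto simp: bij_betw_def inv_into_into f_inv_into_f)
      show ?thesis using True Fk[OF y(1), of k] y(2) e by (simp add: act \<eta> cscale_def power_divide)
    next
      case False
      then show ?thesis using F(1) by (simp add: act cscale_def)
    qed
    then have "act (twist \<gamma> (perm_rep a S)) x F = cscale (\<eta> x) F" if "x \<in> carrier H" for x
      using that unfolding H.carrier_range by (auto simp: fun_eq_iff)
    then show "F \<in> eigenspace H (twist \<gamma> (perm_rep a S)) \<eta>"
      using F(1) by (auto simp: eigenspace_def twist_def perm_rep_def)
  qed
qed

text \<open>Written as a coordinate subspace over the one-point type, so that
  \<open>dim_supported\<close> gives dimension 1 or 0.\<close>

lemma eigenspace_char_rep:
  "eigenspace H (char_rep \<chi>) \<eta> = {F. \<forall>x. x \<notin> (if \<forall>g\<in>carrier H. \<chi> g = \<eta> g then UNIV else {}) \<longrightarrow> F x = 0}"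
  by (auto simp: eigenspace_def char_rep_def cscale_def fun_eq_iff)

lemma eigenspace_zero_rep: "eigenspace H zero_rep \<eta> = {F. \<forall>x. x \<notin> {} \<longrightarrow> F x = 0}"
  by (auto simp: eigenspace_def zero_rep_def cscale_def fun_eq_iff)

lemma char_mult_rep_plus_supported:
  assumes "eigenspace H V \<eta> = {F. \<forall>x. x \<notin> A \<longrightarrow> F x = 0}" "eigenspace H W \<eta> = {F. \<forall>x. x \<notin> B \<longrightarrow> F x = 0}"
    and "finite A" "finite B"
  shows "char_mult H (rep_plus V W) \<eta> = card A + card B"
proof -
  have c: "case_sum f h = cscale c F \<longleftrightarrow> f = cscale c (F \<circ> Inl) \<and> h = cscale c (F \<circ> Inr)" for f h c F
    by (auto simp: fun_eq_iff cscale_def split: sum.splits)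
  have "eigenspace H (rep_plus V W) \<eta> = {F. F \<circ> Inl \<in> eigenspace H V \<eta> \<and> F \<circ> Inr \<in> eigenspace H W \<eta>}"
    by (auto simp: eigenspace_def rep_plus_def c)
  also have "\<dots> = {F. \<forall>x. x \<notin> Inl ` A \<union> Inr ` B \<longrightarrow> F x = 0}"
    unfolding assms by (auto simp: image_iff) (metis old.sum.exhaust)
  finally have "char_mult H (rep_plus V W) \<eta> = card (Inl ` A \<union> Inr ` B)"
    unfolding char_mult_eq_dim using assms(3,4) by (simp only:) (rule dim_supported, simp)
  also have "\<dots> = card A + card B"
    using assms(3,4) by (subst card_Un_disjoint) (auto simp: card_image)
  finally show ?thesis .
qed

lemma rep_iso_ind_zero:
  assumes "group G"
  shows "rep_iso G (ind G H zero_rep) zero_rep"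
proof -
  have sp: "space (ind G H zero_rep) = {0}" by (auto simp: ind_def zero_rep_def fun_eq_iff) blast+
  show ?thesis unfolding rep_iso_def sp
    by (rule exI[of _ "\<lambda>_. 0"]) (auto simp: zero_rep_def bij_betw_def cscale_def fun_eq_iff)
qed

section \<open>Valuations and Galois groups\<close>

locale valued_field =
  fixes v :: "'a::field_char_0 \<Rightarrow> rat"
  assumes valuation: "is_valuation v"
begin

lemma val_mult: "x \<noteq> 0 \<Longrightarrow> y \<noteq> 0 \<Longrightarrow> v (x * y) = v x + v y"
  using valuation by (simp add: is_valuation_def)

lemma val_add: "x \<noteq> 0 \<Longrightarrow> y \<noteq> 0 \<Longrightarrow> x + y \<noteq> 0 \<Longrightarrow> v (x + y) \<ge> min (v x) (v y)"
  using valuation by (simp add: is_valuation_def)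

lemma val_one [simp]: "v 1 = 0"
  using valuation by (rule is_valuation_one)

lemma val_minus: "x \<noteq> 0 \<Longrightarrow> v (- x) = v x"
  by (rule is_valuation_minus[OF valuation])

lemma val_diff_commute: "v (x - y) = v (y - x)"
  using val_minus[of "x - y"] by (cases "x = y") auto

lemma val_inverse: "x \<noteq> 0 \<Longrightarrow> v (inverse x) = - v x"
  using val_mult[of x "inverse x"] by simp

lemma val_divide: "x \<noteq> 0 \<Longrightarrow> y \<noteq> 0 \<Longrightarrow> v (x / y) = v x - v y"
  using val_mult[of x "inverse y"] val_inverse[of y] by (simp add: divide_inverse)

lemma val_power: "x \<noteq> 0 \<Longrightarrow> v (x ^ n) = of_nat n * v x"
  by (induction n) (auto simp: val_mult algebra_simps)

lemma val_prod: "finite A \<Longrightarrow> (\<And>i. i \<in> A \<Longrightarrow> f i \<noteq> 0) \<Longrightarrow> v (prod f A) = (\<Sum>i\<in>A. v (f i))"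
  by (induction A rule: finite_induct) (auto simp: val_mult)

text \<open>The value \<open>v 0\<close> is arbitrary, so 0 is added by hand here and in
  \<open>maximal\<close>. The residue field is never formed; congruences are written as membership
  of differences in \<open>maximal\<close>.\<close>

definition integers :: "'a set" where "integers = {x. x = 0 \<or> v x \<ge> 0}"
definition maximal :: "'a set" where "maximal = {x. x = 0 \<or> v x > 0}"

lemma val_eq_of_add:
  assumes "x \<noteq> 0" "y = 0 \<or> v y > v x" shows "x + y \<noteq> 0" "v (x + y) = v x"
proof -
  show nz: "x + y \<noteq> 0"
  proof
    assume "x + y = 0"
    then have "y = - x" by (simp add: eq_neg_iff_add_eq_0 add.commute)
    then show False using assms val_minus by auto
  qed
  show "v (x + y) = v x"
  proof (cases "y = 0")
    case False
    then have y: "v y > v x" using assms by simp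
    have "v (x + y) \<ge> v x" using val_add[OF assms(1) False nz] y by simp
    moreover have "v x \<ge> min (v (x + y)) (v (- y))"
      using val_add[of "x + y" "- y"] nz False assms(1) by simp
    ultimately show ?thesis using y val_minus[OF False] by auto
  qed simp
qed

lemma integers_mult: "x \<in> integers \<Longrightarrow> y \<in> integers \<Longrightarrow> x * y \<in> integers"
  by (cases "x = 0"; cases "y = 0") (auto simp: integers_def val_mult)

lemma integers_one [simp]: "1 \<in> integers" by (simp add: integers_def)
lemma maximal_zero [simp]: "0 \<in> maximal" by (simp add: maximal_def)
lemma one_notin_maximal [simp]: "1 \<notin> maximal" by (simp add: maximal_def)
lemma maximal_subset: "x \<in> maximal \<Longrightarrow> x \<in> integers" by (auto simp: maximal_def integers_def)

lemma integers_add: "x \<in> integers \<Longrightarrow> y \<in> integers \<Longrightarrow> x + y \<in> integers"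
  using val_add[of x y] by (cases "x = 0"; cases "y = 0"; cases "x + y = 0") (auto simp: integers_def)

lemma maximal_add: "x \<in> maximal \<Longrightarrow> y \<in> maximal \<Longrightarrow> x + y \<in> maximal"
  using val_add[of x y] by (cases "x = 0"; cases "y = 0"; cases "x + y = 0") (auto simp: maximal_def)

lemma integers_minus: "x \<in> integers \<Longrightarrow> - x \<in> integers"
  using val_minus[of x] by (cases "x = 0") (auto simp: integers_def)

lemma maximal_minus: "x \<in> maximal \<Longrightarrow> - x \<in> maximal"
  using val_minus[of x] by (cases "x = 0") (auto simp: maximal_def)

lemma integers_diff: "x \<in> integers \<Longrightarrow> y \<in> integers \<Longrightarrow> x - y \<in> integers"
  using integers_add[of x "- y"] integers_minus[of y] by simp

lemma maximal_diff: "x \<in> maximal \<Longrightarrow> y \<in> maximal \<Longrightarrow> x - y \<in> maximal"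
  using maximal_add[of x "- y"] maximal_minus[of y] by simp

lemma maximal_diff_commute: "x - y \<in> maximal \<Longrightarrow> y - x \<in> maximal"
  using maximal_minus[of "x - y"] by simp

lemma maximal_diff_trans: "x - y \<in> maximal \<Longrightarrow> y - z \<in> maximal \<Longrightarrow> x - z \<in> maximal"
  using maximal_add[of "x - y" "y - z"] by simp

lemma maximal_mult: "x \<in> integers \<Longrightarrow> y \<in> maximal \<Longrightarrow> x * y \<in> maximal"
  by (cases "x = 0"; cases "y = 0") (auto simp: integers_def maximal_def val_mult)

lemma maximal_mult': "x \<in> maximal \<Longrightarrow> y \<in> integers \<Longrightarrow> x * y \<in> maximal"
  using maximal_mult[of y x] by (simp add: mult.commute)

lemma maximal_prime: "x * y \<in> maximal \<Longrightarrow> x \<in> integers \<Longrightarrow> y \<in> integers \<Longrightarrow> x \<in> maximal \<or> y \<in> maximal"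
  by (cases "x = 0"; cases "y = 0") (auto simp: integers_def maximal_def val_mult)

lemma integers_sum: "(\<And>i. i \<in> A \<Longrightarrow> f i \<in> integers) \<Longrightarrow> sum f A \<in> integers"
  by (induction A rule: infinite_finite_induct) (auto simp: integers_add, auto simp: integers_def)

lemma maximal_sum: "(\<And>i. i \<in> A \<Longrightarrow> f i \<in> maximal) \<Longrightarrow> sum f A \<in> maximal"
  by (induction A rule: infinite_finite_induct) (auto simp: maximal_add)

lemma integers_power: "x \<in> integers \<Longrightarrow> x ^ n \<in> integers"
  by (induction n) (auto simp: integers_mult)

lemma maximal_mult_diff:
  assumes "x - x' \<in> maximal" "y - y' \<in> maximal" "x \<in> integers" "y' \<in> integers"
  shows "x * y - x' * y' \<in> maximal"
proof -
  have "x * y - x' * y' = x * (y - y') + (x - x') * y'" by (simp add: algebra_simps)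
  then show ?thesis using assms maximal_add maximal_mult maximal_mult' by metis
qed

lemma maximal_power_diff:
  assumes "x - y \<in> maximal" "x \<in> integers" "y \<in> integers"
  shows "x ^ n - y ^ n \<in> maximal"
proof (induction n)
  case (Suc n)
  then show ?case using assms maximal_mult_diff[OF assms(1) Suc assms(2) integers_power[OF assms(3)]] by simp
qed simp

lemma unit_iff: "x \<in> integers \<and> x \<notin> maximal \<longleftrightarrow> x \<noteq> 0 \<and> v x = 0"
  by (auto simp: integers_def maximal_def)

end

section \<open>Automorphisms of a finite extension\<close>

lemma subfield_closed:
  fixes L :: "'a::field set"
  assumes "subfield L (ring_of_type_algebra :: 'a ring)"
  shows "0 \<in> L" "1 \<in> L" "\<And>x y. x \<in> L \<Longrightarrow> y \<in> L \<Longrightarrow> x + y \<in> L"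
    "\<And>x y. x \<in> L \<Longrightarrow> y \<in> L \<Longrightarrow> x * y \<in> L" "\<And>x. x \<in> L \<Longrightarrow> - x \<in> L" "\<And>x. x \<in> L \<Longrightarrow> inverse x \<in> L"
proof -
  let ?R = "ring_of_type_algebra :: 'a ring"
  interpret R: field ?R by (rule field_from_type_algebra)
  interpret L: subfield L ?R by fact
  note E = subringE[OF subfieldE(1)[OF assms]]
  have simps: "\<zero>\<^bsub>?R\<^esub> = 0" "\<one>\<^bsub>?R\<^esub> = 1" "\<And>x y. x \<oplus>\<^bsub>?R\<^esub> y = x + y" "\<And>x y. x \<otimes>\<^bsub>?R\<^esub> y = x * y" "carrier ?R = UNIV"
    by (auto simp: ring_of_type_algebra_def)
  show 0: "0 \<in> L" using E(2) simps by simp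
  show "1 \<in> L" using E(3) simps by simp
  show "x + y \<in> L" if "x \<in> L" "y \<in> L" for x y
    using E(7)[of x y] that simps by simp
  show mult: "x * y \<in> L" if "x \<in> L" "y \<in> L" for x y
    using E(6)[of x y] that simps by simp
  show "- x \<in> L" if x: "x \<in> L" for x
  proof -
    have "\<ominus>\<^bsub>?R\<^esub> x \<in> L" using E(5) x by simp
    moreover have "\<ominus>\<^bsub>?R\<^esub> x = - x"
      using R.minus_equality[of "- x" x] simps by simp
    ultimately show ?thesis by simp
  qed
  show "inverse x \<in> L" if x: "x \<in> L" for x
  proof (cases "x = 0")
    case False
    then have "x \<in> Units (?R\<lparr>carrier := L\<rparr>)" using L.subfield_Units x simps by simp
    then obtain y where y: "y \<in> L" "x * y = 1" using simps by (auto simp: Units_def)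
    then have "inverse x = y" using inverse_unique[of x y] by simp
    then show ?thesis using y by simp
  qed (use 0 in simp)
qed

text \<open>An automorphism is linear over the base field, so it is determined by its values on a
  spanning list.\<close>

lemma gal_combine_eq:
  fixes L :: "'k::field alg_closure set"
  assumes L: "subfield L ring_of_type_algebra" "range to_ac \<subseteq> L"
    and "\<sigma> \<in> gal L" "\<tau> \<in> gal L" "set Us \<subseteq> L" "\<And>u. u \<in> set Us \<Longrightarrow> \<sigma> u = \<tau> u" "set Ks \<subseteq> range to_ac"
  shows "ring.combine (ring_of_type_algebra :: 'k alg_closure ring) Ks Us \<in> L \<and>
    \<sigma> (ring.combine (ring_of_type_algebra :: 'k alg_closure ring) Ks Us) =
    \<tau> (ring.combine (ring_of_type_algebra :: 'k alg_closure ring) Ks Us)"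
proof -
  let ?R = "ring_of_type_algebra :: 'k alg_closure ring"
  interpret R: field ?R by (rule field_from_type_algebra)
  have simps: "\<zero>\<^bsub>?R\<^esub> = 0" "\<And>x y. x \<oplus>\<^bsub>?R\<^esub> y = x + y" "\<And>x y. x \<otimes>\<^bsub>?R\<^esub> y = x * y"
    by (auto simp: ring_of_type_algebra_def)
  note cl = subfield_closed[OF L(1)]
  have zero: "\<rho> 0 = 0" if "\<rho> \<in> gal L" for \<rho>
  proof -
    have "\<rho> (to_ac 0) = to_ac 0" using that unfolding gal_def by blast
    then show ?thesis by simp
  qed
  show ?thesis using assms(5-7)
  proof (induction Ks Us rule: R.combine.induct)
    case (1 k Ks u Us)
    let ?c = "R.combine Ks Us"
    have IH: "?c \<in> L" "\<sigma> ?c = \<tau> ?c" using 1 by auto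
    have mem: "k \<in> L" "u \<in> L" "k * u \<in> L" using 1 L cl(4) by auto
    have "\<rho> (k * u + ?c) = k * \<rho> u + \<rho> ?c" if "\<rho> \<in> gal L" for \<rho>
    proof -
      have "\<rho> k = k" using that 1 unfolding gal_def by auto
      then show ?thesis using that mem IH(1) unfolding gal_def by auto
    qed
    from this[OF assms(3)] this[OF assms(4)] have "\<sigma> (k * u + ?c) = \<tau> (k * u + ?c)" using IH 1 by simp
    then show ?case using IH mem cl(3) by (simp add: simps)
  qed (use cl(1) zero[OF assms(3)] zero[OF assms(4)] in \<open>simp_all add: simps\<close>)
qed

lemma gal_poly:
  fixes L :: "'k::field alg_closure set"
  assumes L: "subfield L ring_of_type_algebra" "range to_ac \<subseteq> L" and \<sigma>: "\<sigma> \<in> gal L" and x: "x \<in> L"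
  shows "poly (map_poly to_ac q) x \<in> L \<and> \<sigma> (poly (map_poly to_ac q) x) = poly (map_poly to_ac q) (\<sigma> x)"
proof (induction q)
  case 0
  have "\<sigma> (to_ac 0) = to_ac 0" using \<sigma> unfolding gal_def by blast
  then show ?case using subfield_closed(1)[OF L(1)] by simp
next
  case (pCons a q)
  note cl = subfield_closed[OF L(1)]
  let ?y = "poly (map_poly to_ac q) x"
  have a: "to_ac a \<in> L" using L(2) by blast
  have y: "?y \<in> L" "x * ?y \<in> L" using pCons cl(4) x by auto
  have "\<sigma> (to_ac a + x * ?y) = to_ac a + \<sigma> x * \<sigma> ?y" using \<sigma> a x y unfolding gal_def by auto
  then show ?case using pCons a y cl(3) by (simp add: map_poly_pCons)
qed

text \<open>An automorphism is determined by the images of a finite spanning list \<open>Us\<close>,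
  and the image of each \<open>u\<close> is a root of the polynomial \<open>P u\<close> over the
  base field. So restriction to \<open>Us\<close> embeds \<open>gal L\<close> into a finite product
  of finite sets.\<close>

lemma finite_gal:
  fixes L :: "'k::field alg_closure set"
  assumes L: "finite_galois L"
  shows "finite (gal L)"
proof -
  let ?R = "ring_of_type_algebra :: 'k alg_closure ring"
  interpret R: field ?R by (rule field_from_type_algebra)
  have sf: "subfield L ?R" and K: "range to_ac \<subseteq> L" and fd: "R.finite_dimension (range to_ac) L"
    using L by (auto simp: finite_galois_def)
  \<comment> \<open>Spans and bases in \<open>L\<close> require the base field to be a subfield in
    the sense of the algebraic structures.\<close>
  have sK: "subfield (range to_ac :: 'k alg_closure set) ?R"
  proof (rule R.subfieldI')
    show "subring (range to_ac :: 'k alg_closure set) ?R"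
    proof (rule R.subringI)
      fix h :: "'k alg_closure" assume "h \<in> range to_ac"
      then obtain c where c: "h = to_ac c" by blast
      have "\<ominus>\<^bsub>?R\<^esub> h = - h" using R.minus_equality[of "- h" h] by (simp add: ring_of_type_algebra_def)
      then show "\<ominus>\<^bsub>?R\<^esub> h \<in> range to_ac" using c by (metis rangeI to_ac_minus)
    qed (auto simp: ring_of_type_algebra_def simp flip: to_ac_1 to_ac_mult to_ac_add)
    fix k :: "'k alg_closure" assume "k \<in> range to_ac - {\<zero>\<^bsub>?R\<^esub>}"
    then obtain c where c: "k = to_ac c" "k \<noteq> 0" by (auto simp: ring_of_type_algebra_def)
    have "inv\<^bsub>?R\<^esub> k = inverse k"
      by (rule R.inv_char) (use c in \<open>auto simp: ring_of_type_algebra_def\<close>)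
    then show "inv\<^bsub>?R\<^esub> k \<in> range to_ac" using c by (metis rangeI to_ac_inverse)
  qed
  obtain Us where Us: "set Us \<subseteq> carrier ?R" "R.Span (range to_ac) Us = L"
    using R.exists_base[OF sK R.finite_dimensionE[OF sK fd]] by blast
  have UL: "set Us \<subseteq> L" using R.Span_base_incl[OF sK Us(1)] Us(2) by simp
  have L_eq: "L = {R.combine Ks Us | Ks. set Ks \<subseteq> range to_ac}"
    using R.Span_eq_combine_set[OF sK Us(1)] Us(2) by simp
  have ex: "\<exists>p :: 'k poly. p \<noteq> 0 \<and> poly (map_poly to_ac p) u = 0" for u :: "'k alg_closure"
    using alg_closure_algebraic by blast
  define P where "P = (\<lambda>u :: 'k alg_closure. SOME p :: 'k poly. p \<noteq> 0 \<and> poly (map_poly to_ac p) u = 0)"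
  have P: "P u \<noteq> 0" "poly (map_poly to_ac (P u)) u = 0" for u
    using someI_ex[OF ex[of u]] by (auto simp: P_def)
  have rootsP: "finite {x. poly (map_poly to_ac (P u)) x = 0}" for u
  proof (rule poly_roots_finite)
    show "map_poly to_ac (P u) \<noteq> 0" using P(1)[of u] by (auto simp: poly_eq_iff coeff_map_poly)
  qed
  define r where "r = (\<lambda>\<sigma> :: 'k alg_closure \<Rightarrow> 'k alg_closure. restrict \<sigma> (set Us))"
  have "r ` gal L \<subseteq> (\<Pi>\<^sub>E u\<in>set Us. {x. poly (map_poly to_ac (P u)) x = 0})"
  proof (clarsimp simp: r_def restrict_PiE_iff)
    fix \<sigma> u assume \<sigma>: "\<sigma> \<in> gal L" and u: "u \<in> set Us"
    have "\<sigma> (to_ac 0) = to_ac 0" using \<sigma> unfolding gal_def by blast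
    then show "poly (map_poly to_ac (P u)) (\<sigma> u) = 0"
      using gal_poly[OF sf K \<sigma>, of u "P u"] P(2)[of u] u UL by auto
  qed
  then have "finite (r ` gal L)" using rootsP by (meson finite_PiE finite_set finite_subset)
  moreover have "inj_on r (gal L)"
  proof (rule inj_onI)
    fix \<sigma> \<tau> assume st: "\<sigma> \<in> gal L" "\<tau> \<in> gal L" "r \<sigma> = r \<tau>"
    have "\<sigma> u = \<tau> u" if "u \<in> set Us" for u using fun_cong[OF st(3), of u] that by (simp add: r_def)
    then have "\<sigma> x = \<tau> x" if "x \<in> L" for x
      using gal_combine_eq[OF sf K st(1,2) UL] that L_eq by blast
    moreover have "\<sigma> \<in> extensional L" "\<tau> \<in> extensional L" using st by (auto simp: gal_def Bij_def)
    ultimately show "\<sigma> = \<tau>" by (meson extensionalityI)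
  qed
  ultimately show ?thesis by (rule finite_imageD)
qed

text \<open>By \<open>val_of_nat\<close> the integers prime to \<open>p\<close> are units; together
  with \<open>tame\<close> this makes the orders of inertia and of its subgroups units, so that one
  can divide by them when averaging or taking traces.\<close>

locale tame_galois = valued_field v for v :: "('k::field_char_0) alg_closure \<Rightarrow> rat" +
  fixes p :: nat and L :: "'k alg_closure set"
  assumes val_base: "v ` (to_ac ` (UNIV - {0})) = \<int>"
    and galois: "finite_galois L" and tame: "tame p v L"
    and val_of_nat: "\<And>m::nat. \<not> p dvd m \<Longrightarrow> v (of_nat m) = 0"
begin

lemma subfield_L: "subfield L ring_of_type_algebra" and base_subset: "range to_ac \<subseteq> L"
  using galois by (auto simp: finite_galois_def)

lemmas L_closed [simp] = subfield_closed[OF subfield_L]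

lemma L_to_ac [simp]: "to_ac c \<in> L" using base_subset by blast
lemma L_diff [simp]: "x \<in> L \<Longrightarrow> y \<in> L \<Longrightarrow> x - y \<in> L" using L_closed(3)[of x "- y"] by simp
lemma L_divide [simp]: "x \<in> L \<Longrightarrow> y \<in> L \<Longrightarrow> x / y \<in> L" by (simp add: divide_inverse)
lemma L_power [simp]: "x \<in> L \<Longrightarrow> x ^ n \<in> L" by (induction n) auto
lemma L_of_nat [simp]: "of_nat n \<in> L" by (induction n) auto
lemma L_sum: "(\<And>i. i \<in> A \<Longrightarrow> f i \<in> L) \<Longrightarrow> sum f A \<in> L"
  by (induction A rule: infinite_finite_induct) auto
lemma L_prod: "(\<And>i. i \<in> A \<Longrightarrow> f i \<in> L) \<Longrightarrow> prod f A \<in> L"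
  by (induction A rule: infinite_finite_induct) auto

lemma gal_closed: "\<sigma> \<in> gal L \<Longrightarrow> x \<in> L \<Longrightarrow> \<sigma> x \<in> L"
  unfolding gal_def Bij_def bij_betw_def by blast

lemma gal_add: "\<sigma> \<in> gal L \<Longrightarrow> x \<in> L \<Longrightarrow> y \<in> L \<Longrightarrow> \<sigma> (x + y) = \<sigma> x + \<sigma> y"
  and gal_mult: "\<sigma> \<in> gal L \<Longrightarrow> x \<in> L \<Longrightarrow> y \<in> L \<Longrightarrow> \<sigma> (x * y) = \<sigma> x * \<sigma> y"
  and gal_to_ac: "\<sigma> \<in> gal L \<Longrightarrow> \<sigma> (to_ac c) = to_ac c"
  unfolding gal_def by blast+

lemma gal_inj: "\<sigma> \<in> gal L \<Longrightarrow> x \<in> L \<Longrightarrow> y \<in> L \<Longrightarrow> \<sigma> x = \<sigma> y \<longleftrightarrow> x = y"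
  unfolding gal_def Bij_def bij_betw_def inj_on_def by blast

lemma gal_zero: "\<sigma> \<in> gal L \<Longrightarrow> \<sigma> 0 = 0" and gal_one: "\<sigma> \<in> gal L \<Longrightarrow> \<sigma> 1 = 1"
  using gal_to_ac[of \<sigma> 0] gal_to_ac[of \<sigma> 1] by auto

lemma gal_nonzero: "\<sigma> \<in> gal L \<Longrightarrow> x \<in> L \<Longrightarrow> x \<noteq> 0 \<Longrightarrow> \<sigma> x \<noteq> 0"
  using gal_inj[of \<sigma> x 0] gal_zero by auto

lemma gal_minus: "\<sigma> \<in> gal L \<Longrightarrow> x \<in> L \<Longrightarrow> \<sigma> (- x) = - \<sigma> x"
  using gal_add[of \<sigma> x "- x"] gal_zero[of \<sigma>] by (simp add: add_eq_0_iff)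

lemma gal_diff: "\<sigma> \<in> gal L \<Longrightarrow> x \<in> L \<Longrightarrow> y \<in> L \<Longrightarrow> \<sigma> (x - y) = \<sigma> x - \<sigma> y"
  using gal_add[of \<sigma> x "- y"] gal_minus by simp

lemma gal_inverse: "\<sigma> \<in> gal L \<Longrightarrow> x \<in> L \<Longrightarrow> \<sigma> (inverse x) = inverse (\<sigma> x)"
proof (cases "x = 0")
  case False
  assume "\<sigma> \<in> gal L" "x \<in> L"
  then have "\<sigma> x * \<sigma> (inverse x) = 1" using gal_mult[of \<sigma> x "inverse x"] gal_one[of \<sigma>] False by simp
  then show ?thesis using inverse_unique by metis
qed (simp add: gal_zero)

lemma gal_divide: "\<sigma> \<in> gal L \<Longrightarrow> x \<in> L \<Longrightarrow> y \<in> L \<Longrightarrow> \<sigma> (x / y) = \<sigma> x / \<sigma> y"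
  by (simp add: divide_inverse gal_mult gal_inverse)

lemma gal_power: "\<sigma> \<in> gal L \<Longrightarrow> x \<in> L \<Longrightarrow> \<sigma> (x ^ n) = \<sigma> x ^ n"
  by (induction n) (auto simp: gal_mult gal_one)

lemma gal_sum: "\<sigma> \<in> gal L \<Longrightarrow> (\<And>i. i \<in> A \<Longrightarrow> f i \<in> L) \<Longrightarrow> \<sigma> (sum f A) = (\<Sum>i\<in>A. \<sigma> (f i))"
  by (induction A rule: infinite_finite_induct) (auto simp: gal_zero gal_add L_sum)

lemma gal_prod: "\<sigma> \<in> gal L \<Longrightarrow> (\<And>i. i \<in> A \<Longrightarrow> f i \<in> L) \<Longrightarrow> \<sigma> (prod f A) = (\<Prod>i\<in>A. \<sigma> (f i))"
  by (induction A rule: infinite_finite_induct) (auto simp: gal_one gal_mult L_prod)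

lemma gal_eqI: "\<sigma> \<in> gal L \<Longrightarrow> \<tau> \<in> gal L \<Longrightarrow> (\<And>x. x \<in> L \<Longrightarrow> \<sigma> x = \<tau> x) \<Longrightarrow> \<sigma> = \<tau>"
  by (rule extensionalityI[of _ L]) (simp_all add: gal_def Bij_def)

lemma compose_apply [simp]: "x \<in> L \<Longrightarrow> compose L \<sigma> \<tau> x = \<sigma> (\<tau> x)"
  by (simp add: compose_def)

lemma gal_compose: "\<sigma> \<in> gal L \<Longrightarrow> \<tau> \<in> gal L \<Longrightarrow> compose L \<sigma> \<tau> \<in> gal L"
proof -
  assume st: "\<sigma> \<in> gal L" "\<tau> \<in> gal L"
  then have "compose L \<sigma> \<tau> \<in> Bij L" by (simp add: gal_def compose_Bij)
  then show ?thesis unfolding gal_def mem_Collect_eq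
    using st by (auto simp: gal_add gal_mult gal_closed gal_to_ac)
qed

lemma gal_id: "(\<lambda>x\<in>L. x) \<in> gal L"
  by (simp add: gal_def id_Bij)

lemma gal_inv:
  assumes \<sigma>: "\<sigma> \<in> gal L"
  obtains \<tau> where "\<tau> \<in> gal L" "\<And>x. x \<in> L \<Longrightarrow> \<tau> (\<sigma> x) = x" "\<And>x. x \<in> L \<Longrightarrow> \<sigma> (\<tau> x) = x"
proof -
  define \<tau> where "\<tau> = restrict (inv_into L \<sigma>) L"
  have B: "\<sigma> \<in> Bij L" using \<sigma> by (simp add: gal_def)
  then have bij: "bij_betw \<sigma> L L" by (simp add: Bij_def)
  have 1: "\<tau> (\<sigma> x) = x" if "x \<in> L" for x
    using that bij gal_closed[OF \<sigma> that] by (simp add: \<tau>_def bij_betw_def inv_into_f_f)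
  have 2: "\<sigma> (\<tau> x) = x" and 3: "\<tau> x \<in> L" if "x \<in> L" for x
    using that bij by (auto simp: \<tau>_def bij_betw_def f_inv_into_f inv_into_into)
  have "\<tau> \<in> gal L"
    unfolding gal_def mem_Collect_eq
  proof (intro conjI ballI allI)
    show "\<tau> \<in> Bij L" unfolding \<tau>_def using restrict_inv_into_Bij[OF B] .
    show "\<tau> (x + y) = \<tau> x + \<tau> y" "\<tau> (x * y) = \<tau> x * \<tau> y" if "x \<in> L" "y \<in> L" for x y
      using 1[of "\<tau> x + \<tau> y"] 1[of "\<tau> x * \<tau> y"] 2 3 that gal_add[OF \<sigma>] gal_mult[OF \<sigma>] by auto
    show "\<tau> (to_ac c) = to_ac c" for c using 1[of "to_ac c"] gal_to_ac[OF \<sigma>] by simp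
  qed
  then show ?thesis using that 1 2 by blast
qed

lemma fixed_in_base: "x \<in> L \<Longrightarrow> (\<And>\<sigma>. \<sigma> \<in> gal L \<Longrightarrow> \<sigma> x = x) \<Longrightarrow> x \<in> range to_ac"
  using galois unfolding finite_galois_def by blast

lemma val_base_int: "x \<in> range to_ac \<Longrightarrow> x \<noteq> 0 \<Longrightarrow> v x \<in> \<int>"
proof -
  assume "x \<in> range to_ac" "x \<noteq> 0"
  then obtain c where "x = to_ac c" "c \<noteq> 0" by auto
  then have "v x \<in> v ` (to_ac ` (UNIV - {0}))" by simp
  then show ?thesis unfolding val_base .
qed

lemma base_of_val:
  fixes i :: int
  obtains c where "to_ac c \<noteq> 0" "v (to_ac c) = of_int i"
proof -
  have "(of_int i :: rat) \<in> (\<lambda>c. v (to_ac c)) ` (UNIV - {0})" using val_base unfolding image_image by simp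
  then obtain c where "of_int i = v (to_ac c)" "c \<in> UNIV - {0}" by (rule imageE)
  then show ?thesis by (intro that[of c]) simp_all
qed

section \<open>Inertia, the decomposition group and approximation\<close>

lemma finite_inertia: "finite (inertia v L)"
  by (rule finite_subset[OF _ finite_gal[OF galois]]) (auto simp: inertia_def)

lemma inertia_gal: "\<sigma> \<in> inertia v L \<Longrightarrow> \<sigma> \<in> gal L"
  by (simp add: inertia_def)

lemma inertia_maximal: "\<sigma> \<in> inertia v L \<Longrightarrow> x \<in> L \<Longrightarrow> x \<in> integers \<Longrightarrow> \<sigma> x - x \<in> maximal"
  by (auto simp: inertia_def integers_def maximal_def)

text \<open>
  No uniqueness of extensions of valuations is needed here: some power of \<open>x\<close> is an element of
  \<open>K\<close> times a unit.
\<close>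

lemma val_gal_eqI:
  assumes \<sigma>: "\<sigma> \<in> gal L" and units: "\<And>x. x \<in> L \<Longrightarrow> x \<noteq> 0 \<Longrightarrow> v x = 0 \<Longrightarrow> v (\<sigma> x) = 0"
    and x: "x \<in> L" "x \<noteq> 0"
  shows "v (\<sigma> x) = v x"
proof -
  obtain a b where ab: "quotient_of (v x) = (a, b)" by fastforce
  have b: "b > 0" using quotient_of_denom_pos[OF ab] .
  have vx: "v x = of_int a / of_int b" using quotient_of_div[OF ab] .
  obtain c where c: "to_ac c \<noteq> (0 :: 'k alg_closure)" "v (to_ac c) = of_int a" by (rule base_of_val)
  let ?z = "x ^ nat b / to_ac c"
  have b': "(of_nat (nat b) :: rat) = of_int b" using b by simp
  have "v ?z = of_int b * v x - of_int a" using x c b' by (simp add: val_divide val_power)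
  also have "\<dots> = 0" using vx b by simp
  finally have "v (\<sigma> ?z) = 0" using x c by (intro units) simp_all
  moreover have "v (\<sigma> ?z) = of_int b * v (\<sigma> x) - of_int a"
    using x c b' gal_nonzero[OF \<sigma> x] by (simp add: gal_divide[OF \<sigma>] gal_power[OF \<sigma>] gal_to_ac[OF \<sigma>] val_divide val_power)
  ultimately have "of_int b * v (\<sigma> x) = of_int b * v x" using vx b by simp
  then show ?thesis using b by simp
qed

text \<open>Inertia moves a unit by an element of \<open>maximal\<close> and so keeps its valuation
  0; \<open>val_gal_eqI\<close> extends this from units to all of \<open>L\<close>.\<close>

lemma val_inertia:
  assumes \<sigma>: "\<sigma> \<in> inertia v L" and x: "x \<in> L" "x \<noteq> 0"
  shows "v (\<sigma> x) = v x"
proof (rule val_gal_eqI[OF inertia_gal[OF \<sigma>] _ x])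
  fix x assume x: "x \<in> L" "x \<noteq> 0" "v x = 0"
  then have "\<sigma> x - x \<in> maximal" by (intro inertia_maximal[OF \<sigma>]) (simp_all add: integers_def)
  then have "v (x + (\<sigma> x - x)) = v x" using x by (intro val_eq_of_add) (auto simp: maximal_def)
  then show "v (\<sigma> x) = 0" using x by simp
qed

text \<open>It is not identified with \<open>gal L\<close>: for an automorphism outside it, the
  conjugate valuation differs from \<open>v\<close>, and the approximation results below are about
  such conjugates.\<close>

definition decomposition :: "('k alg_closure \<Rightarrow> 'k alg_closure) set" where
  "decomposition = {\<sigma> \<in> gal L. \<forall>x\<in>L. x \<noteq> 0 \<longrightarrow> v (\<sigma> x) = v x}"

lemma decomposition_gal: "\<sigma> \<in> decomposition \<Longrightarrow> \<sigma> \<in> gal L"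
  by (simp add: decomposition_def)

lemma val_decomposition: "\<sigma> \<in> decomposition \<Longrightarrow> x \<in> L \<Longrightarrow> x \<noteq> 0 \<Longrightarrow> v (\<sigma> x) = v x"
  by (simp add: decomposition_def)

lemma inertia_decomposition: "\<sigma> \<in> inertia v L \<Longrightarrow> \<sigma> \<in> decomposition"
  by (simp add: decomposition_def val_inertia inertia_gal)

lemma decomposition_integers: "\<sigma> \<in> decomposition \<Longrightarrow> x \<in> L \<Longrightarrow> x \<in> integers \<Longrightarrow> \<sigma> x \<in> integers"
  using gal_zero[OF decomposition_gal, of \<sigma>] val_decomposition[of \<sigma> x]
  by (cases "x = 0") (simp_all add: integers_def)

lemma decomposition_maximal: "\<sigma> \<in> decomposition \<Longrightarrow> x \<in> L \<Longrightarrow> x \<in> maximal \<Longrightarrow> \<sigma> x \<in> maximal"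
  using gal_zero[OF decomposition_gal, of \<sigma>] val_decomposition[of \<sigma> x]
  by (cases "x = 0") (simp_all add: maximal_def)

lemma exists_separating:
  assumes \<sigma>: "\<sigma> \<in> gal L" "\<sigma> \<notin> decomposition"
  obtains b where "b \<in> L" "b \<noteq> 0" "v b < 0" "v (\<sigma> b) > 0"
proof -
  obtain x where x: "x \<in> L" "x \<noteq> 0" "v x = 0" "v (\<sigma> x) \<noteq> 0"
  proof -
    obtain y where y: "y \<in> L" "y \<noteq> 0" "v (\<sigma> y) \<noteq> v y" using \<sigma> by (auto simp: decomposition_def)
    show ?thesis using val_gal_eqI[OF \<sigma>(1) _ y(1,2)] y(3) that by blast
  qed
  obtain z where z: "z \<in> L" "z \<noteq> 0" "v z = 0" "v (\<sigma> z) > 0"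
  proof (cases "v (\<sigma> x) > 0")
    case False
    have "v (\<sigma> (inverse x)) = - v (\<sigma> x)"
      using x gal_nonzero[OF \<sigma>(1)] by (simp add: gal_inverse[OF \<sigma>(1)] val_inverse)
    then show ?thesis using that[of "inverse x"] x False by (simp add: val_inverse)
  qed (use that x in blast)
  obtain c where c: "to_ac c \<noteq> (0 :: 'k alg_closure)" "v (to_ac c) = of_int 1" by (rule base_of_val)
  \<comment> \<open>\<open>c\<close> has valuation 1 and is fixed by \<open>\<sigma>\<close>;
    dividing \<open>z ^ k\<close> by it gives valuation \<open>- 1\<close> at \<open>v\<close>, and
    the size of \<open>k\<close> keeps the valuation at the conjugate positive.\<close>
  obtain k :: nat where k: "of_nat k * v (\<sigma> z) > 1" using z(4) ex_less_of_nat_mult by blast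
  show ?thesis
  proof (rule that[of "z ^ k / to_ac c"])
    show "v (z ^ k / to_ac c) < 0" using z c by (simp add: val_divide val_power)
    have "v (\<sigma> (z ^ k / to_ac c)) = of_nat k * v (\<sigma> z) - 1"
      using z c gal_nonzero[OF \<sigma>(1) z(1,2)]
      by (simp add: gal_divide[OF \<sigma>(1)] gal_power[OF \<sigma>(1)] gal_to_ac[OF \<sigma>(1)] val_divide val_power)
    then show "v (\<sigma> (z ^ k / to_ac c)) > 0" using k by simp
  qed (use z c in simp_all)
qed

text \<open>The approximation theorem of Artin and Whaples, for the conjugates of \<open>v\<close>.\<close>

lemma exists_separating_all:
  assumes "finite A" "A \<subseteq> gal L - decomposition"
  shows "\<exists>b\<in>L. b \<noteq> 0 \<and> v b < 0 \<and> (\<forall>\<sigma>\<in>A. v (\<sigma> b) > 0)"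
  using assms
proof (induction A rule: finite_induct)
  case empty
  obtain c where c: "to_ac c \<noteq> (0 :: 'k alg_closure)" "v (to_ac c) = of_int (-1)" by (rule base_of_val)
  then show ?case by (intro bexI[of _ "to_ac c"]) simp_all
next
  case (insert \<tau> A)
  then obtain b where b: "b \<in> L" "b \<noteq> 0" "v b < 0" "\<And>\<sigma>. \<sigma> \<in> A \<Longrightarrow> v (\<sigma> b) > 0" by auto
  have \<tau>: "\<tau> \<in> gal L" "\<tau> \<notin> decomposition" and A: "\<And>\<sigma>. \<sigma> \<in> A \<Longrightarrow> \<sigma> \<in> gal L" using insert by auto
  obtain c where c: "c \<in> L" "c \<noteq> 0" "v c < 0" "v (\<tau> c) > 0" by (rule exists_separating[OF \<tau>])
  have "\<exists>k::nat. k > 0 \<and> (\<forall>\<sigma>\<in>A. of_nat k * v (\<sigma> b) + v (\<sigma> c) > 0)"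
  proof -
    have "\<exists>k::nat. of_nat k * v (\<sigma> b) > - v (\<sigma> c)" if "\<sigma> \<in> A" for \<sigma>
      using b(4)[OF that] ex_less_of_nat_mult by blast
    then obtain k :: "_ \<Rightarrow> nat" where k: "\<And>\<sigma>. \<sigma> \<in> A \<Longrightarrow> of_nat (k \<sigma>) * v (\<sigma> b) > - v (\<sigma> c)" by metis
    have "of_nat (Suc (Max (insert 0 (k ` A)))) * v (\<sigma> b) + v (\<sigma> c) > 0" if "\<sigma> \<in> A" for \<sigma>
    proof -
      have "k \<sigma> \<le> Suc (Max (insert 0 (k ` A)))" using insert.hyps that by (simp add: le_SucI)
      then have "of_nat (k \<sigma>) * v (\<sigma> b) \<le> of_nat (Suc (Max (insert 0 (k ` A)))) * v (\<sigma> b)"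
        using b(4)[OF that] by (intro mult_right_mono) (auto simp del: of_nat_Suc)
      then show ?thesis using k[OF that] by simp
    qed
    then show ?thesis by blast
  qed
  then obtain k :: nat where k: "k > 0" "\<And>\<sigma>. \<sigma> \<in> A \<Longrightarrow> of_nat k * v (\<sigma> b) + v (\<sigma> c) > 0" by blast
  have nz: "\<sigma> b \<noteq> 0" "\<sigma> c \<noteq> 0" if "\<sigma> \<in> gal L" for \<sigma> using gal_nonzero that b c by auto
  \<comment> \<open>The element \<open>b\<close> serves the conjugates in \<open>A\<close>, and
    \<open>c\<close> serves \<open>\<tau>\<close>. If \<open>b\<close> is a unit at
    \<open>\<tau>\<close>, then \<open>b ^ k * c\<close> serves all: it is negative at
    \<open>v\<close>, as \<open>c\<close> at \<open>\<tau>\<close>, and positive on \<open>A\<close>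
    for large \<open>k\<close>.\<close>
  consider "v (\<tau> b) > 0" | "v (\<tau> b) = 0" | "v (\<tau> b) < 0" by linarith
  then show ?case
  proof cases
    case 1
    then show ?thesis using b by (intro bexI[of _ b]) auto
  next
    case 2
    have val: "v (\<sigma> (b ^ k * c)) = of_nat k * v (\<sigma> b) + v (\<sigma> c)" if "\<sigma> \<in> gal L" for \<sigma>
      using that nz[OF that] b c by (simp add: gal_mult gal_power val_mult val_power)
    have "v (b ^ k * c) = of_nat k * v b + v c" using b c by (simp add: val_mult val_power)
    also have "\<dots> < 0" using b(3) c(3) k(1) by (simp add: add_neg_neg mult_pos_neg)
    finally show ?thesis using b c val[OF \<tau>(1)] val[OF A] k(2) 2
      by (intro bexI[of _ "b ^ k * c"]) auto
  next
    case 3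
    have add1: "1 + b ^ k \<noteq> 0" "v (1 + b ^ k) = of_nat k * v b"
    proof -
      have "v (b ^ k) < v 1" using b k(1) by (simp add: val_power mult_pos_neg)
      then have "b ^ k + 1 \<noteq> 0" "v (b ^ k + 1) = v (b ^ k)" using val_eq_of_add[of "b ^ k" 1] b by auto
      then show "1 + b ^ k \<noteq> 0" "v (1 + b ^ k) = of_nat k * v b" using b by (auto simp: add.commute val_power)
    qed
    \<comment> \<open>The fraction has valuation 0 wherever \<open>b\<close> is negative, that is at
      \<open>v\<close> and at \<open>\<tau>\<close>, and a large positive valuation on
      \<open>A\<close>; so it repairs \<open>c\<close> on \<open>A\<close> without disturbing it
      elsewhere.\<close>
    let ?y = "b ^ k / (1 + b ^ k) * c"
    have \<sigma>y: "\<sigma> ?y = \<sigma> b ^ k / (1 + \<sigma> b ^ k) * \<sigma> c" "1 + \<sigma> b ^ k \<noteq> 0" if "\<sigma> \<in> gal L" for \<sigma>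
    proof -
      have *: "\<sigma> (1 + b ^ k) = 1 + \<sigma> b ^ k" using that b by (simp add: gal_add gal_one gal_power)
      then show "1 + \<sigma> b ^ k \<noteq> 0" using gal_nonzero[OF that, of "1 + b ^ k"] b add1 by simp
      show "\<sigma> ?y = \<sigma> b ^ k / (1 + \<sigma> b ^ k) * \<sigma> c"
        using that b c * by (simp add: gal_mult gal_divide gal_power)
    qed
    have "v ?y = v c" using b c add1 by (simp add: val_mult val_divide val_power)
    moreover have "v (\<tau> ?y) = v (\<tau> c)"
    proof -
      have "v (\<tau> b ^ k) < v 1" using 3 nz[OF \<tau>(1)] k(1) by (simp add: val_power mult_pos_neg)
      then have "v (\<tau> b ^ k + 1) = v (\<tau> b ^ k)" using val_eq_of_add[of "\<tau> b ^ k" 1] nz[OF \<tau>(1)] by auto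
      then show ?thesis using \<sigma>y[OF \<tau>(1)] nz[OF \<tau>(1)] by (simp add: val_mult val_divide add.commute)
    qed
    moreover have "v (\<sigma> ?y) > 0" if "\<sigma> \<in> A" for \<sigma>
    proof -
      note \<sigma> = A[OF that]
      have "v (\<sigma> b ^ k) > v 1" using b(4)[OF that] nz[OF \<sigma>] k(1) by (simp add: val_power)
      then have "v (1 + \<sigma> b ^ k) = 0" using val_eq_of_add[of 1 "\<sigma> b ^ k"] by auto
      then have "v (\<sigma> ?y) = of_nat k * v (\<sigma> b) + v (\<sigma> c)"
        using \<sigma>y[OF \<sigma>] nz[OF \<sigma>] by (simp add: val_mult val_divide val_power)
      then show ?thesis using k(2)[OF that] by simp
    qed
    ultimately show ?thesis using b c add1 by (intro bexI[of _ ?y]) auto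
  qed
qed

text \<open>For the separating element \<open>b\<close>, the quotient \<open>b / (1 + b)\<close> is
  congruent to 1 at \<open>v\<close> and has positive valuation at the other conjugates; a high
  power keeps the first property and makes the second as strong as desired.\<close>

lemma exists_approx:
  fixes N :: rat
  obtains a where "a \<in> L" "a - 1 \<in> maximal" "\<And>\<sigma>. \<sigma> \<in> gal L \<Longrightarrow> \<sigma> \<notin> decomposition \<Longrightarrow> v (\<sigma> a) > N"
proof -
  obtain b where b: "b \<in> L" "b \<noteq> 0" "v b < 0" "\<And>\<sigma>. \<sigma> \<in> gal L \<Longrightarrow> \<sigma> \<notin> decomposition \<Longrightarrow> v (\<sigma> b) > 0"
    using exists_separating_all[of "gal L - decomposition"] finite_gal[OF galois] by auto
  have b1: "1 + b \<noteq> 0" "v (1 + b) = v b"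
    using val_eq_of_add[of b 1] b by (auto simp: add.commute)
  define y where "y = b / (1 + b)"
  have y: "y \<in> L" "y \<noteq> 0" "y - 1 \<in> maximal" "y \<in> integers"
  proof -
    have "y - 1 = - inverse (1 + b)" using b1 by (simp add: y_def field_simps)
    moreover have "inverse (1 + b) \<in> maximal" using b1 b by (simp add: maximal_def val_inverse)
    ultimately show m: "y - 1 \<in> maximal" by (simp add: maximal_minus)
    show "y \<in> integers" using integers_add[OF maximal_subset[OF m] integers_one] by simp
  qed (use b b1 in \<open>simp_all add: y_def\<close>)
  have yd: "v (\<sigma> y) > 0" if \<sigma>: "\<sigma> \<in> gal L" "\<sigma> \<notin> decomposition" for \<sigma>
  proof -
    have nz: "\<sigma> b \<noteq> 0" using gal_nonzero \<sigma>(1) b by auto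
    have "1 + \<sigma> b \<noteq> 0" "v (1 + \<sigma> b) = 0" using val_eq_of_add[of 1 "\<sigma> b"] b(4)[OF \<sigma>] by auto
    moreover have "\<sigma> y = \<sigma> b / (1 + \<sigma> b)" using \<sigma>(1) b by (simp add: y_def gal_divide gal_add gal_one)
    ultimately show ?thesis using b(4)[OF \<sigma>] nz by (simp add: val_divide)
  qed
  have "\<exists>k::nat. of_nat k * v (\<sigma> y) > N" if "\<sigma> \<in> gal L - decomposition" for \<sigma>
    using yd that ex_less_of_nat_mult by blast
  then obtain k :: "_ \<Rightarrow> nat" where k: "\<And>\<sigma>. \<sigma> \<in> gal L - decomposition \<Longrightarrow> of_nat (k \<sigma>) * v (\<sigma> y) > N" by metis
  \<comment> \<open>The 0 keeps \<open>Max\<close> meaningful if every automorphism preserves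
    \<open>v\<close>.\<close>
  define K where "K = Max (insert 0 (k ` (gal L - decomposition)))"
  show ?thesis
  proof (rule that[of "y ^ K"])
    show "y ^ K - 1 \<in> maximal" using maximal_power_diff[OF y(3,4) integers_one, of K] by simp
    fix \<sigma> assume \<sigma>: "\<sigma> \<in> gal L" "\<sigma> \<notin> decomposition"
    have "k \<sigma> \<le> K" unfolding K_def using finite_gal[OF galois] \<sigma> by simp
    then have "of_nat (k \<sigma>) * v (\<sigma> y) \<le> of_nat K * v (\<sigma> y)"
      using yd[OF \<sigma>] by (intro mult_right_mono) auto
    moreover have "v (\<sigma> (y ^ K)) = of_nat K * v (\<sigma> y)"
      using gal_nonzero[OF \<sigma>(1) y(1,2)] \<sigma>(1) y by (simp add: gal_power val_power)
    ultimately show "v (\<sigma> (y ^ K)) > N" using k[of \<sigma>] \<sigma> by simp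
  qed (use y in simp)
qed

end

section \<open>The residue field and traces\<close>

context tame_galois
begin

lemma decomposition_inv:
  assumes \<sigma>: "\<sigma> \<in> decomposition"
  obtains \<tau> where "\<tau> \<in> decomposition" "\<And>x. x \<in> L \<Longrightarrow> \<tau> (\<sigma> x) = x" "\<And>x. x \<in> L \<Longrightarrow> \<sigma> (\<tau> x) = x"
proof -
  obtain \<tau> where \<tau>: "\<tau> \<in> gal L" "\<And>x. x \<in> L \<Longrightarrow> \<tau> (\<sigma> x) = x" "\<And>x. x \<in> L \<Longrightarrow> \<sigma> (\<tau> x) = x"
    using gal_inv[OF decomposition_gal[OF \<sigma>]] by blast
  have "v (\<tau> x) = v x" if "x \<in> L" "x \<noteq> 0" for x
    using val_decomposition[OF \<sigma> gal_closed[OF \<tau>(1) that(1)] gal_nonzero[OF \<tau>(1) that]] \<tau>(3)[OF that(1)] by simp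
  then have "\<tau> \<in> decomposition" using \<tau>(1) by (simp add: decomposition_def)
  then show ?thesis using that \<tau> by blast
qed

lemma decomposition_compose:
  assumes "\<sigma> \<in> decomposition" "\<tau> \<in> decomposition" shows "compose L \<sigma> \<tau> \<in> decomposition"
proof -
  note g = decomposition_gal[OF assms(1)] decomposition_gal[OF assms(2)]
  have "v (\<sigma> (\<tau> x)) = v x" if "x \<in> L" "x \<noteq> 0" for x
    using val_decomposition[OF assms(1) gal_closed[OF g(2) that(1)] gal_nonzero[OF g(2) that]]
      val_decomposition[OF assms(2) that] by simp
  then show ?thesis using gal_compose[OF g] by (simp add: decomposition_def)
qed

lemma decomposition_id: "(\<lambda>x\<in>L. x) \<in> decomposition"
  using gal_id by (simp add: decomposition_def)

lemma inertiaI: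
  assumes "\<sigma> \<in> gal L" "\<And>x. x \<in> L \<Longrightarrow> x \<in> integers \<Longrightarrow> \<sigma> x - x \<in> maximal"
  shows "\<sigma> \<in> inertia v L"
  unfolding inertia_def mem_Collect_eq
proof (intro conjI ballI impI)
  fix x assume "x \<in> L" "x = 0 \<or> v x \<ge> 0"
  then have "\<sigma> x - x \<in> maximal" using assms(2) by (simp add: integers_def)
  then show "\<sigma> x = x \<or> v (\<sigma> x - x) > 0" by (simp add: maximal_def)
qed (rule assms)

text \<open>Dedekind's independence of characters, for automorphisms of the residue field of \<open>L\<close>.\<close>

lemma dedekind_residue:
  assumes "finite T" "T \<subseteq> decomposition"
    and "\<And>\<sigma> \<tau>. \<sigma> \<in> T \<Longrightarrow> \<tau> \<in> T \<Longrightarrow> \<sigma> \<noteq> \<tau> \<Longrightarrow> \<exists>y\<in>L. y \<in> integers \<and> \<sigma> y - \<tau> y \<notin> maximal"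
    and "\<And>\<sigma>. \<sigma> \<in> T \<Longrightarrow> c \<sigma> \<in> integers"
    and "\<And>w. w \<in> L \<Longrightarrow> w \<in> integers \<Longrightarrow> (\<Sum>\<sigma>\<in>T. c \<sigma> * \<sigma> w) \<in> maximal"
  shows "\<forall>\<sigma>\<in>T. c \<sigma> \<in> maximal"
  using assms
proof (induction T arbitrary: c rule: finite_induct)
  case (insert \<tau> T)
  have \<tau>: "\<tau> \<in> decomposition" and T: "\<And>\<sigma>. \<sigma> \<in> T \<Longrightarrow> \<sigma> \<in> decomposition" using insert.prems(1) by auto
  have cT: "c \<sigma> \<in> maximal" if \<sigma>: "\<sigma> \<in> T" for \<sigma>
  proof -
    have "\<sigma> \<noteq> \<tau>" using insert.hyps \<sigma> by auto
    then obtain y where y: "y \<in> L" "y \<in> integers" "\<sigma> y - \<tau> y \<notin> maximal"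
      using insert.prems(2)[of \<sigma> \<tau>] \<sigma> by auto
    have yi: "\<rho> y \<in> integers" if "\<rho> \<in> insert \<tau> T" for \<rho>
      using decomposition_integers y that \<tau> T by blast
    \<comment> \<open>Replacing \<open>w\<close> by \<open>y * w\<close> and subtracting
      \<open>\<tau> y\<close> times the old relation removes the term of \<open>\<tau>\<close>;
      \<open>y\<close> is chosen so that the coefficient of \<open>\<sigma>\<close> is only
      multiplied by a unit.\<close>
    define c' where "c' = (\<lambda>\<rho>. c \<rho> * (\<rho> y - \<tau> y))"
    have "\<forall>\<rho>\<in>T. c' \<rho> \<in> maximal"
    proof (rule insert.IH)
      show "T \<subseteq> decomposition" using T by blast
      show "\<exists>y\<in>L. y \<in> integers \<and> \<sigma> y - \<tau> y \<notin> maximal" if "\<sigma> \<in> T" "\<tau> \<in> T" "\<sigma> \<noteq> \<tau>" for \<sigma> \<tau>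
        using insert.prems(2) that by blast
      show "c' \<rho> \<in> integers" if "\<rho> \<in> T" for \<rho>
        unfolding c'_def by (intro integers_mult integers_diff yi insert.prems(3)) (use that in auto)
      fix w assume w: "w \<in> L" "w \<in> integers"
      have "(\<Sum>\<rho>\<in>insert \<tau> T. c \<rho> * \<rho> (y * w)) - \<tau> y * (\<Sum>\<rho>\<in>insert \<tau> T. c \<rho> * \<rho> w) =
        (\<Sum>\<rho>\<in>insert \<tau> T. c \<rho> * \<rho> (y * w) - \<tau> y * (c \<rho> * \<rho> w))"
        by (simp only: sum_distrib_left sum_subtractf)
      also have "\<dots> = (\<Sum>\<rho>\<in>insert \<tau> T. c' \<rho> * \<rho> w)"
      proof (rule sum.cong[OF refl])
        fix \<rho> assume "\<rho> \<in> insert \<tau> T"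
        then have "\<rho> \<in> gal L" using decomposition_gal T \<tau> by blast
        then have "\<rho> (y * w) = \<rho> y * \<rho> w" using y w by (simp add: gal_mult)
        then show "c \<rho> * \<rho> (y * w) - \<tau> y * (c \<rho> * \<rho> w) = c' \<rho> * \<rho> w" by (simp add: c'_def algebra_simps)
      qed
      also have "\<dots> = (\<Sum>\<rho>\<in>T. c' \<rho> * \<rho> w)" using insert.hyps by (simp add: c'_def)
      finally have eq: "(\<Sum>\<rho>\<in>T. c' \<rho> * \<rho> w) =
        (\<Sum>\<rho>\<in>insert \<tau> T. c \<rho> * \<rho> (y * w)) - \<tau> y * (\<Sum>\<rho>\<in>insert \<tau> T. c \<rho> * \<rho> w)" by simp
      show "(\<Sum>\<rho>\<in>T. c' \<rho> * \<rho> w) \<in> maximal" unfolding eq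
      proof (rule maximal_diff)
        show "(\<Sum>\<rho>\<in>insert \<tau> T. c \<rho> * \<rho> (y * w)) \<in> maximal"
          using y w integers_mult by (intro insert.prems(4)) simp_all
        show "\<tau> y * (\<Sum>\<rho>\<in>insert \<tau> T. c \<rho> * \<rho> w) \<in> maximal"
          using maximal_mult[OF yi[of \<tau>] insert.prems(4)[OF w]] by simp
      qed
    qed
    then have "c \<sigma> * (\<sigma> y - \<tau> y) \<in> maximal" using \<sigma> by (simp add: c'_def)
    moreover have "c \<sigma> \<in> integers" using insert.prems(3) \<sigma> by blast
    moreover have "\<sigma> y - \<tau> y \<in> integers" using yi \<sigma> by (intro integers_diff) auto
    ultimately show ?thesis using maximal_prime y(3) by blast
  qed
  \<comment> \<open>All other coefficients vanish in the residue field by now, so the relation at 1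
    leaves the coefficient of \<open>\<tau>\<close>.\<close>
  have "(\<Sum>\<sigma>\<in>insert \<tau> T. c \<sigma> * \<sigma> 1) \<in> maximal" using insert.prems(4)[of 1] by simp
  moreover have "(\<Sum>\<sigma>\<in>insert \<tau> T. c \<sigma> * \<sigma> 1) = c \<tau> + (\<Sum>\<sigma>\<in>T. c \<sigma>)"
  proof -
    have "(\<Sum>\<sigma>\<in>T. c \<sigma> * \<sigma> 1) = (\<Sum>\<sigma>\<in>T. c \<sigma>)"
      by (rule sum.cong[OF refl]) (simp add: gal_one[OF decomposition_gal[OF T]])
    then show ?thesis using insert.hyps gal_one[OF decomposition_gal[OF \<tau>]] by simp
  qed
  moreover have "(\<Sum>\<sigma>\<in>T. c \<sigma>) \<in> maximal" using cT by (rule maximal_sum)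
  ultimately have "c \<tau> \<in> maximal" using maximal_diff[of "c \<tau> + (\<Sum>\<sigma>\<in>T. c \<sigma>)" "\<Sum>\<sigma>\<in>T. c \<sigma>"] by simp
  then show ?case using cT by blast
qed simp

abbreviation ram :: nat where "ram \<equiv> card (inertia v L)"

lemma of_nat_ram: "v (of_nat ram) = 0" "of_nat ram \<noteq> (0 :: 'k alg_closure)"
  using tame val_of_nat[of ram] by (auto simp: tame_def intro: Nat.gr0I)

text \<open>
  The fixed field of inertia is unramified over \<open>K\<close>: for suitable \<open>a\<close> and \<open>w\<close> the trace of
  \<open>a * w * x\<close> from \<open>L\<close> to \<open>K\<close> has the same valuation as \<open>x\<close>.
\<close>

lemma val_inertia_fixed:
  assumes x: "x \<in> L" "x \<noteq> 0" and fx: "\<And>\<sigma>. \<sigma> \<in> inertia v L \<Longrightarrow> \<sigma> x = x"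
  shows "v x \<in> \<int>"
proof -
  let ?D = decomposition
  have finG: "finite (gal L)" by (rule finite_gal[OF galois])
  have finD: "finite ?D" by (rule finite_subset[OF _ finG]) (auto simp: decomposition_def)
  \<comment> \<open>For elements of the decomposition group: inducing the same automorphism of the
    residue field of \<open>L\<close>. The classes are the cosets of inertia.\<close>
  define eqv where "eqv = (\<lambda>\<sigma> \<tau>. \<forall>y\<in>L. y \<in> integers \<longrightarrow> \<sigma> y - \<tau> y \<in> maximal)"
  have eqv_refl: "eqv \<sigma> \<sigma>" for \<sigma> by (simp add: eqv_def)
  have eqv_sym: "eqv \<sigma> \<tau> \<Longrightarrow> eqv \<tau> \<sigma>" for \<sigma> \<tau> by (simp add: eqv_def maximal_diff_commute)
  have eqv_trans: "eqv \<sigma> \<tau> \<Longrightarrow> eqv \<tau> \<rho> \<Longrightarrow> eqv \<sigma> \<rho>" for \<sigma> \<tau> \<rho>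
    unfolding eqv_def using maximal_diff_trans by blast
  define rep where "rep = (\<lambda>\<sigma>. SOME \<tau>. \<tau> \<in> ?D \<and> eqv \<tau> \<sigma>)"
  have rep: "rep \<sigma> \<in> ?D" "eqv (rep \<sigma>) \<sigma>" if "\<sigma> \<in> ?D" for \<sigma>
  proof -
    have "rep \<sigma> \<in> ?D \<and> eqv (rep \<sigma>) \<sigma>" unfolding rep_def
      by (rule someI[of "\<lambda>\<tau>. \<tau> \<in> ?D \<and> eqv \<tau> \<sigma>" \<sigma>]) (use that eqv_refl in simp)
    then show "rep \<sigma> \<in> ?D" "eqv (rep \<sigma>) \<sigma>" by auto
  qed
  have rep_eq: "rep \<sigma> = rep \<tau>" if "eqv \<sigma> \<tau>" for \<sigma> \<tau>
  proof -
    have "(\<lambda>\<rho>. \<rho> \<in> ?D \<and> eqv \<rho> \<sigma>) = (\<lambda>\<rho>. \<rho> \<in> ?D \<and> eqv \<rho> \<tau>)" using that eqv_sym eqv_trans by blast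
    then show ?thesis by (simp add: rep_def)
  qed
  define T where "T = rep ` ?D"
  have TD: "T \<subseteq> ?D" using rep by (auto simp: T_def)
  have repT: "rep \<tau> = \<tau>" if "\<tau> \<in> T" for \<tau> using that rep rep_eq by (auto simp: T_def)
  have fibre: "{\<sigma> \<in> ?D. rep \<sigma> = \<tau>} = (\<lambda>\<rho>. compose L \<tau> \<rho>) ` inertia v L" if \<tau>T: "\<tau> \<in> T" for \<tau>
  proof (intro equalityI subsetI)
    fix \<sigma> assume "\<sigma> \<in> {\<sigma> \<in> ?D. rep \<sigma> = \<tau>}"
    then have \<sigma>: "\<sigma> \<in> ?D" "eqv \<sigma> \<tau>" using rep eqv_sym by auto
    obtain \<tau>' where \<tau>': "\<tau>' \<in> ?D" "\<And>x. x \<in> L \<Longrightarrow> \<tau>' (\<tau> x) = x" "\<And>x. x \<in> L \<Longrightarrow> \<tau> (\<tau>' x) = x"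
      using decomposition_inv TD \<tau>T by blast
    note g = decomposition_gal[OF \<sigma>(1)] decomposition_gal[OF \<tau>'(1)]
    have \<tau>g: "\<tau> \<in> gal L" using TD \<tau>T decomposition_gal by blast
    have "compose L \<tau>' \<sigma> \<in> inertia v L"
    proof (rule inertiaI[OF gal_compose[OF g(2,1)]])
      fix y assume y: "y \<in> L" "y \<in> integers"
      have "\<sigma> y - \<tau> y \<in> maximal" using \<sigma>(2) y by (simp add: eqv_def)
      then have "\<tau>' (\<sigma> y - \<tau> y) \<in> maximal"
        using y gal_closed g \<tau>g by (intro decomposition_maximal[OF \<tau>'(1)]) auto
      then show "compose L \<tau>' \<sigma> y - y \<in> maximal"
        using y gal_closed[OF g(1) y(1)] gal_closed[OF \<tau>g y(1)] \<tau>'(2) by (simp add: gal_diff[OF g(2)])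
    qed
    moreover have "\<sigma> = compose L \<tau> (compose L \<tau>' \<sigma>)"
      by (rule gal_eqI[OF g(1) gal_compose[OF \<tau>g gal_compose[OF g(2,1)]]])
         (use \<tau>'(3) gal_closed g in simp)
    ultimately show "\<sigma> \<in> (\<lambda>\<rho>. compose L \<tau> \<rho>) ` inertia v L" by blast
  next
    fix \<sigma> assume "\<sigma> \<in> (\<lambda>\<rho>. compose L \<tau> \<rho>) ` inertia v L"
    then obtain \<rho> where \<rho>: "\<rho> \<in> inertia v L" "\<sigma> = compose L \<tau> \<rho>" by blast
    have \<tau>D: "\<tau> \<in> ?D" using TD \<tau>T by blast
    then have D: "\<sigma> \<in> ?D" using decomposition_compose inertia_decomposition \<rho> by blast
    have "eqv \<sigma> \<tau>"
      unfolding eqv_def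
    proof (intro ballI impI)
      fix y assume y: "y \<in> L" "y \<in> integers"
      have "\<tau> (\<rho> y - y) \<in> maximal"
        using y gal_closed[OF inertia_gal[OF \<rho>(1)]] inertia_maximal[OF \<rho>(1)]
        by (intro decomposition_maximal[OF \<tau>D]) auto
      then show "\<sigma> y - \<tau> y \<in> maximal"
        using y gal_closed[OF inertia_gal[OF \<rho>(1)]] by (simp add: \<rho>(2) gal_diff[OF decomposition_gal[OF \<tau>D]])
    qed
    then show "\<sigma> \<in> {\<sigma> \<in> ?D. rep \<sigma> = \<tau>}" using D rep_eq repT[OF \<tau>T] by simp
  qed
  have inj: "inj_on (\<lambda>\<rho>. compose L \<tau> \<rho>) (inertia v L)" if \<tau>T: "\<tau> \<in> T" for \<tau>
  proof (rule inj_onI)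
    fix \<rho> \<rho>' assume r: "\<rho> \<in> inertia v L" "\<rho>' \<in> inertia v L" "compose L \<tau> \<rho> = compose L \<tau> \<rho>'"
    have \<tau>g: "\<tau> \<in> gal L" using TD \<tau>T decomposition_gal by blast
    show "\<rho> = \<rho>'"
    proof (rule gal_eqI[OF inertia_gal[OF r(1)] inertia_gal[OF r(2)]])
      fix x assume x: "x \<in> L"
      then have "\<tau> (\<rho> x) = \<tau> (\<rho>' x)" using fun_cong[OF r(3), of x] by simp
      then show "\<rho> x = \<rho>' x" using gal_inj[OF \<tau>g] gal_closed inertia_gal r x by blast
    qed
  qed
  \<comment> \<open>These ratios are units on the decomposition group, and constant on cosets of
    inertia because inertia fixes \<open>x\<close>.\<close>
  define c where "c = (\<lambda>\<sigma>. \<sigma> x / x)"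
  have c_unit: "c \<sigma> \<in> integers" "c \<sigma> \<notin> maximal" if "\<sigma> \<in> ?D" for \<sigma>
    using that x gal_nonzero[OF decomposition_gal[OF that] x] val_decomposition[OF that x]
    by (auto simp: c_def integers_def maximal_def val_divide)
  \<comment> \<open>Representatives of distinct cosets act differently on the residue field, so by
    independence a combination of them with unit coefficients cannot vanish there
    identically.\<close>
  have "\<exists>w\<in>L. w \<in> integers \<and> (\<Sum>\<tau>\<in>T. c \<tau> * \<tau> w) \<notin> maximal"
  proof (rule ccontr)
    assume "\<not> ?thesis"
    then have a: "\<And>w. w \<in> L \<Longrightarrow> w \<in> integers \<Longrightarrow> (\<Sum>\<tau>\<in>T. c \<tau> * \<tau> w) \<in> maximal" by blast
    have "\<forall>\<tau>\<in>T. c \<tau> \<in> maximal"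
    proof (rule dedekind_residue[OF _ TD _ _ a])
      show "finite T" using finD by (simp add: T_def)
      show "c \<tau> \<in> integers" if "\<tau> \<in> T" for \<tau> using c_unit(1) TD that by blast
      fix \<sigma> \<tau> assume st: "\<sigma> \<in> T" "\<tau> \<in> T" "\<sigma> \<noteq> \<tau>"
      have "\<not> eqv \<sigma> \<tau>" using rep_eq repT st by metis
      then show "\<exists>y\<in>L. y \<in> integers \<and> \<sigma> y - \<tau> y \<notin> maximal" by (auto simp: eqv_def)
    qed
    moreover have "rep (\<lambda>x\<in>L. x) \<in> T" using decomposition_id by (simp add: T_def)
    ultimately show False using c_unit(2) TD by blast
  qed
  then obtain w where w: "w \<in> L" "w \<in> integers" "(\<Sum>\<tau>\<in>T. c \<tau> * \<tau> w) \<notin> maximal" by blast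
  have w0: "w \<noteq> 0"
  proof
    assume "w = 0"
    then have "(\<Sum>\<tau>\<in>T. c \<tau> * \<tau> w) = 0" using TD gal_zero decomposition_gal by (intro sum.neutral) auto
    then show False using w(3) by simp
  qed
  have wx: "w * x \<in> L" "w * x \<noteq> 0" using w x w0 by auto
  \<comment> \<open>If \<open>\<sigma> a\<close> has valuation above \<open>B\<close>, then the
    trace term of \<open>\<sigma>\<close> divided by \<open>x\<close> lies in
    \<open>maximal\<close>; this disposes of all terms outside the decomposition group.\<close>
  define B where "B = Max (insert 0 ((\<lambda>\<sigma>. v x - v (\<sigma> (w * x))) ` gal L))"
  have B: "v x - v (\<sigma> (w * x)) \<le> B" if "\<sigma> \<in> gal L" for \<sigma>
    unfolding B_def using finG that by (intro Max_ge) auto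
  obtain a where a: "a \<in> L" "a - 1 \<in> maximal" "\<And>\<sigma>. \<sigma> \<in> gal L \<Longrightarrow> \<sigma> \<notin> ?D \<Longrightarrow> v (\<sigma> a) > B"
    using exists_approx by blast
  have a0: "a \<noteq> 0"
  proof
    assume "a = 0"
    then have "- (a - 1) \<notin> maximal" by simp
    then show False using maximal_minus[OF a(2)] by blast
  qed
  define tr where "tr = (\<Sum>\<sigma>\<in>gal L. \<sigma> (a * (w * x)))"
  have awx: "a * (w * x) \<in> L" using a wx by simp
  have trL: "tr \<in> L" unfolding tr_def using gal_closed awx by (intro L_sum) auto
  have "tr \<in> range to_ac"
  proof (rule fixed_in_base[OF trL])
    fix \<sigma> assume \<sigma>: "\<sigma> \<in> gal L"
    have bij: "bij_betw (compose L \<sigma>) (gal L) (gal L)"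
      unfolding bij_betw_def
    proof
      show i: "inj_on (compose L \<sigma>) (gal L)"
      proof (rule inj_onI)
        fix \<rho> \<rho>' assume r: "\<rho> \<in> gal L" "\<rho>' \<in> gal L" "compose L \<sigma> \<rho> = compose L \<sigma> \<rho>'"
        show "\<rho> = \<rho>'"
        proof (rule gal_eqI[OF r(1,2)])
          fix x assume x: "x \<in> L"
          then have "\<sigma> (\<rho> x) = \<sigma> (\<rho>' x)" using fun_cong[OF r(3), of x] by simp
          then show "\<rho> x = \<rho>' x" using gal_inj[OF \<sigma>] gal_closed r x by blast
        qed
      qed
      show "compose L \<sigma> ` gal L = gal L"
        using gal_compose[OF \<sigma>] finG i by (intro endo_inj_surj) auto
    qed
    have "\<sigma> tr = (\<Sum>\<rho>\<in>gal L. \<sigma> (\<rho> (a * (w * x))))"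
      unfolding tr_def using gal_closed awx by (intro gal_sum[OF \<sigma>]) auto
    also have "\<dots> = (\<Sum>\<rho>\<in>gal L. compose L \<sigma> \<rho> (a * (w * x)))" using awx by simp
    also have "\<dots> = tr" unfolding tr_def by (rule sum.reindex_bij_betw[OF bij])
    finally show "\<sigma> tr = tr" .
  qed
  have \<sigma>awx: "\<sigma> (a * (w * x)) / x = \<sigma> a * (\<sigma> w * c \<sigma>)" if "\<sigma> \<in> gal L" for \<sigma>
    using that a w x by (simp add: gal_mult c_def)
  let ?S = "\<Sum>\<tau>\<in>T. c \<tau> * \<tau> w"
  \<comment> \<open>On the decomposition group \<open>a\<close> may be replaced by 1, and then the
    term depends only on the coset of inertia. Each coset occurs \<open>ram\<close> times, and
    \<open>ram\<close> is a unit by tameness, so the trace divided by \<open>x\<close> is a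
    unit.\<close>
  have cong: "tr / x - of_nat ram * ?S \<in> maximal"
  proof -
    have e1: "tr / x = (\<Sum>\<sigma>\<in>?D. \<sigma> (a * (w * x)) / x) + (\<Sum>\<sigma>\<in>gal L - ?D. \<sigma> (a * (w * x)) / x)"
      unfolding tr_def sum_divide_distrib
      using sum.subset_diff[of ?D "gal L"] finG by (simp add: decomposition_gal subset_iff add.commute)
    have m1: "(\<Sum>\<sigma>\<in>gal L - ?D. \<sigma> (a * (w * x)) / x) \<in> maximal"
    proof (rule maximal_sum)
      fix \<sigma> assume "\<sigma> \<in> gal L - ?D"
      then have \<sigma>: "\<sigma> \<in> gal L" "\<sigma> \<notin> ?D" by auto
      have "v (\<sigma> (a * (w * x)) / x) = v (\<sigma> a) + v (\<sigma> (w * x)) - v x"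
        using \<sigma>(1) a(1) a0 wx x gal_nonzero[OF \<sigma>(1)] by (simp add: gal_mult[OF \<sigma>(1) a(1) wx(1)] val_divide val_mult)
      also have "\<dots> > 0" using a(3)[OF \<sigma>] B[OF \<sigma>(1)] by simp
      finally show "\<sigma> (a * (w * x)) / x \<in> maximal" by (simp add: maximal_def)
    qed
    have m2: "(\<Sum>\<sigma>\<in>?D. \<sigma> (a * (w * x)) / x) - (\<Sum>\<sigma>\<in>?D. c (rep \<sigma>) * rep \<sigma> w) \<in> maximal"
      unfolding sum_subtractf[symmetric]
    proof (rule maximal_sum)
      fix \<sigma> assume \<sigma>: "\<sigma> \<in> ?D"
      note g = decomposition_gal[OF \<sigma>]
      have T: "rep \<sigma> \<in> T" using \<sigma> by (simp add: T_def)
      then obtain \<rho> where \<rho>: "\<rho> \<in> inertia v L" "\<sigma> = compose L (rep \<sigma>) \<rho>" using fibre \<sigma> by blast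
      have c_eq: "c \<sigma> = c (rep \<sigma>)" using fun_cong[OF \<rho>(2), of x] x fx[OF \<rho>(1)] by (simp add: c_def)
      have 1: "\<sigma> a - 1 \<in> maximal"
        using decomposition_maximal[OF \<sigma> _ a(2)] a(1) by (simp add: gal_diff[OF g] gal_one[OF g])
      have 2: "\<sigma> w * c \<sigma> - rep \<sigma> w * c \<sigma> \<in> maximal"
        unfolding left_diff_distrib[symmetric]
        by (intro maximal_mult' c_unit \<sigma>) (use rep(2)[OF \<sigma>] eqv_sym w in \<open>auto simp: eqv_def maximal_diff_commute\<close>)
      have i: "rep \<sigma> w * c \<sigma> \<in> integers" "\<sigma> a \<in> integers"
        using c_unit \<sigma> decomposition_integers rep(1)[OF \<sigma>] w integers_mult
          integers_add[OF maximal_subset[OF 1] integers_one] by auto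
      have "\<sigma> a * (\<sigma> w * c \<sigma>) - 1 * (rep \<sigma> w * c \<sigma>) \<in> maximal"
        by (rule maximal_mult_diff[OF 1 2 i(2,1)])
      then show "\<sigma> (a * (w * x)) / x - c (rep \<sigma>) * rep \<sigma> w \<in> maximal"
        using \<sigma>awx[OF g] c_eq by (simp add: mult.commute)
    qed
    have e2: "(\<Sum>\<sigma>\<in>?D. c (rep \<sigma>) * rep \<sigma> w) = of_nat ram * ?S"
    proof -
      have "(\<Sum>\<sigma>\<in>?D. c (rep \<sigma>) * rep \<sigma> w) = (\<Sum>\<tau>\<in>T. \<Sum>\<sigma>\<in>{\<sigma> \<in> ?D. rep \<sigma> = \<tau>}. c (rep \<sigma>) * rep \<sigma> w)"
        unfolding T_def by (rule sum.image_gen[OF finD])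
      also have "\<dots> = (\<Sum>\<tau>\<in>T. of_nat ram * (c \<tau> * \<tau> w))"
      proof (rule sum.cong[OF refl])
        fix \<tau> assume \<tau>: "\<tau> \<in> T"
        have "(\<Sum>\<sigma>\<in>{\<sigma> \<in> ?D. rep \<sigma> = \<tau>}. c (rep \<sigma>) * rep \<sigma> w) = (\<Sum>\<sigma>\<in>{\<sigma> \<in> ?D. rep \<sigma> = \<tau>}. c \<tau> * \<tau> w)"
          by (rule sum.cong) auto
        also have "\<dots> = of_nat (card {\<sigma> \<in> ?D. rep \<sigma> = \<tau>}) * (c \<tau> * \<tau> w)" by simp
        also have "card {\<sigma> \<in> ?D. rep \<sigma> = \<tau>} = ram" unfolding fibre[OF \<tau>] by (rule card_image[OF inj[OF \<tau>]])
        finally show "(\<Sum>\<sigma>\<in>{\<sigma> \<in> ?D. rep \<sigma> = \<tau>}. c (rep \<sigma>) * rep \<sigma> w) = of_nat ram * (c \<tau> * \<tau> w)" .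
      qed
      finally show ?thesis by (simp add: sum_distrib_left)
    qed
    show ?thesis using maximal_add[OF m2 m1] unfolding e1 e2 by (simp only: diff_add_eq)
  qed
  have S: "of_nat ram * ?S \<in> integers" "of_nat ram * ?S \<notin> maximal"
  proof -
    have r: "of_nat ram \<in> integers" "(of_nat ram :: 'k alg_closure) \<notin> maximal"
      using of_nat_ram by (auto simp: integers_def maximal_def)
    have S: "?S \<in> integers"
    proof (rule integers_sum)
      fix \<tau> assume "\<tau> \<in> T"
      then have "\<tau> \<in> ?D" using TD by blast
      then show "c \<tau> * \<tau> w \<in> integers" using integers_mult c_unit(1) decomposition_integers w(1,2) by blast
    qed
    show "of_nat ram * ?S \<in> integers" using r S integers_mult by blast
    show "of_nat ram * ?S \<notin> maximal" using maximal_prime[OF _ r(1) S] r(2) w(3) by blast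
  qed
  have "tr / x \<in> integers" using integers_add[OF maximal_subset[OF cong] S(1)] by simp
  moreover have "tr / x \<notin> maximal"
  proof
    assume "tr / x \<in> maximal"
    then have "tr / x - (tr / x - of_nat ram * ?S) \<in> maximal" using cong by (rule maximal_diff)
    then show False using S(2) by simp
  qed
  ultimately have "tr / x \<noteq> 0" "v (tr / x) = 0" using unit_iff by blast+
  then have "tr \<noteq> 0" "v tr = v x" using x val_divide[of tr x] by auto
  then show ?thesis using val_base_int[OF \<open>tr \<in> range to_ac\<close>] by simp
qed

end

section \<open>Tame inertia is cyclic\<close>

text \<open>The classical count: an element of order \<open>d\<close> has \<open>d\<close> powers,
  which must be all solutions of \<open>x [^] d = \<one>\<close>, so there are at most
  \<open>totient d\<close> elements of order \<open>d\<close>. As the totients of the divisors of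
  the group order add up to it, some element has full order.\<close>

lemma (in group) finite_cyclicI:
  assumes fin: "finite (carrier G)" and roots: "\<And>d. d > 0 \<Longrightarrow> card {x \<in> carrier G. x [^] (d::nat) = \<one>} \<le> d"
  obtains g where "finite_cyclic G g (card (carrier G))"
proof -
  let ?N = "card (carrier G)"
  have N: "?N > 0" using fin one_closed by (simp add: card_gt_0_iff) blast
  have card_ord: "card {x \<in> carrier G. ord x = d} \<le> totient d" if d: "d > 0" for d
  proof (cases "{x \<in> carrier G. ord x = d} = {}")
    case False
    then obtain a where a: "a \<in> carrier G" "ord a = d" by blast
    let ?P = "\<lambda>k::nat. a [^] k"
    have inj: "inj_on ?P {..<d}"
    proof (rule linorder_inj_onI)
      fix i j :: nat assume ij: "i < j" "i \<in> {..<d}" "j \<in> {..<d}"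
      show "?P i \<noteq> ?P j"
      proof
        assume "?P i = ?P j"
        moreover have "?P j = ?P i \<otimes> ?P (j - i)" using ij a by (simp add: nat_pow_mult)
        ultimately have "?P (j - i) = \<one>" using a by (metis l_cancel_one' nat_pow_closed)
        then have "d dvd j - i" using a pow_eq_id by blast
        then show False using ij by (auto dest: dvd_imp_le)
      qed
    qed auto
    have "?P ` {..<d} \<subseteq> {x \<in> carrier G. x [^] d = \<one>}"
    proof clarify
      fix k :: nat
      have "(a [^] k) [^] d = (a [^] d) [^] k" using a by (simp add: nat_pow_pow mult.commute)
      then show "a [^] k \<in> carrier G \<and> (a [^] k) [^] d = \<one>" using a pow_ord_eq_1[of a] by simp
    qed
    moreover have "finite {x \<in> carrier G. x [^] d = \<one>}" using fin by simp
    moreover have "card {x \<in> carrier G. x [^] d = \<one>} \<le> card (?P ` {..<d})"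
      using roots[OF d] by (simp add: card_image[OF inj])
    ultimately have eq: "?P ` {..<d} = {x \<in> carrier G. x [^] d = \<one>}"
      by (intro card_subset_eq) (auto intro: le_antisym card_mono)
    have "{x \<in> carrier G. ord x = d} \<subseteq> ?P ` totatives d"
    proof clarify
      fix x assume x: "x \<in> carrier G" "d = ord x"
      then have "x \<in> {x \<in> carrier G. x [^] d = \<one>}" using pow_ord_eq_1[of x] by simp
      then obtain k where k: "k < d" "x = ?P k" using eq by (metis (no_types, lifting) imageE lessThan_iff)
      show "x \<in> ?P ` totatives (ord x)"
      \<comment> \<open>The exponent 0 is not in \<open>totatives\<close>; then \<open>d = 1\<close>
        and the exponent 1 gives the same element.\<close>
      proof (cases "k = 0")
        case True
        then have "x = \<one>" using k by simp
        then have o: "ord x = 1" by simp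
        then have "a = \<one>" using a x(2) ord_eq_1 by simp
        then show ?thesis unfolding o using \<open>x = \<one>\<close> by (intro image_eqI[of _ _ 1]) simp_all
      next
        case False
        have "ord x = ord a div gcd (ord a) k" using ord_pow_gen[OF a(1), of k] False k(2) by presburger
        then have "d div gcd d k = d" using a(2) x(2) by metis
        then have "gcd d k = 1" by (rule div_gcd_eq_self[OF d])
        then have "coprime k d" by (metis coprime_iff_gcd_eq_1 gcd.commute)
        then show ?thesis using k False x by (intro image_eqI[of _ _ k]) (auto simp: in_totatives_iff)
      qed
    qed
    then have "card {x \<in> carrier G. ord x = d} \<le> card (?P ` totatives d)" by (intro card_mono) auto
    also have "\<dots> \<le> totient d" unfolding totient_def by (rule card_image_le) simp
    finally show ?thesis .
  next
    case True
    then show ?thesis by (simp only: card.empty)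
  qed
  have "\<exists>g\<in>carrier G. ord g = ?N"
  proof (rule ccontr)
    assume none: "\<not> ?thesis"
    have "ord x dvd ?N" if "x \<in> carrier G" for x
      using ord_dvd_group_order[OF that] by (simp add: Coset.order_def)
    then have U: "(\<Union>d\<in>{d. d dvd ?N}. {x \<in> carrier G. ord x = d}) = carrier G" by blast
    have "card (\<Union>d\<in>{d. d dvd ?N}. {x \<in> carrier G. ord x = d}) = (\<Sum>d | d dvd ?N. card {x \<in> carrier G. ord x = d})"
      by (rule card_UN_disjoint) (use N fin in auto)
    then have "?N = (\<Sum>d | d dvd ?N. card {x \<in> carrier G. ord x = d})" unfolding U .
    also have "\<dots> < (\<Sum>d | d dvd ?N. totient d)"
    proof (rule sum_strict_mono_ex1)
      show "finite {d. d dvd ?N}" using N by simp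
      show "\<forall>d\<in>{d. d dvd ?N}. card {x \<in> carrier G. ord x = d} \<le> totient d"
        using card_ord N by (auto intro: dvd_pos_nat)
      have "{x \<in> carrier G. ord x = ?N} = {}" using none by blast
      then have "card {x \<in> carrier G. ord x = ?N} = 0" by (simp only: card.empty)
      also have "0 < totient ?N" using N by simp
      finally show "\<exists>d\<in>{d. d dvd ?N}. card {x \<in> carrier G. ord x = d} < totient d"
        by (intro bexI[of _ ?N]) simp_all
    qed
    finally show False unfolding totient_divisor_sum by (rule less_irrefl[THEN notE])
  qed
  then obtain g where g: "g \<in> carrier G" "ord g = ?N" by blast
  have pow: "g [^] (k::nat) = \<one> \<longleftrightarrow> ?N dvd k" for k using pow_eq_id[OF g(1)] g(2) by simp
  have sub: "range (\<lambda>k::nat. g [^] k) \<subseteq> carrier G" using g by auto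
  have "inj_on (\<lambda>k::nat. g [^] k) {..<?N}"
  proof (rule linorder_inj_onI)
    fix i j :: nat assume ij: "i < j" "i \<in> {..<?N}" "j \<in> {..<?N}"
    show "g [^] i \<noteq> g [^] j"
    proof
      assume "g [^] i = g [^] j"
      moreover have "g [^] j = g [^] i \<otimes> g [^] (j - i)" using ij g by (simp add: nat_pow_mult)
      ultimately have "g [^] (j - i) = \<one>" using g by (metis l_cancel_one' nat_pow_closed)
      then show False using ij pow by (auto dest: dvd_imp_le)
    qed
  qed auto
  then have "card ((\<lambda>k::nat. g [^] k) ` {..<?N}) = ?N" by (simp add: card_image)
  then have "(\<lambda>k::nat. g [^] k) ` {..<?N} = carrier G" using sub fin by (intro card_subset_eq) auto
  then have "carrier G = range (\<lambda>k::nat. g [^] k)" using sub by blast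
  then have "finite_cyclic G g ?N" using g pow N by unfold_locales auto
  then show ?thesis by (rule that)
qed

section \<open>The tame character of inertia\<close>

context tame_galois
begin

abbreviation J where "J \<equiv> inertia_group v L"

lemma J_simps [simp]: "carrier J = inertia v L" "\<one>\<^bsub>J\<^esub> = (\<lambda>x\<in>L. x)"
  "\<sigma> \<in> inertia v L \<Longrightarrow> \<tau> \<in> inertia v L \<Longrightarrow> \<sigma> \<otimes>\<^bsub>J\<^esub> \<tau> = compose L \<sigma> \<tau>"
  by (auto simp: inertia_group_def BijGroup_def inertia_def gal_def)

lemma inertia_compose:
  assumes "\<sigma> \<in> inertia v L" "\<tau> \<in> inertia v L" shows "compose L \<sigma> \<tau> \<in> inertia v L"
proof (rule inertiaI)
  note g = inertia_gal[OF assms(1)] inertia_gal[OF assms(2)]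
  show "compose L \<sigma> \<tau> \<in> gal L" using g by (rule gal_compose)
  fix x assume x: "x \<in> L" "x \<in> integers"
  have "\<sigma> (\<tau> x) - \<tau> x \<in> maximal"
    using inertia_maximal[OF assms(1) gal_closed[OF g(2) x(1)] decomposition_integers[OF inertia_decomposition[OF assms(2)] x]] .
  then show "compose L \<sigma> \<tau> x - x \<in> maximal" using maximal_diff_trans inertia_maximal[OF assms(2) x] x by simp
qed

lemma inertia_id: "(\<lambda>x\<in>L. x) \<in> inertia v L"
  by (rule inertiaI[OF gal_id]) simp

lemma inertia_inv:
  assumes \<sigma>: "\<sigma> \<in> inertia v L"
  obtains \<tau> where "\<tau> \<in> inertia v L" "\<And>x. x \<in> L \<Longrightarrow> \<tau> (\<sigma> x) = x"
proof -
  obtain \<tau> where \<tau>: "\<tau> \<in> decomposition" "\<And>x. x \<in> L \<Longrightarrow> \<tau> (\<sigma> x) = x" "\<And>x. x \<in> L \<Longrightarrow> \<sigma> (\<tau> x) = x"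
    using decomposition_inv[OF inertia_decomposition[OF \<sigma>]] by blast
  have "\<tau> \<in> inertia v L"
  proof (rule inertiaI[OF decomposition_gal[OF \<tau>(1)]])
    fix x assume x: "x \<in> L" "x \<in> integers"
    have "\<sigma> (\<tau> x) - \<tau> x \<in> maximal"
      using inertia_maximal[OF \<sigma>] decomposition_integers[OF \<tau>(1) x] gal_closed[OF decomposition_gal[OF \<tau>(1)] x(1)] by blast
    then show "\<tau> x - x \<in> maximal" using \<tau>(3)[OF x(1)] maximal_diff_commute by simp
  qed
  then show ?thesis using that \<tau> by blast
qed

lemma group_J: "group J"
proof (rule groupI)
  fix x y z assume "x \<in> carrier J" "y \<in> carrier J" "z \<in> carrier J"
  then show "x \<otimes>\<^bsub>J\<^esub> y \<otimes>\<^bsub>J\<^esub> z = x \<otimes>\<^bsub>J\<^esub> (y \<otimes>\<^bsub>J\<^esub> z)"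
    using inertia_compose inertia_gal
    by (simp, intro gal_eqI gal_compose) (auto simp: gal_closed)
next
  fix x assume x: "x \<in> carrier J"
  then show "\<one>\<^bsub>J\<^esub> \<otimes>\<^bsub>J\<^esub> x = x"
    using inertia_gal inertia_id gal_id by (simp, intro gal_eqI gal_compose) (auto simp: gal_closed)
  obtain \<tau> where \<tau>: "\<tau> \<in> inertia v L" "\<And>y. y \<in> L \<Longrightarrow> \<tau> (x y) = y" using inertia_inv x by auto
  have "compose L \<tau> x = (\<lambda>x\<in>L. x)" using \<tau> by (auto simp: compose_def)
  then show "\<exists>y\<in>carrier J. y \<otimes>\<^bsub>J\<^esub> x = \<one>\<^bsub>J\<^esub>" using \<tau> x by auto
qed (use inertia_compose inertia_id in auto)

sublocale J: group "inertia_group v L" by (rule group_J)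

lemma J_pow: "\<sigma> \<in> inertia v L \<Longrightarrow> \<sigma> [^]\<^bsub>J\<^esub> (k::nat) \<in> inertia v L"
  using J.nat_pow_closed[of \<sigma> k] by simp

lemma J_pow_apply:
  assumes "\<sigma> \<in> inertia v L" "x \<in> L"
  shows "(\<sigma> [^]\<^bsub>J\<^esub> (k::nat)) x = (\<sigma> ^^ k) x"
proof (induction k)
  case (Suc k)
  have "\<sigma> [^]\<^bsub>J\<^esub> Suc k = \<sigma> \<otimes>\<^bsub>J\<^esub> \<sigma> [^]\<^bsub>J\<^esub> k" using J.nat_pow_Suc2 assms by simp
  then show ?case using Suc assms J_pow by simp
qed (use assms in simp)

lemma J_finite: "finite (carrier J)" using finite_inertia by simp

lemma ram_pos: "ram > 0" using of_nat_ram(2) by (auto intro: Nat.gr0I)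

lemma J_pow_ram: "\<sigma> \<in> inertia v L \<Longrightarrow> \<sigma> [^]\<^bsub>J\<^esub> ram = (\<lambda>x\<in>L. x)"
  using J.pow_order_eq_1[of \<sigma>] J_finite by (simp add: Coset.order_def)

lemma inertia_ratio_unit:
  assumes "\<sigma> \<in> inertia v L" "x \<in> L" "x \<noteq> 0"
  shows "\<sigma> x / x \<in> L" "\<sigma> x / x \<noteq> 0" "v (\<sigma> x / x) = 0" "\<sigma> x / x \<in> integers"
  using assms gal_closed[OF inertia_gal] gal_nonzero[OF inertia_gal, of \<sigma> x] val_inertia[of \<sigma> x]
  by (auto simp: val_divide integers_def)

lemma inertia_ratio_mult:
  assumes "\<sigma> \<in> inertia v L" "x \<in> L" "y \<in> L"
  shows "\<sigma> (x * y) / (x * y) = \<sigma> x / x * (\<sigma> y / y)"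
  using assms by (simp add: gal_mult[OF inertia_gal])

lemma inertia_ratio_of_unit:
  assumes "\<sigma> \<in> inertia v L" "x \<in> L" "x \<noteq> 0" "v x = 0"
  shows "\<sigma> x / x - 1 \<in> maximal"
proof -
  have "\<sigma> x - x \<in> maximal" using inertia_maximal assms by (simp add: integers_def)
  moreover have "inverse x \<in> integers" using assms by (simp add: integers_def val_inverse)
  ultimately have "(\<sigma> x - x) * inverse x \<in> maximal" by (rule maximal_mult')
  then show ?thesis using assms by (simp add: field_simps)
qed

text \<open>The ratio \<open>\<tau> x / x\<close> is a unit, hence fixed by \<open>\<sigma>\<close>
  modulo \<open>maximal\<close>; this turns the cocycle relation into multiplicativity.\<close>

lemma inertia_ratio_compose:
  assumes s: "\<sigma> \<in> inertia v L" and t: "\<tau> \<in> inertia v L" and x: "x \<in> L" "x \<noteq> 0"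
  shows "\<sigma> (\<tau> x) / x - \<sigma> x / x * (\<tau> x / x) \<in> maximal"
proof -
  let ?y = "\<tau> x / x"
  note y = inertia_ratio_unit[OF t x]
  have "\<tau> x = ?y * x" using x by simp
  then have "\<sigma> (\<tau> x) / x = \<sigma> ?y * (\<sigma> x / x)" using gal_mult[OF inertia_gal[OF s] y(1) x(1)] by simp
  moreover have "(\<sigma> ?y - ?y) * (\<sigma> x / x) \<in> maximal"
    using maximal_mult'[OF inertia_maximal[OF s y(1,4)] inertia_ratio_unit(4)[OF s x]] .
  ultimately show ?thesis by (metis left_diff_distrib mult.commute)
qed

text \<open>Tame inertia acts faithfully through the ratios \<open>\<sigma> x / x\<close>: the wild part has \<open>p\<close>-power order.\<close>

lemma tame_trivial:
  assumes \<sigma>: "\<sigma> \<in> inertia v L" and triv: "\<And>x. x \<in> L \<Longrightarrow> x \<noteq> 0 \<Longrightarrow> \<sigma> x / x - 1 \<in> maximal" and x: "x \<in> L"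
  shows "\<sigma> x = x"
proof (rule ccontr)
  assume ne: "\<sigma> x \<noteq> x"
  \<comment> \<open>The iterates of \<open>y\<close> under \<open>\<sigma>\<close> telescope to 0
    over a full period of \<open>ram\<close> steps, but each is congruent to 1 after division by
    \<open>y\<close>; so \<open>ram\<close> would lie in \<open>maximal\<close>.\<close>
  define y where "y = \<sigma> x - x"
  note g = inertia_gal[OF \<sigma>]
  have y: "y \<in> L" "y \<noteq> 0" using ne x gal_closed[OF g x] by (auto simp: y_def)
  have cl: "(\<sigma> ^^ k) z \<in> L" if "z \<in> L" for k z using that by (induction k) (auto simp: gal_closed[OF g])
  have nz: "(\<sigma> ^^ k) y \<noteq> 0" for k by (induction k) (use y gal_nonzero[OF g] cl in auto)
  have "(\<sigma> ^^ k) y = (\<sigma> ^^ Suc k) x - (\<sigma> ^^ k) x" for k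
    by (induction k) (use x cl gal_closed[OF g] in \<open>auto simp: y_def gal_diff[OF g]\<close>)
  then have "(\<Sum>k<m. (\<sigma> ^^ k) y) = (\<sigma> ^^ m) x - x" for m by (induction m) auto
  moreover have "(\<sigma> ^^ ram) x = x" using J_pow_apply[OF \<sigma> x, of ram] J_pow_ram[OF \<sigma>] x by simp
  ultimately have sum0: "(\<Sum>k<ram. (\<sigma> ^^ k) y) = 0" by simp
  have "(\<sigma> ^^ k) y / y - 1 \<in> maximal" for k
  proof (induction k)
    case (Suc k)
    let ?z = "(\<sigma> ^^ k) y"
    have z: "?z \<in> L" "?z \<noteq> 0" using cl y nz by auto
    have "(\<sigma> ^^ Suc k) y / y = \<sigma> ?z / ?z * (?z / y)" using z by simp
    moreover have "?z / y \<in> integers" using integers_add[OF maximal_subset[OF Suc] integers_one] by simp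
    ultimately show ?case
      using maximal_mult_diff[OF triv[OF z] Suc inertia_ratio_unit(4)[OF \<sigma> z] integers_one] by (metis mult_1)
  qed (use y in simp)
  then have "(\<Sum>k<ram. (\<sigma> ^^ k) y / y - 1) \<in> maximal" by (intro maximal_sum)
  moreover have "(\<Sum>k<ram. (\<sigma> ^^ k) y / y - 1) = - of_nat ram"
    by (simp add: sum_subtractf sum0 flip: sum_divide_distrib)
  ultimately have "- of_nat ram \<in> maximal" by simp
  then have "(of_nat ram :: 'k alg_closure) \<in> maximal" using maximal_minus by fastforce
  then show False using of_nat_ram by (simp add: maximal_def)
qed

text \<open>The product of the inertia conjugates of \<open>x\<close> is fixed by inertia, so its
  valuation is an integer; the factors all have the valuation of \<open>x\<close>.\<close>

lemma ram_val_int: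
  assumes x: "x \<in> L" "x \<noteq> 0"
  shows "of_nat ram * v x \<in> \<int>"
proof -
  let ?N = "\<Prod>\<sigma>\<in>inertia v L. \<sigma> x"
  have cl: "\<sigma> x \<in> L" "\<sigma> x \<noteq> 0" "v (\<sigma> x) = v x" if "\<sigma> \<in> inertia v L" for \<sigma>
    using that x gal_closed gal_nonzero inertia_gal val_inertia by auto
  have "v ?N \<in> \<int>"
  proof (rule val_inertia_fixed)
    show "?N \<in> L" using cl by (intro L_prod)
    show "?N \<noteq> 0" using cl finite_inertia by simp
    fix \<tau> assume \<tau>: "\<tau> \<in> inertia v L"
    have inj: "inj_on (compose L \<tau>) (inertia v L)"
      using J.inj_on_multc[of \<tau>] J.inj_on_cmult[of \<tau>] \<tau> by (auto simp: inj_on_def)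
    have bij: "bij_betw (compose L \<tau>) (inertia v L) (inertia v L)"
      unfolding bij_betw_def using inj endo_inj_surj[OF finite_inertia _ inj] inertia_compose[OF \<tau>] by auto
    have "\<tau> ?N = (\<Prod>\<sigma>\<in>inertia v L. \<tau> (\<sigma> x))" using cl by (intro gal_prod inertia_gal \<tau>)
    also have "\<dots> = (\<Prod>\<sigma>\<in>inertia v L. compose L \<tau> \<sigma> x)" using x by simp
    also have "\<dots> = ?N" by (rule prod.reindex_bij_betw[OF bij])
    finally show "\<tau> ?N = ?N" .
  qed
  moreover have "v ?N = of_nat ram * v x" using cl finite_inertia by (simp add: val_prod)
  ultimately show ?thesis by simp
qed

lemma root_unity_val: "z ^ ram = 1 \<Longrightarrow> z \<noteq> 0 \<and> v z = 0"
proof -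
  assume z: "z ^ ram = 1"
  have z0: "z \<noteq> 0" using z ram_pos by (metis power_0_left zero_neq_one less_numeral_extra(3))
  then have "of_nat ram * v z = 0" using val_power[of z ram] z by simp
  then show ?thesis using ram_pos z0 by simp
qed

text \<open>Reduction is injective on these roots of unity: if \<open>u\<close> is congruent to 1
  but different from 1, its geometric sum is 0 and also congruent to \<open>ram\<close>, which is a
  unit.\<close>

lemma root_unity_eqI:
  assumes z: "z ^ ram = 1" and w: "w ^ ram = 1" and zw: "z - w \<in> maximal"
  shows "z = w"
proof (rule ccontr)
  assume ne: "z \<noteq> w"
  note vz = root_unity_val[OF z] and vw = root_unity_val[OF w]
  define u where "u = z / w"
  have u: "u ^ ram = 1" "u \<noteq> 1" using z w ne vw by (auto simp: u_def power_divide)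
  have "(z - w) * inverse w \<in> maximal" using zw vw by (intro maximal_mult') (auto simp: integers_def val_inverse)
  then have um: "u - 1 \<in> maximal" using vw by (simp add: u_def field_simps)
  have ui: "u \<in> integers" using root_unity_val[OF u(1)] by (simp add: integers_def)
  have "(\<Sum>k<ram. u ^ k - 1) \<in> maximal"
    using maximal_power_diff[OF um ui integers_one] by (intro maximal_sum) simp
  moreover have "(\<Sum>k<ram. u ^ k) = 0" using u by (simp add: geometric_sum)
  ultimately have "- of_nat ram \<in> maximal" by (simp add: sum_subtractf)
  then have "(of_nat ram :: 'k alg_closure) \<in> maximal" using maximal_minus by fastforce
  then show False using of_nat_ram by (simp add: maximal_def)
qed

text \<open>\<open>X ^ ram - 1\<close> splits over the algebraic closure, and its value at
  \<open>u\<close> is the product of the differences of \<open>u\<close> and the roots;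
  \<open>maximal\<close> is prime, so it contains one of them. The root found is not claimed to lie
  in \<open>L\<close>.\<close>

lemma exists_root_unity:
  assumes u: "u \<in> integers" "u ^ ram - 1 \<in> maximal"
  obtains z where "z ^ ram = 1" "u - z \<in> maximal"
proof -
  let ?q = "monom 1 ram - 1 :: 'k alg_closure poly"
  have deg: "degree ?q = ram" using ram_pos degree_add_eq_left[of "-1" "monom 1 ram :: 'k alg_closure poly"] by (simp add: degree_monom_eq)
  have q0: "?q \<noteq> 0" using deg ram_pos by auto
  have lc: "lead_coeff ?q = 1" unfolding deg using coeff_eq_0[of "1 :: 'k alg_closure poly" ram] ram_pos by simp
  obtain A where A: "?q = (\<Prod>x\<in>#A. [:-x, 1:])" using alg_closed_imp_factorization[OF q0] lc by auto
  have ev: "poly ?q y = (\<Prod>x\<in>#A. y - x)" for y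
    unfolding A by (induction A) (auto simp: algebra_simps)
  have root: "z ^ ram = 1" if "z \<in># A" for z
  proof -
    have "poly ?q z = 0" unfolding ev using that by (auto simp: prod_mset_zero_iff)
    then show ?thesis by (simp add: poly_monom)
  qed
  have "\<exists>z\<in>#A. u - z \<in> maximal"
  proof (rule ccontr)
    assume none: "\<not> ?thesis"
    have i: "u - z \<in> integers" "u - z \<notin> maximal" if "z \<in># A" for z
    proof -
      have "z \<in> integers" using root_unity_val[OF root[OF that]] by (simp add: integers_def)
      then show "u - z \<in> integers" using u(1) integers_diff by blast
      show "u - z \<notin> maximal" using none that by blast
    qed
    have "(\<Prod>x\<in>#B. u - x) \<in> integers \<and> (\<Prod>x\<in>#B. u - x) \<notin> maximal" if "B \<subseteq># A" for B
      using that
    proof (induction B)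
      case (add z B)
      then have "z \<in># A" "B \<subseteq># A" by (auto dest: mset_subset_eq_insertD subset_mset.less_imp_le)
      then show ?case using i[of z] add.IH maximal_prime integers_mult by auto
    qed simp
    then have "poly ?q u \<notin> maximal" unfolding ev by blast
    then show False using u(2) by (simp add: poly_monom)
  qed
  then show ?thesis using that root by blast
qed

end

lemma roots_unity_field:
  assumes d: "d > 0"
  shows "finite {w :: 'a::field. w ^ d = 1}" "card {w :: 'a. w ^ d = 1} \<le> d"
proof -
  let ?q = "monom 1 d + (- 1) :: 'a poly"
  have deg: "degree ?q = d" using d degree_add_eq_left[of "-1" "monom 1 d :: 'a poly"] by (simp add: degree_monom_eq)
  then have q0: "?q \<noteq> 0" using d by auto
  have eq: "{w. poly ?q w = 0} = {w :: 'a. w ^ d = 1}" by (auto simp: poly_monom)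
  show "finite {w :: 'a. w ^ d = 1}" using poly_roots_finite[OF q0] unfolding eq .
  show "card {w :: 'a. w ^ d = 1} \<le> d" using card_poly_roots_bound[OF q0] unfolding eq deg .
qed

context tame_galois
begin

text \<open>By \<open>ram_val_int\<close> the values on \<open>L\<close> are multiples of
  \<open>1 / ram\<close>, so there is a smallest positive one, attained at \<open>\<pi>\<close>;
  division with remainder shows that every value is a multiple of it.\<close>

lemma exists_uniformizer:
  obtains \<pi> where "\<pi> \<in> L" "\<pi> \<noteq> 0" "v \<pi> > 0" "\<And>x. x \<in> L \<Longrightarrow> x \<noteq> 0 \<Longrightarrow> \<exists>k::int. v x = of_int k * v \<pi>"
proof -
  define P where "P = (\<lambda>j::nat. j > 0 \<and> (\<exists>x\<in>L. x \<noteq> 0 \<and> of_nat ram * v x = of_nat j))"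
  obtain c where c: "to_ac c \<noteq> (0 :: 'k alg_closure)" "v (to_ac c) = of_int 1" by (rule base_of_val)
  have "P ram" unfolding P_def using c ram_pos by (intro conjI bexI[of _ "to_ac c"]) auto
  define j where "j = (LEAST j. P j)"
  have Pj: "P j" unfolding j_def using \<open>P ram\<close> by (rule LeastI)
  then obtain \<pi> where \<pi>: "\<pi> \<in> L" "\<pi> \<noteq> 0" "of_nat ram * v \<pi> = of_nat j" and j0: "j > 0" by (auto simp: P_def)
  have r: "(of_nat ram :: rat) > 0" using ram_pos by simp
  show ?thesis
  proof (rule that[OF \<pi>(1,2)])
    have "of_nat ram * v \<pi> > 0" using \<pi>(3) j0 by simp
    then show "v \<pi> > 0" using r by (simp add: zero_less_mult_iff)
    fix x assume x: "x \<in> L" "x \<noteq> 0"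
    obtain i where i: "of_nat ram * v x = of_int i" using ram_val_int[OF x] by (auto elim: Ints_cases)
    define k where "k = i div int j"
    define y where "y = x * inverse \<pi> powi k"
    have pw: "v (\<pi> powi l) = of_int l * v \<pi>" and pwL: "\<pi> powi l \<in> L" "\<pi> powi l \<noteq> 0" for l
      using \<pi>(1,2) by (auto simp: power_int_def val_power val_inverse)
    have yL: "y \<in> L" "y \<noteq> 0" using x pwL(1)[of k] \<pi> by (auto simp: y_def power_int_inverse)
    have vy0: "v y = v x - of_int k * v \<pi>"
      using x pwL[of k] pw[of k] by (simp add: y_def power_int_inverse val_mult val_inverse)
    have "of_nat ram * v y = of_nat ram * v x - of_int k * (of_nat ram * v \<pi>)"
      unfolding vy0 by (simp add: algebra_simps)
    also have "\<dots> = of_int i - of_int k * (of_nat ram * v \<pi>)" by (simp only: i)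
    also have "\<dots> = of_int (i - k * int j)" using \<pi>(3) by simp
    also have "i - k * int j = i mod int j" by (simp add: k_def minus_div_mult_eq_mod)
    finally have vy: "of_nat ram * v y = of_int (i mod int j)" .
    have "i mod int j = 0"
    proof (rule ccontr)
      assume n: "i mod int j \<noteq> 0"
      have ge: "i mod int j \<ge> 0" "i mod int j < int j" using j0 by auto
      then have "P (nat (i mod int j))" unfolding P_def using n yL vy by (intro conjI bexI[of _ y]) auto
      then have "j \<le> nat (i mod int j)" unfolding j_def by (rule Least_le)
      then show False using ge by linarith
    qed
    then have "v y = 0" using vy r by simp
    then have "v x = of_int k * v \<pi>" using vy0 by simp
    then show "\<exists>k::int. v x = of_int k * v \<pi>" ..
  qed
qed

lemma power_int_maximal_diff:
  assumes "x - y \<in> maximal" "x \<noteq> 0" "v x = 0" "y \<noteq> 0" "v y = 0"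
  shows "x powi k - y powi k \<in> maximal"
proof (cases "k \<ge> 0")
  case True
  then show ?thesis using maximal_power_diff[OF assms(1)] assms by (simp add: power_int_def integers_def)
next
  case False
  have "inverse x - inverse y = inverse x * (- (x - y)) * inverse y" using assms by (simp add: field_simps)
  moreover have "inverse x * (- (x - y)) * inverse y \<in> maximal"
    by (intro maximal_mult maximal_mult' maximal_minus assms(1)) (use assms in \<open>auto simp: integers_def val_inverse\<close>)
  ultimately have "inverse x - inverse y \<in> maximal" by simp
  then have "inverse x ^ nat (- k) - inverse y ^ nat (- k) \<in> maximal"
    by (rule maximal_power_diff) (use assms in \<open>auto simp: integers_def val_inverse\<close>)
  then show ?thesis using False by (simp add: power_int_def)
qed

lemma gal_power_int: "\<sigma> \<in> gal L \<Longrightarrow> x \<in> L \<Longrightarrow> \<sigma> (x powi k) = \<sigma> x powi k"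
  by (simp add: power_int_def gal_power gal_inverse)

text \<open>A form of the tame character without uniformizer and roots of unity: \<open>g\<close>
  multiplies a uniformizer, modulo \<open>maximal\<close>, by a root of unity of exact order
  \<open>ram\<close>, and \<open>a\<close> is the exponent of the uniformizer in
  \<open>x\<close>.\<close>

definition tame_generator :: "('k alg_closure \<Rightarrow> 'k alg_closure) \<Rightarrow> bool" where
  "tame_generator g \<longleftrightarrow> finite_cyclic J g ram \<and>
     (\<forall>j x a. x \<in> L \<longrightarrow> x \<noteq> 0 \<longrightarrow> of_nat ram * v x = of_int a \<longrightarrow>
       ((g [^]\<^bsub>J\<^esub> (j::nat)) x / x - 1 \<in> maximal \<longleftrightarrow> int ram dvd int j * a))"

text \<open>
  The tame character: \<open>\<sigma> \<pi> / \<pi>\<close> is congruent to a unique root of unity \<open>z \<sigma>\<close> of order dividing the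
  order of inertia, and \<open>z\<close> is an injective homomorphism. Hence inertia is cyclic, and comparing
  with the ratio at an element of valuation 1 of \<open>K\<close> shows that \<open>v \<pi> = 1 / ram\<close>.
\<close>

lemma exists_tame_generator: "\<exists>g. tame_generator g"
proof -
  obtain \<pi> where \<pi>: "\<pi> \<in> L" "\<pi> \<noteq> 0" "v \<pi> > 0" "\<And>x. x \<in> L \<Longrightarrow> x \<noteq> 0 \<Longrightarrow> \<exists>k::int. v x = of_int k * v \<pi>"
    using exists_uniformizer by blast
  let ?u = "\<lambda>\<sigma>. \<sigma> \<pi> / \<pi>"
  have u: "?u \<sigma> \<in> integers" "?u \<sigma> \<noteq> 0" "v (?u \<sigma>) = 0" if "\<sigma> \<in> inertia v L" for \<sigma>
    using inertia_ratio_unit[OF that \<pi>(1,2)] by auto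
  have upow: "(\<sigma> [^]\<^bsub>J\<^esub> k) \<pi> / \<pi> - ?u \<sigma> ^ k \<in> maximal" if \<sigma>: "\<sigma> \<in> inertia v L" for \<sigma> and k :: nat
  proof (induction k)
    case (Suc k)
    let ?\<tau> = "\<sigma> [^]\<^bsub>J\<^esub> k"
    have "\<sigma> [^]\<^bsub>J\<^esub> Suc k = \<sigma> \<otimes>\<^bsub>J\<^esub> ?\<tau>" using J.nat_pow_Suc2 \<sigma> by simp
    then have "(\<sigma> [^]\<^bsub>J\<^esub> Suc k) \<pi> / \<pi> = \<sigma> (?\<tau> \<pi>) / \<pi>" using \<sigma> J_pow \<pi> by simp
    moreover have "\<sigma> (?\<tau> \<pi>) / \<pi> - ?u \<sigma> * ?u ?\<tau> \<in> maximal"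
      using inertia_ratio_compose[OF \<sigma> J_pow[OF \<sigma>] \<pi>(1,2)] .
    moreover have "?u \<sigma> * ?u ?\<tau> - ?u \<sigma> * ?u \<sigma> ^ k \<in> maximal"
      using maximal_mult[OF u(1)[OF \<sigma>] Suc] by (simp add: right_diff_distrib)
    ultimately show ?case using maximal_diff_trans by (metis power_Suc)
  qed (use \<pi> in simp)
  have "\<exists>z. z ^ ram = 1 \<and> ?u \<sigma> - z \<in> maximal" if \<sigma>: "\<sigma> \<in> inertia v L" for \<sigma>
  proof -
    have "1 - ?u \<sigma> ^ ram \<in> maximal" using upow[OF \<sigma>, of ram] J_pow_ram[OF \<sigma>] \<pi> by simp
    then have "?u \<sigma> ^ ram - 1 \<in> maximal" by (rule maximal_diff_commute)
    then show ?thesis using exists_root_unity[OF u(1)[OF \<sigma>]] by metis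
  qed
  \<comment> \<open>\<open>z \<sigma>\<close> is the Teichmueller representative of the residue of
    \<open>\<sigma> \<pi> / \<pi>\<close>. Relations that hold modulo \<open>maximal\<close> become
    equalities for \<open>z\<close> by \<open>root_unity_eqI\<close>.\<close>
  then obtain z where z: "z \<sigma> ^ ram = 1" "?u \<sigma> - z \<sigma> \<in> maximal" if "\<sigma> \<in> inertia v L" for \<sigma> by metis
  have zv: "z \<sigma> \<noteq> 0" "v (z \<sigma>) = 0" "z \<sigma> \<in> integers" if "\<sigma> \<in> inertia v L" for \<sigma>
    using root_unity_val[OF z(1)[OF that]] by (auto simp: integers_def)
  have zpow: "z (\<sigma> [^]\<^bsub>J\<^esub> k) = z \<sigma> ^ k" if \<sigma>: "\<sigma> \<in> inertia v L" for \<sigma> and k :: nat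
  proof (rule root_unity_eqI)
    show "z (\<sigma> [^]\<^bsub>J\<^esub> k) ^ ram = 1" using z(1) J_pow[OF \<sigma>] by blast
    show "(z \<sigma> ^ k) ^ ram = 1" using z(1)[OF \<sigma>] by (metis mult.commute power_mult power_one)
    have "z (\<sigma> [^]\<^bsub>J\<^esub> k) - ?u (\<sigma> [^]\<^bsub>J\<^esub> k) \<in> maximal" using z(2)[OF J_pow[OF \<sigma>]] by (rule maximal_diff_commute)
    moreover have "?u \<sigma> ^ k - z \<sigma> ^ k \<in> maximal" using maximal_power_diff[OF z(2)[OF \<sigma>] u(1)[OF \<sigma>] zv(3)[OF \<sigma>]] .
    ultimately show "z (\<sigma> [^]\<^bsub>J\<^esub> k) - z \<sigma> ^ k \<in> maximal" using upow[OF \<sigma>, of k] maximal_diff_trans by blast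
  qed
  have zmult: "z (\<sigma> \<otimes>\<^bsub>J\<^esub> \<tau>) = z \<sigma> * z \<tau>" if s: "\<sigma> \<in> inertia v L" and t: "\<tau> \<in> inertia v L" for \<sigma> \<tau>
  proof (rule root_unity_eqI)
    have st: "\<sigma> \<otimes>\<^bsub>J\<^esub> \<tau> \<in> inertia v L" using s t inertia_compose by simp
    show "z (\<sigma> \<otimes>\<^bsub>J\<^esub> \<tau>) ^ ram = 1" using z(1)[OF st] .
    show "(z \<sigma> * z \<tau>) ^ ram = 1" using z(1)[OF s] z(1)[OF t] by (simp add: power_mult_distrib)
    have "z (\<sigma> \<otimes>\<^bsub>J\<^esub> \<tau>) - ?u (\<sigma> \<otimes>\<^bsub>J\<^esub> \<tau>) \<in> maximal" using z(2)[OF st] by (rule maximal_diff_commute)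
    moreover have "?u (\<sigma> \<otimes>\<^bsub>J\<^esub> \<tau>) - ?u \<sigma> * ?u \<tau> \<in> maximal"
      using inertia_ratio_compose[OF s t \<pi>(1,2)] s t \<pi>(1) by simp
    moreover have "?u \<sigma> * ?u \<tau> - z \<sigma> * z \<tau> \<in> maximal"
      by (rule maximal_mult_diff[OF z(2)[OF s] z(2)[OF t] u(1)[OF s] zv(3)[OF t]])
    ultimately show "z (\<sigma> \<otimes>\<^bsub>J\<^esub> \<tau>) - z \<sigma> * z \<tau> \<in> maximal" using maximal_diff_trans by blast
  qed
  \<comment> \<open>Write \<open>x\<close> as a unit times \<open>\<pi> powi k\<close>: the unit has
    ratio congruent to 1, and the power contributes the \<open>k\<close>-th power of the ratio of
    \<open>\<pi>\<close>.\<close>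
  have ratio: "\<sigma> x / x - z \<sigma> powi k \<in> maximal"
    if \<sigma>: "\<sigma> \<in> inertia v L" and x: "x \<in> L" "x \<noteq> 0" "v x = of_int k * v \<pi>" for \<sigma> x and k :: int
  proof -
    let ?p = "\<pi> powi k"
    have p: "?p \<in> L" "?p \<noteq> 0" "v ?p = of_int k * v \<pi>" using \<pi>(1,2) by (auto simp: power_int_def val_power val_inverse)
    define y where "y = x / ?p"
    have y: "y \<in> L" "y \<noteq> 0" "v y = 0" "x = y * ?p" using x p by (auto simp: y_def val_divide)
    have "\<sigma> x / x = \<sigma> y / y * (\<sigma> ?p / ?p)" unfolding y(4) using inertia_ratio_mult[OF \<sigma> y(1) p(1)] .
    also have "\<sigma> ?p / ?p = ?u \<sigma> powi k"
      using gal_power_int[OF inertia_gal[OF \<sigma>] \<pi>(1)] by (simp add: power_int_divide_distrib)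
    finally have eq: "\<sigma> x / x = \<sigma> y / y * ?u \<sigma> powi k" .
    have "?u \<sigma> powi k - z \<sigma> powi k \<in> maximal"
      by (rule power_int_maximal_diff[OF z(2)[OF \<sigma>] u(2,3)[OF \<sigma>] zv(1,2)[OF \<sigma>]])
    moreover have "z \<sigma> powi k \<in> integers"
      using zv[OF \<sigma>] by (auto simp: power_int_def integers_def val_power val_inverse)
    ultimately have "\<sigma> y / y * ?u \<sigma> powi k - 1 * z \<sigma> powi k \<in> maximal"
      using maximal_mult_diff[OF inertia_ratio_of_unit[OF \<sigma> y(1-3)] _ inertia_ratio_unit(4)[OF \<sigma> y(1,2)]] by blast
    then show ?thesis using eq by simp
  qed
  have zpow_ram: "(z \<sigma> powi k) ^ ram = 1" if "\<sigma> \<in> inertia v L" for \<sigma> and k :: int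
    using z(1)[OF that] by (simp add: power_int_def power_inverse flip: power_mult)
      (metis mult.commute power_mult power_one)
  have ratio1: "\<sigma> x / x - 1 \<in> maximal \<longleftrightarrow> z \<sigma> powi k = 1"
    if \<sigma>: "\<sigma> \<in> inertia v L" and x: "x \<in> L" "x \<noteq> 0" "v x = of_int k * v \<pi>" for \<sigma> x and k :: int
  proof
    assume "\<sigma> x / x - 1 \<in> maximal"
    then have "z \<sigma> powi k - 1 \<in> maximal"
      using ratio[OF \<sigma> x] maximal_diff_trans maximal_diff_commute by blast
    then show "z \<sigma> powi k = 1" using root_unity_eqI[OF zpow_ram[OF \<sigma>]] by simp
  qed (use ratio[OF \<sigma> x] in simp)
  have z1: "\<sigma> = \<one>\<^bsub>J\<^esub>" if \<sigma>: "\<sigma> \<in> inertia v L" "z \<sigma> = 1" for \<sigma>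
  proof -
    have "\<sigma> x / x - 1 \<in> maximal" if x: "x \<in> L" "x \<noteq> 0" for x
    proof -
      obtain k :: int where k: "v x = of_int k * v \<pi>" using \<pi>(4)[OF x] by blast
      show ?thesis using ratio1[OF \<sigma>(1) x k] \<sigma>(2) by simp
    qed
    then have "\<sigma> x = x" if "x \<in> L" for x using tame_trivial[OF \<sigma>(1)] that by blast
    then have "\<sigma> = (\<lambda>x\<in>L. x)" by (intro gal_eqI inertia_gal \<sigma>(1) gal_id) simp
    then show ?thesis by simp
  qed
  have inj: "inj_on z (inertia v L)"
  proof (rule inj_onI)
    fix \<sigma> \<tau> assume st: "\<sigma> \<in> inertia v L" "\<tau> \<in> inertia v L" "z \<sigma> = z \<tau>"
    have i: "inv\<^bsub>J\<^esub> \<tau> \<in> inertia v L" using J.inv_closed[of \<tau>] st by simp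
    have "z (inv\<^bsub>J\<^esub> \<tau> \<otimes>\<^bsub>J\<^esub> \<sigma>) = z (inv\<^bsub>J\<^esub> \<tau>) * z \<tau>" using zmult[OF i st(1)] st(3) by simp
    also have "\<dots> = z (inv\<^bsub>J\<^esub> \<tau> \<otimes>\<^bsub>J\<^esub> \<tau>)" using zmult[OF i st(2)] by simp
    also have "\<dots> = z (\<tau> [^]\<^bsub>J\<^esub> (0::nat))" using J.l_inv[of \<tau>] st by simp
    also have "\<dots> = 1" using zpow[OF st(2), of 0] by simp
    finally have "inv\<^bsub>J\<^esub> \<tau> \<otimes>\<^bsub>J\<^esub> \<sigma> = \<one>\<^bsub>J\<^esub>" using z1 J.m_closed[of "inv\<^bsub>J\<^esub> \<tau>" \<sigma>] i st J_simps(1) by blast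
    then have "inv\<^bsub>J\<^esub> \<sigma> = inv\<^bsub>J\<^esub> \<tau>" using J.inv_equality[of "inv\<^bsub>J\<^esub> \<tau>" \<sigma>] i st by simp
    then have "inv\<^bsub>J\<^esub> (inv\<^bsub>J\<^esub> \<sigma>) = inv\<^bsub>J\<^esub> (inv\<^bsub>J\<^esub> \<tau>)" by simp
    then show "\<sigma> = \<tau>" using J.inv_inv[of \<sigma>] J.inv_inv[of \<tau>] st by simp
  qed
  have roots_le: "card {w :: 'k alg_closure. w ^ d = 1} \<le> d" "finite {w :: 'k alg_closure. w ^ d = 1}" if "d > 0" for d
    using roots_unity_field[OF that] by auto
  have "card {x \<in> carrier J. x [^]\<^bsub>J\<^esub> d = \<one>\<^bsub>J\<^esub>} \<le> d" if d: "d > 0" for d :: nat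
  proof -
    have "card {x \<in> carrier J. x [^]\<^bsub>J\<^esub> d = \<one>\<^bsub>J\<^esub>} \<le> card {w :: 'k alg_closure. w ^ d = 1}"
    proof (rule card_inj_on_le[of z])
      show "inj_on z {x \<in> carrier J. x [^]\<^bsub>J\<^esub> d = \<one>\<^bsub>J\<^esub>}" using inj by (rule inj_on_subset) auto
      show "z ` {x \<in> carrier J. x [^]\<^bsub>J\<^esub> d = \<one>\<^bsub>J\<^esub>} \<subseteq> {w. w ^ d = 1}"
      proof clarify
        fix x assume x: "x \<in> carrier J" "x [^]\<^bsub>J\<^esub> d = \<one>\<^bsub>J\<^esub>"
        then have "z x ^ d = z (x [^]\<^bsub>J\<^esub> (0::nat))" using zpow[of x d] by simp
        also have "\<dots> = 1" using zpow[of x 0] x(1) by simp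
        finally show "z x ^ d = 1" .
      qed
    qed (rule roots_le[OF d])
    then show ?thesis using roots_le(1)[OF d] by simp
  qed
  then obtain g where "finite_cyclic J g (card (carrier J))" using J.finite_cyclicI[OF J_finite] by blast
  then have cyc: "finite_cyclic J g ram" by simp
  then interpret C: finite_cyclic J g ram .
  have g: "g \<in> inertia v L" using C.gen_closed by simp
  obtain c where c: "to_ac c \<noteq> (0 :: 'k alg_closure)" "v (to_ac c) = of_int 1" by (rule base_of_val)
  \<comment> \<open>\<open>e\<close> expresses the value 1 in units of \<open>v \<pi>\<close>. Since
    \<open>g\<close> fixes the base field, \<open>z g\<close> is killed by \<open>e\<close>, so
    \<open>ram\<close> divides \<open>e\<close>; conversely \<open>ram * v \<pi>\<close> is an
    integer, so \<open>e\<close> divides \<open>ram\<close>.\<close>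
  obtain e :: int where e: "1 = of_int e * v \<pi>" using \<pi>(4)[of "to_ac c"] c by auto
  have e0: "e > 0" using e \<pi>(3) by (metis less_irrefl linorder_neqE_linordered_idom mult_neg_pos mult_zero_left of_int_0 of_int_0_less_iff of_int_less_0_iff zero_less_one zero_neq_one less_asym)
  have vpi: "v \<pi> = 1 / of_int e" using e e0 by (simp add: field_simps)
  have "z g powi e = 1"
    using ratio1[OF g, of "to_ac c" e] c e gal_to_ac[OF inertia_gal[OF g]] by simp
  then have "z g ^ nat e = 1" using e0 by (simp add: power_int_def)
  then have "g [^]\<^bsub>J\<^esub> nat e = \<one>\<^bsub>J\<^esub>" using z1[OF J_pow[OF g]] zpow[OF g] by simp
  then have "ram dvd nat e" using C.gen_pow_eq_one by blast
  moreover have "int e' dvd int ram" if "e = int e'" for e'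
  proof -
    obtain i where i: "of_nat ram * v \<pi> = of_int i" using ram_val_int[OF \<pi>(1,2)] by (auto elim: Ints_cases)
    then have "of_nat ram = (of_int (i * e) :: rat)" using vpi e0 by (simp add: field_simps)
    then have "int ram = i * e" by (metis of_int_eq_iff of_int_of_nat_eq)
    then show ?thesis using that by simp
  qed
  ultimately have er: "e = int ram" using e0 by (metis dvd_antisym int_dvd_int_iff int_nat_eq less_imp_le nat_0_le)
  show ?thesis unfolding tame_generator_def
  proof (intro exI[of _ g] conjI allI impI cyc)
    fix j :: nat and x a assume x: "x \<in> L" "x \<noteq> 0" "of_nat ram * v x = of_int a"
    have "v x = of_int a / of_nat ram" using x(3) ram_pos by (simp add: eq_divide_eq mult.commute)
    then have "v x = of_int a * v \<pi>" using vpi er by simp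
    then have "(g [^]\<^bsub>J\<^esub> j) x / x - 1 \<in> maximal \<longleftrightarrow> (z g ^ j) powi a = 1"
      using ratio1[OF J_pow[OF g] x(1,2)] zpow[OF g] by simp
    also have "\<dots> \<longleftrightarrow> z g ^ (j * nat \<bar>a\<bar>) = 1"
      by (cases "a \<ge> 0") (auto simp: power_int_def power_mult power_inverse)
    also have "\<dots> \<longleftrightarrow> g [^]\<^bsub>J\<^esub> (j * nat \<bar>a\<bar>) = \<one>\<^bsub>J\<^esub>"
      using z1[OF J_pow[OF g]] zpow[OF g] zpow[OF g, of 0] by (metis J.nat_pow_0 power_0)
    also have "\<dots> \<longleftrightarrow> ram dvd j * nat \<bar>a\<bar>" by (rule C.gen_pow_eq_one)
    also have "\<dots> \<longleftrightarrow> int ram dvd int j * a"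
      by (simp flip: int_dvd_int_iff) (simp add: abs_mult flip: dvd_abs_iff[of _ "int j * a"])
    finally show "(g [^]\<^bsub>J\<^esub> j) x / x - 1 \<in> maximal \<longleftrightarrow> int ram dvd int j * a" .
  qed
qed

end

section \<open>The action of inertia on the children of a cluster\<close>

lemma denom_pos: "denom q > 0"
  using quotient_of_denom_pos'[of q] by (simp add: denom_def)

lemma denom_dvd_iff: "denom q dvd k \<longleftrightarrow> q * of_nat k \<in> \<int>"
proof -
  obtain a b where ab: "quotient_of q = (a, b)" by fastforce
  have b: "b > 0" and q: "q = of_int a / of_int b" and cop: "coprime a b"
    using quotient_of_denom_pos[OF ab] quotient_of_div[OF ab] quotient_of_coprime[OF ab] by auto
  have "denom q dvd k \<longleftrightarrow> b dvd int k" using b by (simp add: denom_def ab nat_dvd_iff)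
  also have "\<dots> \<longleftrightarrow> b dvd a * int k" using cop by (simp add: coprime_dvd_mult_right_iff coprime_commute)
  also have "\<dots> \<longleftrightarrow> q * of_nat k \<in> \<int>"
  proof
    assume "b dvd a * int k"
    then obtain c where "a * int k = b * c" by (auto elim: dvdE)
    then have "of_int a * of_nat k = (of_int b * of_int c :: rat)" by (metis of_int_mult of_int_of_nat_eq)
    then have "q * of_nat k = of_int c" using b unfolding q by (simp add: field_simps)
    then show "q * of_nat k \<in> \<int>" by simp
  next
    assume "q * of_nat k \<in> \<int>"
    then obtain c where "q * of_nat k = of_int c" by (auto elim: Ints_cases)
    then have "of_int a * of_nat k = (of_int b * of_int c :: rat)" using b unfolding q by (simp add: field_simps)
    then have "of_int (a * int k) = (of_int (b * c) :: rat)" by simp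
    then have "a * int k = b * c" by (simp only: of_int_eq_iff)
    then show "b dvd a * int k" by simp
  qed
  finally show ?thesis .
qed

section \<open>Children of a cluster as open discs\<close>

context valued_field
begin

text \<open>The open disc around \<open>r\<close> of radius the depth, cut out in \<open>s\<close>;
  \<open>children_eq\<close> identifies these discs with the children.\<close>

definition subcluster :: "'a set \<Rightarrow> 'a \<Rightarrow> 'a set" where
  "subcluster s r = {x \<in> s. x = r \<or> v (x - r) > depth v s}"

lemma close_sym: "close_to v \<delta> x y \<Longrightarrow> close_to v \<delta> y x"
  by (rule close_to_sym[OF valuation])

lemma close_trans: "close_to v \<delta> x y \<Longrightarrow> close_to v \<delta> y z \<Longrightarrow> close_to v \<delta> x z"
  by (rule close_to_trans[OF valuation])

lemma val_gt_trans:
  assumes "x = y \<or> v (x - y) > d" "y = z \<or> v (y - z) > d" shows "x = z \<or> v (x - z) > d"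
proof (cases "x = y \<or> y = z \<or> x = z")
  case False
  then have "v ((x - y) + (y - z)) \<ge> min (v (x - y)) (v (y - z))" by (intro val_add) auto
  then show ?thesis using False assms by auto
qed (use assms in auto)

lemma val_diff_ge:
  assumes "x \<noteq> 0" "y \<noteq> 0" "v x = v y" shows "x = y \<or> v (x - y) \<ge> v y"
  using val_add[of x "- y"] val_minus[of y] assms by (cases "x = y") auto

text \<open>Every point of an ultrametric disc is a centre of it.\<close>

lemma cluster_disc:
  assumes c: "is_cluster v R c" and r: "r \<in> c"
  obtains \<delta> where "c = {x \<in> R. close_to v \<delta> x r}"
proof -
  obtain z \<delta> where z: "c = R \<inter> {x. close_to v \<delta> x z}" using c by (auto simp: is_cluster_def)
  then have "close_to v \<delta> r z" using r by simp
  then have "c = {x \<in> R. close_to v \<delta> x r}" unfolding z using close_sym close_trans by blast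
  then show ?thesis by (rule that)
qed

context
  fixes R s assumes R: "finite R" and s: "proper_cluster v R s"
begin

lemma cluster_subset: "s \<subseteq> R" using s by (auto simp: proper_cluster_def is_cluster_def)

lemma finite_cluster: "finite s" using cluster_subset R finite_subset by blast

lemma
  shows depth_le: "\<And>r r'. r \<in> s \<Longrightarrow> r' \<in> s \<Longrightarrow> r \<noteq> r' \<Longrightarrow> depth v s \<le> v (r - r')"
    and depth_attained: "\<exists>r\<in>s. \<exists>r'\<in>s. r \<noteq> r' \<and> v (r - r') = depth v s"
proof -
  let ?D = "{v (r - r') | r r'. r \<in> s \<and> r' \<in> s \<and> r \<noteq> r'}"
  have "?D \<subseteq> (\<lambda>(r, r'). v (r - r')) ` (s \<times> s)" by auto
  then have fin: "finite ?D" using finite_cluster by (meson finite_SigmaI finite_imageI finite_subset)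
  have "card s > 1" using s by (simp add: proper_cluster_def)
  then obtain r r' where "r \<in> s" "r' \<in> s" "r \<noteq> r'" using card_le_Suc0_iff_eq[OF finite_cluster] by (auto simp: not_le)
  then have "?D \<noteq> {}" by blast
  then have "depth v s \<in> ?D" unfolding depth_def using fin by (rule Min_in[rotated])
  then obtain r r' where "depth v s = v (r - r')" "r \<in> s" "r' \<in> s" "r \<noteq> r'" by blast
  then show "\<exists>r\<in>s. \<exists>r'\<in>s. r \<noteq> r' \<and> v (r - r') = depth v s" by metis
  show "depth v s \<le> v (r - r')" if "r \<in> s" "r' \<in> s" "r \<noteq> r'" for r r'
    unfolding depth_def using fin by (rule Min_le) (use that in blast)
qed

lemma subcluster_eq_iff:
  assumes "r \<in> s" "r' \<in> s"
  shows "subcluster s r = subcluster s r' \<longleftrightarrow> r = r' \<or> v (r - r') > depth v s"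
proof
  assume "subcluster s r = subcluster s r'"
  moreover have "r \<in> subcluster s r" using assms by (simp add: subcluster_def)
  ultimately show "r = r' \<or> v (r - r') > depth v s" by (simp add: subcluster_def)
next
  assume a: "r = r' \<or> v (r - r') > depth v s"
  then have b: "r' = r \<or> v (r' - r) > depth v s" using val_diff_commute by metis
  show "subcluster s r = subcluster s r'" unfolding subcluster_def using val_gt_trans a b by blast
qed

lemma subcluster_psubset:
  assumes "r \<in> s" shows "subcluster s r \<subset> s"
proof -
  obtain a b where ab: "a \<in> s" "b \<in> s" "a \<noteq> b" "v (a - b) = depth v s" using depth_attained by blast
  have "\<not> (a \<in> subcluster s r \<and> b \<in> subcluster s r)"
  proof
    assume "a \<in> subcluster s r \<and> b \<in> subcluster s r"
    then have "a = r \<or> v (a - r) > depth v s" "r = b \<or> v (r - b) > depth v s"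
      unfolding subcluster_def using val_diff_commute by fastforce+
    then show False using val_gt_trans[of a r "depth v s" b] ab by simp
  qed
  then show ?thesis using ab by (auto simp: subcluster_def)
qed

lemma is_cluster_subcluster:
  assumes r: "r \<in> s" shows "is_cluster v R (subcluster s r)"
proof -
  let ?d = "depth v s"
  let ?A = "{v (x - r) | x. x \<in> R \<and> x \<noteq> r \<and> v (x - r) > ?d}"
  have "?A \<subseteq> (\<lambda>x. v (x - r)) ` R" by auto
  then have fin: "finite (insert (?d + 1) ?A)" using R by (meson finite.insertI finite_imageI finite_subset)
  \<comment> \<open>Clusters are closed discs, so the strict inequality is replaced by the smallest
    value above the depth that occurs among the finitely many roots; \<open>?d + 1\<close> stands in
    when none occurs.\<close>
  define \<delta> where "\<delta> = Min (insert (?d + 1) ?A)"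
  have "\<delta> \<in> insert (?d + 1) ?A" unfolding \<delta>_def using fin by (intro Min_in) auto
  then have d: "\<delta> > ?d" by auto
  obtain \<epsilon> where \<epsilon>: "s = {x \<in> R. close_to v \<epsilon> x r}" using cluster_disc r s proper_cluster_def by metis
  have "subcluster s r = R \<inter> {x. close_to v \<delta> x r}"
  proof (intro equalityI subsetI)
    fix x assume x: "x \<in> subcluster s r"
    then have xR: "x \<in> R" using cluster_subset by (auto simp: subcluster_def)
    have "close_to v \<delta> x r"
    proof (cases "x = r")
      case False
      then have "v (x - r) \<in> ?A" using x xR by (auto simp: subcluster_def)
      then have "\<delta> \<le> v (x - r)" unfolding \<delta>_def using fin by (intro Min_le) auto
      then show ?thesis by (simp add: close_to_def)
    qed (simp add: close_to_def)
    then show "x \<in> R \<inter> {x. close_to v \<delta> x r}" using xR by simp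
  next
    fix x assume x: "x \<in> R \<inter> {x. close_to v \<delta> x r}"
    \<comment> \<open>A pair at distance exactly the depth shows that the radius of \<open>s\<close>
      does not exceed the depth, so the smaller disc stays inside \<open>s\<close>.\<close>
    obtain a b where ab: "a \<in> s" "b \<in> s" "a \<noteq> b" "v (a - b) = ?d" using depth_attained by blast
    have "close_to v \<epsilon> a b" using ab \<epsilon> close_sym close_trans by blast
    then have "\<epsilon> \<le> ?d" using ab by (simp add: close_to_def)
    then have "close_to v \<epsilon> x r" using x d by (auto simp: close_to_def)
    then have "x \<in> s" using x \<epsilon> by blast
    then show "x \<in> subcluster s r" using x d by (auto simp: subcluster_def close_to_def)
  qed
  moreover have "r \<in> subcluster s r" using r by (simp add: subcluster_def)
  ultimately show ?thesis unfolding is_cluster_def by blast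
qed

text \<open>A cluster through \<open>r\<close> that misses a point of \<open>s\<close> has radius
  above the depth and lies in \<open>subcluster s r\<close>; one that is strictly larger than this
  disc has radius at most the depth and contains all of \<open>s\<close>.\<close>

lemma children_eq: "children v R s = subcluster s ` s"
proof (intro equalityI subsetI)
  fix c assume "c \<in> children v R s"
  then have c: "is_cluster v R c" "c \<subset> s" "\<not> (\<exists>c'. is_cluster v R c' \<and> c \<subset> c' \<and> c' \<subset> s)"
    by (auto simp: children_def)
  obtain r where r: "r \<in> c" using c(1) by (auto simp: is_cluster_def)
  obtain \<delta> where \<delta>: "c = {x \<in> R. close_to v \<delta> x r}" using cluster_disc[OF c(1) r] .
  have rs: "r \<in> s" using r c by blast
  obtain x where x: "x \<in> s" "x \<notin> c" using c(2) by blast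
  then have "\<not> close_to v \<delta> x r" using \<delta> cluster_subset by blast
  then have "x \<noteq> r" "v (x - r) < \<delta>" by (auto simp: close_to_def)
  then have "depth v s < \<delta>" using depth_le[OF x(1) rs] by simp
  then have "c \<subseteq> subcluster s r" using c(2) \<delta> by (auto simp: subcluster_def close_to_def)
  then have "c = subcluster s r" using c(3) is_cluster_subcluster[OF rs] subcluster_psubset[OF rs] by blast
  then show "c \<in> subcluster s ` s" using rs by blast
next
  fix c assume "c \<in> subcluster s ` s"
  then obtain r where r: "r \<in> s" "c = subcluster s r" by blast
  have "\<not> (is_cluster v R c' \<and> c \<subset> c' \<and> c' \<subset> s)" for c'
  proof
    assume c': "is_cluster v R c' \<and> c \<subset> c' \<and> c' \<subset> s"
    have "r \<in> c'" using r c' by (auto simp: subcluster_def)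
    then obtain \<delta> where \<delta>: "c' = {x \<in> R. close_to v \<delta> x r}" using cluster_disc c' by blast
    obtain x where x: "x \<in> c'" "x \<notin> c" using c' by blast
    then have "x \<in> s" "x \<noteq> r" "v (x - r) \<le> depth v s" using c' r by (auto simp: subcluster_def)
    moreover have "v (x - r) \<ge> \<delta>" using x(1) \<delta> \<open>x \<noteq> r\<close> by (simp add: close_to_def)
    ultimately have "\<delta> \<le> depth v s" by simp
    then have "s \<subseteq> c'" using \<delta> depth_le[OF _ r(1)] cluster_subset by (force simp: close_to_def)
    then show False using c' by blast
  qed
  then show "c \<in> children v R s"
    using r is_cluster_subcluster subcluster_psubset by (auto simp: children_def)
qed

end

end

section \<open>The stabiliser of a cluster and its orbits on the odd children\<close>

locale tame_cluster = tame_galois v p L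
  for v :: "('k::field_char_0) alg_closure \<Rightarrow> rat" and p L +
  fixes R s :: "'k alg_closure set"
  assumes R_finite: "finite R" and R_subset: "R \<subseteq> L"
    and s_proper: "proper_cluster v R s"
begin

abbreviation d where "d \<equiv> depth v s"

definition stab :: "('k alg_closure \<Rightarrow> 'k alg_closure) set" where
  "stab = {\<sigma> \<in> inertia v L. \<sigma> ` s = s}"

lemma stab_inertia: "\<sigma> \<in> stab \<Longrightarrow> \<sigma> \<in> inertia v L" by (simp add: stab_def)

lemma s_subset: "s \<subseteq> L" using cluster_subset[OF R_finite s_proper] R_subset by blast

lemma stab_group_eq: "stab_group v L s = J\<lparr>carrier := stab\<rparr>"
  by (simp add: stab_group_def inertia_group_def stab_def)

lemma stab_closed: "\<sigma> \<in> stab \<Longrightarrow> r \<in> s \<Longrightarrow> \<sigma> r \<in> s" by (auto simp: stab_def)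

lemma compose_image: "A \<subseteq> L \<Longrightarrow> compose L \<sigma> \<tau> ` A = \<sigma> ` (\<tau> ` A)"
  by (force simp: image_iff compose_def)

lemma subgroup_stab: "subgroup stab J"
proof (rule J.subgroupI)
  show "stab \<subseteq> carrier J" by (auto simp: stab_def)
  have "(\<lambda>x\<in>L. x) \<in> stab" using inertia_id s_subset by (force simp: stab_def image_iff)
  then show "stab \<noteq> {}" by blast
  fix \<sigma> assume \<sigma>: "\<sigma> \<in> stab"
  have i: "inv\<^bsub>J\<^esub> \<sigma> \<in> inertia v L" using J.inv_closed[of \<sigma>] \<sigma> by (simp add: stab_def)
  have "(inv\<^bsub>J\<^esub> \<sigma>) ` s = (inv\<^bsub>J\<^esub> \<sigma>) ` (\<sigma> ` s)" using \<sigma> by (simp add: stab_def)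
  also have "\<dots> = compose L (inv\<^bsub>J\<^esub> \<sigma>) \<sigma> ` s" by (rule compose_image[OF s_subset, symmetric])
  also have "compose L (inv\<^bsub>J\<^esub> \<sigma>) \<sigma> = (\<lambda>x\<in>L. x)" using J.l_inv[of \<sigma>] \<sigma> i by (simp add: stab_def)
  also have "(\<lambda>x\<in>L. x) ` s = s" using s_subset by (force simp: image_iff)
  finally show "inv\<^bsub>J\<^esub> \<sigma> \<in> stab" using i by (simp add: stab_def)
  fix \<tau> assume \<tau>: "\<tau> \<in> stab"
  show "\<sigma> \<otimes>\<^bsub>J\<^esub> \<tau> \<in> stab"
    using \<sigma> \<tau> inertia_compose compose_image[OF s_subset, of \<sigma> \<tau>] by (simp add: stab_def)
qed

lemma val_stab_diff: "\<sigma> \<in> inertia v L \<Longrightarrow> x \<in> L \<Longrightarrow> y \<in> L \<Longrightarrow> x \<noteq> y \<Longrightarrow> v (\<sigma> x - \<sigma> y) = v (x - y)"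
  using val_inertia[of \<sigma> "x - y"] gal_diff[OF inertia_gal, of \<sigma> x y] by simp

text \<open>Inertia preserves the valuations of differences, and the discs are defined by these
  within \<open>s\<close>.\<close>

lemma image_subcluster:
  assumes \<sigma>: "\<sigma> \<in> stab" and r: "r \<in> s"
  shows "\<sigma> ` subcluster s r = subcluster s (\<sigma> r)"
proof -
  note i = stab_inertia[OF \<sigma>]
  have iff: "\<sigma> x \<in> subcluster s (\<sigma> r) \<longleftrightarrow> x \<in> subcluster s r" if x: "x \<in> s" for x
  proof -
    have "x \<in> L" "r \<in> L" using x r s_subset by auto
    then have "\<sigma> x = \<sigma> r \<longleftrightarrow> x = r" "x \<noteq> r \<Longrightarrow> v (\<sigma> x - \<sigma> r) = v (x - r)"
      using gal_inj[OF inertia_gal[OF i]] val_stab_diff[OF i] by auto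
    then show ?thesis using stab_closed[OF \<sigma> x] x by (auto simp: subcluster_def)
  qed
  have "\<sigma> ` s = s" using \<sigma> by (simp add: stab_def)
  show ?thesis
  proof (intro equalityI subsetI)
    fix y assume "y \<in> \<sigma> ` subcluster s r"
    then show "y \<in> subcluster s (\<sigma> r)" using iff by (auto simp: subcluster_def)
  next
    fix y assume y: "y \<in> subcluster s (\<sigma> r)"
    then have "y \<in> s" by (simp add: subcluster_def)
    then obtain x where "x \<in> s" "y = \<sigma> x" using \<open>\<sigma> ` s = s\<close> by blast
    then show "y \<in> \<sigma> ` subcluster s r" using iff y by blast
  qed
qed

text \<open>Averaging over the stabiliser, whose order is prime to \<open>p\<close>, gives a centre of \<open>s\<close> fixed by it.\<close>

lemma exists_fixed_center:
  obtains z where "z \<in> L" "\<And>\<sigma>. \<sigma> \<in> stab \<Longrightarrow> \<sigma> z = z" "\<And>r. r \<in> s \<Longrightarrow> r = z \<or> v (r - z) \<ge> d"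
proof -
  interpret S: subgroup stab J by (rule subgroup_stab)
  have fin: "finite stab" using finite_inertia finite_subset[of stab "inertia v L"] by (auto simp: stab_def)
  obtain q where q: "ram = card stab * q"
    using J.lagrange[OF subgroup_stab] by (simp add: Coset.order_def) (metis mult.commute)
  have np: "\<not> p dvd card stab" using tame q by (auto simp: tame_def)
  have h: "v (of_nat (card stab)) = 0" "of_nat (card stab) \<noteq> (0 :: 'k alg_closure)"
    using val_of_nat[OF np] np by (auto intro: Nat.gr0I)
  obtain r0 where r0: "r0 \<in> s" using depth_attained[OF R_finite s_proper] by blast
  have cl: "\<sigma> r0 \<in> s" "\<sigma> r0 \<in> L" if "\<sigma> \<in> stab" for \<sigma> using stab_closed[OF that r0] s_subset by auto
  define t where "t = (\<Sum>\<sigma>\<in>stab. \<sigma> r0)"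
  have tL: "t \<in> L" unfolding t_def using cl by (intro L_sum)
  define z where "z = t / of_nat (card stab)"
  show ?thesis
  proof (rule that[of z])
    show "z \<in> L" using tL by (simp add: z_def)
    show "\<sigma> z = z" if \<sigma>: "\<sigma> \<in> stab" for \<sigma>
    proof -
      note i = stab_inertia[OF \<sigma>]
      have cmp: "\<sigma> \<otimes>\<^bsub>J\<^esub> \<tau> = compose L \<sigma> \<tau>" if "\<tau> \<in> stab" for \<tau> using i stab_inertia[OF that] by simp
      have inj: "inj_on (compose L \<sigma>) stab"
        using J.inj_on_cmult[of \<sigma>] i cmp stab_inertia by (auto simp: inj_on_def)
      have sub: "compose L \<sigma> ` stab \<subseteq> stab" using S.m_closed[OF \<sigma>] cmp by auto
      have bij: "bij_betw (compose L \<sigma>) stab stab"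
        unfolding bij_betw_def using inj endo_inj_surj[OF fin sub inj] by blast
      have "\<sigma> t = (\<Sum>\<tau>\<in>stab. \<sigma> (\<tau> r0))" unfolding t_def using cl by (intro gal_sum inertia_gal i)
      also have "\<dots> = (\<Sum>\<tau>\<in>stab. compose L \<sigma> \<tau> r0)" using r0 s_subset by (intro sum.cong) auto
      also have "\<dots> = t" unfolding t_def by (rule sum.reindex_bij_betw[OF bij])
      finally have "\<sigma> t = t" .
      moreover have "\<sigma> (of_nat (card stab)) = of_nat (card stab)"
        using gal_to_ac[OF inertia_gal[OF i], of "of_nat (card stab)"] by simp
      ultimately show ?thesis using tL by (simp add: z_def gal_divide[OF inertia_gal[OF i]])
    qed
    fix r assume r: "r \<in> s"
    show "r = z \<or> v (r - z) \<ge> d"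
    proof (cases "r = z")
      case False
      \<comment> \<open>Up to the unit \<open>card stab\<close>, the difference \<open>r - z\<close>
        is a sum of differences of roots in \<open>s\<close>, each of valuation at least the
        depth.\<close>
      have eq: "of_nat (card stab) * (r - z) = (\<Sum>\<sigma>\<in>stab. r - \<sigma> r0)"
        using h by (simp add: z_def t_def sum_subtractf right_diff_distrib)
      have ge: "x = 0 \<or> v x \<ge> d \<Longrightarrow> y = 0 \<or> v y \<ge> d \<Longrightarrow> x + y = 0 \<or> v (x + y) \<ge> d" for x y
        using val_add[of x y] by (cases "x = 0"; cases "y = 0"; cases "x + y = 0") auto
      have gen: "sum f A = 0 \<or> v (sum f A) \<ge> d" if "finite A" "\<And>i. i \<in> A \<Longrightarrow> f i = 0 \<or> v (f i) \<ge> d" for f and A :: "('k alg_closure \<Rightarrow> 'k alg_closure) set"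
        using that
      proof (induction A rule: finite_induct)
        case (insert x F)
        then have "f x + sum f F = 0 \<or> v (f x + sum f F) \<ge> d" by (intro ge) auto
        then show ?case using insert.hyps by simp
      qed simp
      have "r - \<sigma> r0 = 0 \<or> v (r - \<sigma> r0) \<ge> d" if "\<sigma> \<in> stab" for \<sigma>
        using depth_le[OF R_finite s_proper r cl(1)[OF that]] by auto
      then have "of_nat (card stab) * (r - z) = 0 \<or> v (of_nat (card stab) * (r - z)) \<ge> d"
        unfolding eq by (rule gen[OF fin])
      then show ?thesis using False h by (simp add: val_mult)
    qed simp
  qed
qed

text \<open>Measured from the fixed centre \<open>z\<close>, an element of the stabiliser moves
  \<open>r\<close> by the same amount as \<open>y = r - z\<close>. If \<open>v y > d\<close>, this
  is too little to leave the child. If \<open>v y = d\<close>, the child is fixed exactly when the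
  ratio of \<open>y\<close> is congruent to 1, which the tame character decides: for
  \<open>h [^] j = g [^] (n * j)\<close> it means that \<open>d * n * j\<close> is an
  integer.\<close>

lemma odd_children_structure:
  assumes g: "tame_generator g"
    and n: "n = cluster_index v L s" and h: "h = g [^]\<^bsub>J\<^esub> n"
  defines "S \<equiv> odd_children v R s"
  shows "finite S" "bij_betw ((`) h) S S"
    "\<And>k c. c \<in> S \<Longrightarrow> (h [^]\<^bsub>J\<^esub> (k::nat)) ` c = ((`) h ^^ k) c"
    "\<exists>S\<^sub>0\<subseteq>S. card S\<^sub>0 \<le> 1 \<and> (\<forall>c\<in>S\<^sub>0. h ` c = c) \<and>
       (\<forall>c\<in>S - S\<^sub>0. \<forall>j. ((`) h ^^ j) c = c \<longleftrightarrow> denom (d * of_nat n) dvd j)"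
proof -
  interpret C: finite_cyclic J g ram using g by (simp add: tame_generator_def)
  have idx: "card (rcosets\<^bsub>J\<^esub> stab) = n"
    unfolding n cluster_index_def stab_group_eq by simp
  note sub = C.subgroup_of_index[OF subgroup_stab idx]
  have hs: "h \<in> stab" unfolding h using sub(3)[of n] by simp
  have hk: "h [^]\<^bsub>J\<^esub> k = g [^]\<^bsub>J\<^esub> (n * k)" "h [^]\<^bsub>J\<^esub> k \<in> stab" for k :: nat
  proof -
    show "h [^]\<^bsub>J\<^esub> k = g [^]\<^bsub>J\<^esub> (n * k)" unfolding h using C.gen_closed by (simp add: J.nat_pow_pow)
    then show "h [^]\<^bsub>J\<^esub> k \<in> stab" using sub(3)[of "n * k"] by simp
  qed
  have ch: "children v R s = subcluster s ` s" by (rule children_eq[OF R_finite s_proper])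
  have S: "c \<in> S \<longleftrightarrow> (\<exists>r\<in>s. c = subcluster s r) \<and> odd (card c)" for c
    unfolding S_def odd_children_def ch by auto
  have subS: "c \<subseteq> L" if "c \<in> S" for c using that s_subset by (auto simp: S subcluster_def)
  show finS: "finite S" unfolding S_def odd_children_def ch using finite_cluster[OF R_finite s_proper] by auto
  have inj_h: "inj_on \<sigma> L" if "\<sigma> \<in> stab" for \<sigma>
    using gal_inj[OF inertia_gal[OF stab_inertia[OF that]]] by (auto simp: inj_on_def)
  have map: "\<sigma> ` c \<in> S" if \<sigma>: "\<sigma> \<in> stab" and c: "c \<in> S" for \<sigma> c
  proof -
    obtain r where r: "r \<in> s" "c = subcluster s r" "odd (card c)" using c unfolding S by blast
    have "card (\<sigma> ` c) = card c" using subS[OF c] inj_h[OF \<sigma>] by (intro card_image) (rule inj_on_subset)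
    then show ?thesis unfolding S using r image_subcluster[OF \<sigma> r(1)] stab_closed[OF \<sigma> r(1)] by auto
  qed
  have inj: "inj_on ((`) h) S"
  proof (rule inj_onI)
    fix c c' assume "c \<in> S" "c' \<in> S" "h ` c = h ` c'"
    then show "c = c'" using inj_on_image_eq_iff[OF inj_h[OF hs]] subS by blast
  qed
  show "bij_betw ((`) h) S S"
    unfolding bij_betw_def using inj endo_inj_surj[OF finS _ inj] map[OF hs] by blast
  show pw: "(h [^]\<^bsub>J\<^esub> (k::nat)) ` c = ((`) h ^^ k) c" if c: "c \<in> S" for k c
  proof (induction k)
    case 0
    have "(\<lambda>x\<in>L. x) ` c = c" using subS[OF c] by (force simp: image_iff)
    then show ?case by simp
  next
    case (Suc k)
    have "h [^]\<^bsub>J\<^esub> Suc k = compose L h (h [^]\<^bsub>J\<^esub> k)"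
      using J.nat_pow_Suc2[of h k] stab_inertia[OF hs] stab_inertia[OF hk(2)] by simp
    then have "(h [^]\<^bsub>J\<^esub> Suc k) ` c = h ` ((h [^]\<^bsub>J\<^esub> k) ` c)" by (simp only: compose_image[OF subS[OF c]])
    then show ?case using Suc by simp
  qed
  obtain z where z: "z \<in> L" "\<And>\<sigma>. \<sigma> \<in> stab \<Longrightarrow> \<sigma> z = z" "\<And>r. r \<in> s \<Longrightarrow> r = z \<or> v (r - z) \<ge> d"
    using exists_fixed_center by blast
  \<comment> \<open>The centre lies in at most one of the disjoint open discs around the roots. It
    need not lie in any, and the child it meets may be even, so the set of fixed children so
    obtained may be empty.\<close>
  define central where "central = (\<lambda>r. r = z \<or> v (r - z) > d)"
  define S\<^sub>0 where "S\<^sub>0 = {c \<in> S. \<exists>r\<in>s. central r \<and> c = subcluster s r}"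
  have diff: "\<sigma> r - r = \<sigma> (r - z) - (r - z)" if "\<sigma> \<in> stab" "r \<in> s" for \<sigma> r
  proof -
    have "r \<in> L" using that s_subset by blast
    then have "\<sigma> (r - z) = \<sigma> r - \<sigma> z" using gal_diff[OF inertia_gal[OF stab_inertia[OF that(1)]] _ z(1)] by blast
    then show ?thesis using z(2)[OF that(1)] by simp
  qed
  have fixed_iff: "\<sigma> ` subcluster s r = subcluster s r \<longleftrightarrow> \<sigma> r = r \<or> v (\<sigma> r - r) > d" if "\<sigma> \<in> stab" "r \<in> s" for \<sigma> r
    unfolding image_subcluster[OF that]
    using subcluster_eq_iff[OF R_finite s_proper stab_closed[OF that] that(2)] by simp
  have 1: "S\<^sub>0 \<subseteq> S" by (auto simp: S\<^sub>0_def)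
  have 2: "card S\<^sub>0 \<le> 1"
  proof -
    have "c = c'" if cc: "c \<in> S\<^sub>0" "c' \<in> S\<^sub>0" for c c'
    proof -
      obtain r where r: "r \<in> s" "central r" "c = subcluster s r" using cc by (auto simp: S\<^sub>0_def)
      obtain r' where r': "r' \<in> s" "central r'" "c' = subcluster s r'" using cc by (auto simp: S\<^sub>0_def)
      have "r = z \<or> v (r - z) > d" "z = r' \<or> v (z - r') > d"
        using r(2) r'(2) val_diff_commute[of z r'] by (auto simp: central_def)
      then have "r = r' \<or> v (r - r') > d" by (rule val_gt_trans)
      then show ?thesis using r r' subcluster_eq_iff[OF R_finite s_proper r(1) r'(1)] by simp
    qed
    then show ?thesis using card_le_Suc0_iff_eq[of S\<^sub>0] finS by (simp add: S\<^sub>0_def)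
  qed
  have 3: "h ` c = c" if c0: "c \<in> S\<^sub>0" for c
  proof -
    obtain r where r: "r \<in> s" "central r" "c = subcluster s r" using c0 by (auto simp: S\<^sub>0_def)
    have "h r = r \<or> v (h r - r) > d"
    proof (cases "r = z")
      case False
      let ?y = "r - z"
      have y: "?y \<in> L" "?y \<noteq> 0" "v ?y > d" using r False z(1) s_subset by (auto simp: central_def)
      have vy: "v (h ?y) = v ?y" "h ?y \<noteq> 0"
        using val_inertia[OF stab_inertia[OF hs] y(1,2)] gal_nonzero[OF inertia_gal[OF stab_inertia[OF hs]] y(1,2)] by auto
      have "h ?y = ?y \<or> v (h ?y - ?y) \<ge> v ?y" using val_diff_ge[OF vy(2) y(2) vy(1)] .
      then have "h r - r = 0 \<or> v (h r - r) \<ge> v ?y" unfolding diff[OF hs r(1)] by simp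
      then show ?thesis using y(3) by auto
    qed (use z(2)[OF hs] in simp)
    then show ?thesis using fixed_iff[OF hs r(1)] r(3) by simp
  qed
  have 4: "((`) h ^^ j) c = c \<longleftrightarrow> denom (d * of_nat n) dvd j" if c: "c \<in> S - S\<^sub>0" for c j
  proof -
    obtain r where r: "r \<in> s" "c = subcluster s r" using c S[of c] by blast
    then have nc: "\<not> central r" using c by (auto simp: S\<^sub>0_def)
    let ?y = "r - z" and ?\<sigma> = "h [^]\<^bsub>J\<^esub> j"
    \<comment> \<open>Not being central turns the bound for \<open>v (r - z)\<close> into equality
      with the depth, the only case in which the tame character sees the depth.\<close>
    have y: "?y \<in> L" "?y \<noteq> 0" "v ?y = d" using r nc z(1) z(3)[OF r(1)] s_subset by (auto simp: central_def)
    obtain a where a: "of_nat ram * d = of_int a" using ram_val_int[OF y(1,2)] y(3) by (auto elim: Ints_cases)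
    have "((`) h ^^ j) c = c \<longleftrightarrow> ?\<sigma> r = r \<or> v (?\<sigma> r - r) > d"
      using pw[of c j] c fixed_iff[OF hk(2) r(1), of j] r(2) by simp
    also have "\<dots> \<longleftrightarrow> ?\<sigma> r - r = 0 \<or> v (?\<sigma> r - r) > d" by simp
    also have "\<dots> \<longleftrightarrow> ?\<sigma> ?y - ?y = 0 \<or> v (?\<sigma> ?y - ?y) > d" unfolding diff[OF hk(2) r(1), of j] ..
    also have "\<dots> \<longleftrightarrow> ?\<sigma> ?y / ?y - 1 \<in> maximal"
    proof -
      have e: "?\<sigma> ?y / ?y - 1 = (?\<sigma> ?y - ?y) / ?y" using y by (simp add: diff_divide_distrib)
      show ?thesis
      proof (cases "?\<sigma> ?y - ?y = 0")
        case False
        then have "v ((?\<sigma> ?y - ?y) / ?y) = v (?\<sigma> ?y - ?y) - d" using y val_divide by metis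
        then show ?thesis unfolding e using False y(2) by (simp add: maximal_def)
      qed (unfold e, simp)
    qed
    also have "\<dots> \<longleftrightarrow> int ram dvd int (n * j) * a"
      unfolding hk(1) using g y a by (simp add: tame_generator_def)
    also have "\<dots> \<longleftrightarrow> d * of_nat n * of_nat j \<in> \<int>"
    proof -
      have r0: "(of_nat ram :: rat) > 0" using ram_pos by simp
      have da: "d = of_int a / of_nat ram" using a r0 by (simp add: field_simps)
      show ?thesis
      proof
        assume "int ram dvd int (n * j) * a"
        then obtain c where "int (n * j) * a = int ram * c" by (auto elim: dvdE)
        then have "of_int (int (n * j) * a) = (of_int (int ram * c) :: rat)" by simp
        then have "d * of_nat n * of_nat j = of_int c" unfolding da using r0 by (simp add: field_simps)
        then show "d * of_nat n * of_nat j \<in> \<int>" by simp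
      next
        assume "d * of_nat n * of_nat j \<in> \<int>"
        then obtain c where "d * of_nat n * of_nat j = of_int c" by (auto elim: Ints_cases)
        then have "of_int (int (n * j) * a) = (of_int (int ram * c) :: rat)" unfolding da using r0 by (simp add: field_simps)
        then have "int (n * j) * a = int ram * c" by (simp only: of_int_eq_iff)
        then show "int ram dvd int (n * j) * a" by simp
      qed
    qed
    also have "\<dots> \<longleftrightarrow> denom (d * of_nat n) dvd j" by (rule denom_dvd_iff[symmetric])
    finally show ?thesis .
  qed
  show "\<exists>S\<^sub>0\<subseteq>S. card S\<^sub>0 \<le> 1 \<and> (\<forall>c\<in>S\<^sub>0. h ` c = c) \<and>
       (\<forall>c\<in>S - S\<^sub>0. \<forall>j. ((`) h ^^ j) c = c \<longleftrightarrow> denom (d * of_nat n) dvd j)"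
    by (intro exI[of _ S\<^sub>0] conjI ballI allI 1 2 3 4)
qed

end

section \<open>Assembling the multiplicities\<close>

lemma val_of_nat_Qp:
  fixes v :: "('k::field_char_0) alg_closure \<Rightarrow> rat"
  assumes K: "finite_extension_of_Qp p (\<lambda>x. v (to_ac x))" and m: "\<not> p dvd m"
  shows "v (of_nat m) = 0"
proof -
  obtain e where e: "\<And>q. q \<noteq> 0 \<Longrightarrow> v (to_ac (of_rat q :: 'k)) = e * of_int (rat_val p q)"
    using K by (auto simp: finite_extension_of_Qp_def is_Qp_def)
  have "\<not> int p dvd int m" using m by simp
  then have "multiplicity (int p) (int m) = 0" by (rule not_dvd_imp_multiplicity_0)
  then have "rat_val p (of_nat m) = 0" by (simp add: rat_val_def quotient_of_int[of "int m", simplified])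
  moreover have "(of_nat m :: rat) \<noteq> 0" using m by (auto intro: Nat.gr0I)
  ultimately have "v (to_ac (of_rat (of_nat m) :: 'k)) = 0" using e[of "of_nat m"] by simp
  then show ?thesis by simp
qed

lemma twist_char_rep: "twist \<gamma> (char_rep \<chi>) = char_rep (\<lambda>g. \<gamma> g * \<chi> g)"
  by (simp add: twist_def char_rep_def cscale_def fun_eq_iff mult.assoc)

lemma (in finite_cyclic) characters_agree_iff:
  assumes "\<And>k::nat. \<chi> (g [^] k) = \<chi> g ^ k" "\<And>k::nat. \<eta> (g [^] k) = \<eta> g ^ k"
  shows "(\<forall>x\<in>carrier G. \<chi> x = \<eta> x) \<longleftrightarrow> \<chi> g = \<eta> g"
proof
  assume "\<chi> g = \<eta> g"
  then show "\<forall>x\<in>carrier G. \<chi> x = \<eta> x" unfolding carrier_range using assms by auto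
qed simp

lemma floor_divide_of_nat:
  assumes "l > 0" shows "\<lfloor>of_nat N / of_nat l :: rat\<rfloor> = int (N div l)"
  using floor_divide_of_nat_eq[of N l, where ?'a = rat] by simp

theorem theorem4p7:
  fixes p :: nat
    and v :: "('k::field_char_0) alg_closure \<Rightarrow> rat"
    and f :: "'k poly"
    and L R \<ss> :: "'k alg_closure set"
    and \<gamma> :: "('k alg_closure \<Rightarrow> 'k alg_closure) \<Rightarrow> complex"
    and \<epsilon> :: "('k alg_closure \<Rightarrow> 'k alg_closure, unit) repr"
    and I I\<^sub>s :: "('k alg_closure \<Rightarrow> 'k alg_closure) monoid"
    and n n' N t :: nat
  assumes p: "prime p" "odd p"
    and K: "finite_extension_of_Qp p (\<lambda>x. v (to_ac x))"
    and v: "is_valuation v" "v ` (to_ac ` (UNIV - {0})) = \<int>"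
    and f: "lead_coeff f = 1" "squarefree f" "tame_reduction p v f"
    and L: "finite_galois L" "split_field f \<subseteq> L" "tame p v L"
    and R: "R = roots f"
    and s: "proper_cluster v R \<ss>"
    and I: "I = inertia_group v L" "I\<^sub>s = stab_group v L \<ss>"
    and gamma: "is_gamma p v L R \<ss> \<gamma>" "char_order I\<^sub>s \<gamma> = t"
    and eps: "is_eps v L R \<ss> \<epsilon>"
    and n: "n = cluster_index v L \<ss>"
    and n': "n' = denom (depth v \<ss> * of_nat n)"
    and N: "N = card (odd_children v R \<ss>)"
  shows "(\<forall>m>0.
            of_int (signed_constituents I (virt_ind I I\<^sub>s (cluster_rep v L R \<ss> \<gamma> \<epsilon>)) m) =
            of_nat (totient m) *
              (of_int \<lfloor>of_nat N / of_nat n' :: rat\<rfloor> *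
                 (\<Sum>d | d dvd n'. \<Sum>s\<in>S_set d t. \<Sum>n\<^sub>1 | n\<^sub>1 dvd n div gcd_inf n s.
                    alpha d t s * beta n s * rho_coeff (s * gcd_inf n s * n\<^sub>1) m) +
               (of_nat N - of_nat n' * of_int \<lfloor>of_nat N / of_nat n' :: rat\<rfloor> - 1) *
                 (beta n t / of_nat (totient t)) *
                 (\<Sum>n\<^sub>2 | n\<^sub>2 dvd n div gcd_inf n t. rho_coeff (t * n\<^sub>2 * gcd_inf n t) m)) -
            of_nat (num_constituents I (ind I I\<^sub>s \<epsilon>) m)) \<and>
         (\<epsilon> = zero_rep \<longrightarrow> rep_iso I (ind I I\<^sub>s \<epsilon>) zero_rep) \<and>
         (\<epsilon> = char_rep (triv_char I\<^sub>s) \<longrightarrow>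
            rep_iso I (ind I I\<^sub>s \<epsilon>) (rep_Sum {m. m dvd n} (rho I))) \<and>
         ((\<exists>\<chi>\<in>chars_of_order I\<^sub>s 2. \<epsilon> = char_rep \<chi>) \<longrightarrow>
            rep_iso I (ind I I\<^sub>s \<epsilon>) (rep_Sum {m. m dvd 2 * n \<and> \<not> m dvd n} (rho I)))"
proof -
  have f0: "f \<noteq> 0" using f(1) by auto
  interpret valued_field v by unfold_locales (rule v(1))
  interpret tame_galois v p L
    by unfold_locales (use v(2) L val_of_nat_Qp[OF K] in auto)
  have RL: "R \<subseteq> L" using L(2) unfolding R split_field_def by (auto intro: generate_field.incl)
  have finR: "finite R" unfolding R roots_def
  proof (rule poly_roots_finite)
    show "map_poly to_ac f \<noteq> 0" using f0 by (auto simp: poly_eq_iff coeff_map_poly)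
  qed
  interpret tame_cluster v p L R \<ss>
    by unfold_locales (use finR RL s in auto)
  obtain g where g: "tame_generator g" using exists_tame_generator by blast
  interpret C: finite_cyclic J g ram using g by (simp add: tame_generator_def)
  have idx: "card (rcosets\<^bsub>J\<^esub> stab) = n" unfolding n cluster_index_def stab_group_eq by simp
  note sub = C.subgroup_of_index[OF subgroup_stab idx]
  have Is: "I\<^sub>s = J\<lparr>carrier := stab\<rparr>" unfolding I(2) by (rule stab_group_eq)
  have carIs: "carrier I\<^sub>s = stab" unfolding Is by simp
  define h where "h = g [^]\<^bsub>J\<^esub> n"
  interpret H: finite_cyclic I\<^sub>s h "ram div n" unfolding Is h_def by (rule sub(4))
  have subH: "subgroup (carrier I\<^sub>s) J" unfolding carIs by (rule subgroup_stab)
  have Hpow: "h [^]\<^bsub>I\<^sub>s\<^esub> k = h [^]\<^bsub>J\<^esub> k" "h [^]\<^bsub>J\<^esub> k = g [^]\<^bsub>J\<^esub> (n * k)" for k :: nat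
    unfolding Is h_def using C.gen_closed by (simp_all add: J.nat_pow_pow flip: J.nat_pow_consistent)
  have \<gamma>: "\<gamma> \<in> characters I\<^sub>s" using gamma(1) unfolding is_gamma_def I(2) by (simp add: chars_of_order_def)
  define c where "c = \<gamma> h"
  have ct: "has_order c t" unfolding c_def using H.char_order_eq_iff[OF \<gamma>, of t] gamma(2) by blast
  have c0: "c \<noteq> 0" using ct by (rule has_order_nonzero)
  have n0: "n > 0" by (rule sub(2))
  have n'0: "n' > 0" unfolding n' by (rule denom_pos)
  \<comment> \<open>The depth is the valuation of a difference of two roots in \<open>L\<close>, so
    \<open>ram\<close> times it is an integer.\<close>
  have n'M: "n' dvd ram div n"
  proof -
    obtain r r' where r: "r \<in> \<ss>" "r' \<in> \<ss>" "r \<noteq> r'" "v (r - r') = depth v \<ss>"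
      using depth_attained[OF finR s] by blast
    then have "r \<in> L" "r' \<in> L" using s_subset by auto
    then have "of_nat ram * depth v \<ss> \<in> \<int>" using r ram_val_int[of "r - r'"] by simp
    moreover have "depth v \<ss> * of_nat n * of_nat (ram div n) = of_nat ram * depth v \<ss>"
      using sub(1) by (simp add: mult.assoc flip: of_nat_mult)
    ultimately show ?thesis unfolding n' denom_dvd_iff by (simp only:)
  qed
  let ?S = "odd_children v R \<ss>"
  note oc = odd_children_structure[OF g n h_def]
  from oc(4)[folded n'] obtain S\<^sub>0 where S0': "S\<^sub>0 \<subseteq> ?S \<and> card S\<^sub>0 \<le> 1 \<and> (\<forall>x\<in>S\<^sub>0. h ` x = x) \<and>
    (\<forall>x\<in>?S - S\<^sub>0. \<forall>j. ((`) h ^^ j) x = x \<longleftrightarrow> n' dvd j)" by (rule exE)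
  then have S0: "S\<^sub>0 \<subseteq> ?S" "card S\<^sub>0 \<le> 1" "\<forall>x\<in>S\<^sub>0. h ` x = x"
    "\<forall>x\<in>?S - S\<^sub>0. \<forall>j. ((`) h ^^ j) x = x \<longleftrightarrow> n' dvd j" by simp_all
  have hS: "(`) h ` ?S \<subseteq> ?S" using oc(2) by (simp add: bij_betw_def)
  obtain a where a: "card ?S = n' * a + card S\<^sub>0"
    "\<And>\<xi>. \<xi> \<noteq> 0 \<Longrightarrow> cs.dim {F. (\<forall>x. x \<notin> ?S \<longrightarrow> F x = 0) \<and> (\<forall>y\<in>?S. F (h ` y) = \<xi> * F y)} =
       (if \<xi> ^ n' = 1 then a else 0) + (if \<xi> = 1 then card S\<^sub>0 else 0)"
    using dim_permutation_eigenspace[OF oc(1) hS S0(1,3,4) n'0] by blast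
  have \<eta>pow: "\<eta> (h [^]\<^bsub>I\<^sub>s\<^esub> k) = (\<eta> g ^ n) ^ k" if "\<eta> \<in> characters J" for \<eta> and k :: nat
    unfolding Hpow using C.character_pow[OF that] by (simp add: power_mult)
  have \<eta>h: "\<eta> h = \<eta> g ^ n" if "\<eta> \<in> characters J" for \<eta> using \<eta>pow[OF that, of 1] by simp
  have \<eta>0: "\<eta> g ^ n \<noteq> 0" if "\<eta> \<in> characters J" for \<eta> using that C.gen_closed by (auto simp: characters_def)
  have agree: "(\<forall>x\<in>carrier I\<^sub>s. \<chi> x = \<eta> x) \<longleftrightarrow> \<eta> g ^ n = \<chi> h"
    if "\<eta> \<in> characters J" "\<chi> \<in> characters I\<^sub>s" for \<eta> \<chi>
    using H.characters_agree_iff[of \<chi> \<eta>] H.character_pow[OF that(2)] \<eta>pow[OF that(1)] \<eta>h[OF that(1)] by auto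
  have triv: "triv_char I\<^sub>s \<in> characters I\<^sub>s" by (auto simp: characters_def triv_char_def)
  let ?V = "twist \<gamma> (perm_rep (\<lambda>\<sigma> c. \<sigma> ` c) ?S)"
  let ?W = "twist \<gamma> (char_rep (triv_char I\<^sub>s))"
  \<comment> \<open>With \<open>w = \<eta> g\<close>, a full orbit contributes to
    \<open>\<eta>\<close> when \<open>w ^ n / c\<close> is an \<open>n'\<close>-th root of unity,
    the fixed child when \<open>w ^ n = c\<close>; \<open>a\<close> is the number of full
    orbits.\<close>
  have mult1: "char_mult J (ind J I\<^sub>s ?V) \<eta> =
    (if (\<eta> g ^ n / c) ^ n' = 1 then a else 0) + (if \<eta> g ^ n = c then card S\<^sub>0 else 0)"
    if \<eta>: "\<eta> \<in> characters J" for \<eta>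
  proof -
    have "char_mult J (ind J I\<^sub>s ?V) \<eta> = char_mult I\<^sub>s ?V \<eta>"
      by (rule char_mult_ind[OF group_J subH \<eta> linear_rep_twist[OF linear_rep_perm_rep[OF oc(1)]]])
    also have "\<dots> = cs.dim {F. (\<forall>x. x \<notin> ?S \<longrightarrow> F x = 0) \<and> (\<forall>y\<in>?S. F (h ` y) = (c / \<eta> g ^ n) * F y)}"
      unfolding char_mult_eq_dim c_def
      by (subst eigenspace_twist_perm_rep[OF H.finite_cyclic_axioms oc(1) \<gamma>, where e = "\<eta> g ^ n" and \<tau> = "(`) h"])
         (use \<eta>pow[OF \<eta>] \<eta>0[OF \<eta>] oc(2,3) in \<open>simp_all add: Hpow(1)\<close>)
    also have "\<dots> = (if (c / \<eta> g ^ n) ^ n' = 1 then a else 0) + (if c / \<eta> g ^ n = 1 then card S\<^sub>0 else 0)"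
      using c0 \<eta>0[OF \<eta>] by (intro a(2)) simp
    also have "(c / \<eta> g ^ n) ^ n' = 1 \<longleftrightarrow> (\<eta> g ^ n / c) ^ n' = 1"
      using c0 \<eta>0[OF \<eta>] by (auto simp: power_divide)
    also have "c / \<eta> g ^ n = 1 \<longleftrightarrow> \<eta> g ^ n = c" using \<eta>0[OF \<eta>] by auto
    finally show ?thesis .
  qed
  have eps_cases: "\<epsilon> = zero_rep \<or> (\<exists>\<chi>\<in>characters I\<^sub>s. \<epsilon> = char_rep \<chi>)"
    using eps triv unfolding is_eps_def Let_def I(2)[symmetric] by (auto simp: chars_of_order_def split: if_splits)
  have lin_eps: "linear_rep I\<^sub>s \<epsilon>" using eps_cases linear_rep_zero_rep linear_rep_char_rep by auto
  have mult2: "char_mult J (ind J I\<^sub>s (rep_plus ?W \<epsilon>)) \<eta> =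
    (if \<eta> g ^ n = c then 1 else 0) + char_mult J (ind J I\<^sub>s \<epsilon>) \<eta>" if \<eta>: "\<eta> \<in> characters J" for \<eta>
  proof -
    have linW: "linear_rep I\<^sub>s ?W" by (intro linear_rep_twist linear_rep_char_rep)
    \<comment> \<open>In every case of \<open>\<epsilon>\<close> its eigenspace is a coordinate
      subspace, which is the form in which multiplicities of direct sums can be added.\<close>
    obtain B :: "unit set" where B: "eigenspace I\<^sub>s \<epsilon> \<eta> = {F. \<forall>x. x \<notin> B \<longrightarrow> F x = 0}"
    proof -
      have "\<exists>B. eigenspace I\<^sub>s \<epsilon> \<eta> = {F. \<forall>x. x \<notin> B \<longrightarrow> F x = 0}"
        using eps_cases
      proof
        assume "\<exists>\<chi>\<in>characters I\<^sub>s. \<epsilon> = char_rep \<chi>"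
        then obtain \<chi> where "\<epsilon> = char_rep \<chi>" by blast
        then show ?thesis by (simp only: eigenspace_char_rep) (rule exI, rule refl)
      qed (simp only: eigenspace_zero_rep, rule exI, rule refl)
      then show ?thesis using that by blast
    qed
    have "(\<forall>x\<in>carrier I\<^sub>s. \<gamma> x * triv_char I\<^sub>s x = \<eta> x) \<longleftrightarrow> \<eta> g ^ n = c"
      using agree[OF \<eta> \<gamma>] by (simp add: triv_char_def c_def)
    then have A: "eigenspace I\<^sub>s ?W \<eta> = {F. \<forall>x. x \<notin> (if \<eta> g ^ n = c then UNIV else {}) \<longrightarrow> F x = 0}"
      unfolding twist_char_rep eigenspace_char_rep by simp
    have "char_mult I\<^sub>s (rep_plus ?W \<epsilon>) \<eta> = card (if \<eta> g ^ n = c then UNIV else {} :: unit set) + card B"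
      by (rule char_mult_rep_plus_supported[OF A B]) auto
    also have "card B = char_mult I\<^sub>s \<epsilon> \<eta>" unfolding char_mult_eq_dim B by (rule dim_supported[symmetric]) simp
    finally show ?thesis
      using char_mult_ind[OF group_J subH \<eta> linear_rep_rep_plus[OF linW lin_eps]]
        char_mult_ind[OF group_J subH \<eta> lin_eps] by simp
  qed
  have main: "of_int (signed_constituents I (virt_ind I I\<^sub>s (cluster_rep v L R \<ss> \<gamma> \<epsilon>)) m) =
            of_nat (totient m) *
              (of_int \<lfloor>of_nat N / of_nat n' :: rat\<rfloor> *
                 (\<Sum>d | d dvd n'. \<Sum>s\<in>S_set d t. \<Sum>n\<^sub>1 | n\<^sub>1 dvd n div gcd_inf n s.
                    alpha d t s * beta n s * rho_coeff (s * gcd_inf n s * n\<^sub>1) m) +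
               (of_nat N - of_nat n' * of_int \<lfloor>of_nat N / of_nat n' :: rat\<rfloor> - 1) *
                 (beta n t / of_nat (totient t)) *
                 (\<Sum>n\<^sub>2 | n\<^sub>2 dvd n div gcd_inf n t. rho_coeff (t * n\<^sub>2 * gcd_inf n t) m)) -
            of_nat (num_constituents I (ind I I\<^sub>s \<epsilon>) m)" if m: "m > 0" for m
  proof -
    let ?Z = "{w :: complex. w ^ ram = 1 \<and> has_order w m}"
    let ?A = "{w :: complex. has_order w m \<and> (w ^ n / c) ^ n' = 1}"
    let ?B = "{w :: complex. has_order w m \<and> w ^ n = c}"
    have fin: "finite ?Z" by (rule finite_subset[OF _ finite_has_order[of m]]) auto
    have cM: "c ^ (ram div n) = 1" using H.character_root[OF \<gamma>] by (simp add: c_def)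
    \<comment> \<open>By \<open>n'M\<close> the conditions on \<open>w\<close> already force
      \<open>w ^ ram = 1\<close>, so every such \<open>w\<close> comes from a character of inertia
      and the count may run over all complex roots of unity of order \<open>m\<close>.\<close>
    have ramA: "w ^ ram = 1" if "(w ^ n / c) ^ n' = 1" for w :: complex
    proof -
      obtain k where k: "ram div n = n' * k" using n'M by (auto elim: dvdE)
      have "(w ^ n / c) ^ (ram div n) = 1" unfolding k power_mult that by simp
      then have "(w ^ n) ^ (ram div n) = 1" using cM by (simp add: power_divide)
      then show ?thesis using sub(1) by (simp flip: power_mult)
    qed
    have ramB: "(w ^ n / c) ^ n' = 1" if "w ^ n = c" for w :: complex using that c0 by simp
    have setA: "{w \<in> ?Z. (w ^ n / c) ^ n' = 1} = ?A" using ramA by auto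
    have setB: "{w \<in> ?Z. w ^ n = c} = ?B" using ramA ramB by auto
    have num1: "num_constituents J (ind J I\<^sub>s ?V) m = a * card ?A + card S\<^sub>0 * card ?B"
    proof -
      have "num_constituents J (ind J I\<^sub>s ?V) m =
        (\<Sum>w\<in>?Z. (if (w ^ n / c) ^ n' = 1 then a else 0) + (if w ^ n = c then card S\<^sub>0 else 0))"
        by (rule C.num_constituents_eq[OF mult1])
      also have "\<dots> = (\<Sum>w\<in>{w \<in> ?Z. (w ^ n / c) ^ n' = 1}. a) + (\<Sum>w\<in>{w \<in> ?Z. w ^ n = c}. card S\<^sub>0)"
        unfolding sum.distrib sum.inter_filter[OF fin] ..
      finally show ?thesis unfolding setA setB by simp
    qed
    have num2: "num_constituents J (ind J I\<^sub>s (rep_plus ?W \<epsilon>)) m = card ?B + num_constituents J (ind J I\<^sub>s \<epsilon>) m"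
    proof -
      have "num_constituents J (ind J I\<^sub>s (rep_plus ?W \<epsilon>)) m =
        (\<Sum>\<eta>\<in>chars_of_order J m. (if \<eta> g ^ n = c then 1 else 0) + char_mult J (ind J I\<^sub>s \<epsilon>) \<eta>)"
        unfolding num_constituents_def by (intro sum.cong refl mult2) (simp add: chars_of_order_def)
      also have "\<dots> = (\<Sum>\<eta>\<in>chars_of_order J m. if \<eta> g ^ n = c then 1 else 0) + num_constituents J (ind J I\<^sub>s \<epsilon>) m"
        unfolding num_constituents_def by (rule sum.distrib)
      also have "(\<Sum>\<eta>\<in>chars_of_order J m. if \<eta> g ^ n = c then 1 else (0 :: nat)) = (\<Sum>w\<in>?Z. if w ^ n = c then 1 else 0)"
        by (rule sum.reindex_bij_betw[OF C.bij_betw_chars_of_order])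
      also have "\<dots> = card ?B" unfolding sum.inter_filter[OF fin, symmetric] setB by simp
      finally show ?thesis .
    qed
    have "signed_constituents I (virt_ind I I\<^sub>s (cluster_rep v L R \<ss> \<gamma> \<epsilon>)) m =
      int (num_constituents J (ind J I\<^sub>s ?V) m) - int (num_constituents J (ind J I\<^sub>s (rep_plus ?W \<epsilon>)) m)"
      by (simp add: signed_constituents_def virt_ind_def cluster_rep_def virt_minus_def virt_twist_def I)
    then have lhs: "of_int (signed_constituents I (virt_ind I I\<^sub>s (cluster_rep v L R \<ss> \<gamma> \<epsilon>)) m) =
      of_nat a * of_nat (card ?A) + of_nat (card S\<^sub>0) * of_nat (card ?B) - of_nat (card ?B)
        - (of_nat (num_constituents J (ind J I\<^sub>s \<epsilon>) m) :: rat)"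
      unfolding num1 num2 by simp
    have NS: "N = n' * a + card S\<^sub>0" unfolding N using a(1) .
    have fl: "(of_int \<lfloor>of_nat N / of_nat n' :: rat\<rfloor> :: rat) = of_nat (N div n')"
      using floor_divide_of_nat[OF n'0, of N] by simp
    have "of_nat a * of_nat (card ?A) + of_nat (card S\<^sub>0) * of_nat (card ?B) - (of_nat (card ?B) :: rat) =
      of_nat (N div n') * of_nat (card ?A) + (of_nat N - of_nat n' * of_nat (N div n') - 1) * of_nat (card ?B)"
    \<comment> \<open>\<open>N div n'\<close> equals \<open>a\<close> only if the fixed child is a
      proper remainder, that is for \<open>n' > 1\<close>; for \<open>n' = 1\<close> it is
      \<open>a + card S\<^sub>0\<close>, but then \<open>?A = ?B\<close>.\<close>
    proof (cases "n' = 1")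
      case True
      have "?A = ?B" using True c0 by (auto simp: field_simps)
      then show ?thesis using True NS by (simp add: algebra_simps)
    next
      case False
      then have "card S\<^sub>0 < n'" using S0(2) n'0 by linarith
      then have "N div n' = a" using NS by simp
      then show ?thesis using NS by (simp add: algebra_simps)
    qed
    then have "of_int (signed_constituents I (virt_ind I I\<^sub>s (cluster_rep v L R \<ss> \<gamma> \<epsilon>)) m) =
      of_nat (N div n') * of_nat (card ?A) + (of_nat N - of_nat n' * of_nat (N div n') - 1) * of_nat (card ?B)
        - (of_nat (num_constituents I (ind I I\<^sub>s \<epsilon>) m) :: rat)"
      unfolding lhs by (simp only: I(1))
    moreover have alg: "q * (T * x) + r * (T * b * y) - u = T * (q * x + r * b * y) - u" for q T x r b y u :: rat
      by (simp add: algebra_simps)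
    ultimately show ?thesis
      unfolding fl card_order_fibre[OF ct n0 m] card_order_fibre_twist[OF ct n0 m n'0] by (simp only: alg)
  qed
  \<comment> \<open>A character of inertia with value \<open>w\<close> at \<open>g\<close> has value
    \<open>w ^ n\<close> at the generator \<open>h\<close> of the stabiliser, so restricting to
    \<open>\<chi>\<close> means \<open>w ^ n = \<chi> h\<close>; \<open>D\<close> has to express
    this through the order of \<open>w\<close>.\<close>
  have iso: "rep_iso I (ind I I\<^sub>s (char_rep \<chi>)) (rep_Sum D (rho I))"
    if \<chi>: "\<chi> \<in> characters I\<^sub>s" and D: "\<And>w d. has_order w d \<Longrightarrow> d \<in> D \<longleftrightarrow> w ^ n = \<chi> h" for \<chi> D
    unfolding I(1)
  proof (rule C.rep_iso_ind_char[OF subH])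
    fix \<eta> assume \<eta>: "\<eta> \<in> characters J"
    have "has_order (\<eta> g) (char_order J \<eta>)" using C.char_order_eq_iff[OF \<eta>] by blast
    then have "char_order J \<eta> \<in> D \<longleftrightarrow> \<eta> g ^ n = \<chi> h" by (rule D)
    then show "char_order J \<eta> \<in> D \<longleftrightarrow> (\<forall>x\<in>carrier I\<^sub>s. \<eta> x = \<chi> x)"
      using agree[OF \<eta> \<chi>] by (auto simp: eq_commute)
  qed
  have "rep_iso I (ind I I\<^sub>s \<epsilon>) (rep_Sum {m. m dvd n} (rho I))" if "\<epsilon> = char_rep (triv_char I\<^sub>s)"
    unfolding that
  proof (rule iso[OF triv])
    have "triv_char I\<^sub>s h = 1" using H.gen_closed by (simp add: triv_char_def)
    then show "d \<in> {m. m dvd n} \<longleftrightarrow> w ^ n = triv_char I\<^sub>s h" if "has_order w d" for w :: complex and d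
      using has_orderD[OF that] by simp
  qed
  moreover have "rep_iso I (ind I I\<^sub>s \<epsilon>) (rep_Sum {m. m dvd 2 * n \<and> \<not> m dvd n} (rho I))"
    if \<chi>: "\<chi> \<in> chars_of_order I\<^sub>s 2" "\<epsilon> = char_rep \<chi>" for \<chi>
    unfolding \<chi>(2)
  proof (rule iso)
    show c: "\<chi> \<in> characters I\<^sub>s" using \<chi>(1) by (simp add: chars_of_order_def)
    have o: "has_order (\<chi> h) 2" using H.char_order_eq_iff[OF c, of 2] \<chi>(1) by (simp add: chars_of_order_def)
    have "\<chi> h ^ 2 = 1" "\<chi> h \<noteq> 1" using has_orderD[OF o, of 2] has_orderD[OF o, of 1] by auto
    then have \<chi>h: "\<chi> h = - 1" by (simp add: power2_eq_1_iff)
    \<comment> \<open>The only square root of 1 other than 1 is \<open>- 1\<close>, so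
      \<open>w ^ n = - 1\<close> says that \<open>2 * n\<close> kills \<open>w\<close> and
      \<open>n\<close> does not.\<close>
    show "d \<in> {m. m dvd 2 * n \<and> \<not> m dvd n} \<longleftrightarrow> w ^ n = \<chi> h" if "has_order w d" for w :: complex and d
    proof -
      have "w ^ (2 * n) = (w ^ n) ^ 2" by (metis mult.commute power_mult)
      then have "w ^ (2 * n) = 1 \<and> w ^ n \<noteq> 1 \<longleftrightarrow> w ^ n = - 1" by (auto simp: power2_eq_1_iff)
      then show ?thesis unfolding \<chi>h using has_orderD[OF that] by simp
    qed
  qed
  moreover have "rep_iso I (ind I I\<^sub>s \<epsilon>) zero_rep" if "\<epsilon> = zero_rep"
    unfolding that I(1) by (rule rep_iso_ind_zero[OF group_J])
  ultimately show ?thesis using main by blast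
qed

end
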